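(* Suppose that $N$ is a finitely generated free nilpotent group of class $\ge 2$. Then the first-order theory of the group $\operatorname{Aut}(N)$ is unstable and undecidable.
   Context: A free nilpotent group of class $s$ is a group of the form $F/\gamma_{s+1}(F)$ with $F$ a free group and $\gamma_k(F)$ the $k$-th term of the lower central series of $F$ ($\gamma_1(F)=F$). The rank of $F$ is at least $2$, so that for $s\ge 2$ the nilpotency class is exactly $s$; finitely generated means $F$ has finite rank. $\operatorname{Aut}(N)$ is considered as a structure in the first-order language of groups; its first-order theory is the set of first-order sentences true in it. Unstable and undecidable have their usual meanings (model-theoretic stability; algorithmic decidability). *)

theory Defs
  imports "HOL-Algebra.Bij" "HOL-Algebra.Generated_Groups" "HOL-Library.Nat_Bijection" "HOL-Library.Countable_Set"
begin

section \<open>Free groups\<close>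

text \<open>The free group on \<open>X\<close>, realised on the set of reduced words. The letter \<open>(x, True)\<close> stands for
  the generator \<open>x\<close> and \<open>(x, False)\<close> for its inverse.\<close>

fun reduced :: "('x \<times> bool) list \<Rightarrow> bool" where
  "reduced [] \<longleftrightarrow> True"
| "reduced [l] \<longleftrightarrow> True"
| "reduced (l # m # w) \<longleftrightarrow> \<not> (fst l = fst m \<and> snd l \<noteq> snd m) \<and> reduced (m # w)"

fun cons_red :: "'x \<times> bool \<Rightarrow> ('x \<times> bool) list \<Rightarrow> ('x \<times> bool) list" where
  "cons_red l [] = [l]"
| "cons_red l (m # w) = (if fst l = fst m \<and> snd l \<noteq> snd m then w else l # m # w)"

definition free_group :: "'x set \<Rightarrow> ('x \<times> bool) list monoid" where
  "free_group X =
     \<lparr>carrier = {w \<in> lists (X \<times> UNIV). reduced w}, mult = foldr cons_red, one = []\<rparr>"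

lemma reduced_Cons: "reduced (l # w) \<Longrightarrow> reduced w"
  by (cases w) auto

lemma reduced_cons_red: "reduced w \<Longrightarrow> reduced (cons_red l w)"
  by (cases w) (auto dest: reduced_Cons)

lemma cons_red_cancel:
  assumes "reduced w" "fst l = fst m" "snd l \<noteq> snd m"
  shows "cons_red l (cons_red m w) = w"
proof (cases w)
  case Nil
  then show ?thesis using assms by simp
next
  case (Cons k u)
  have "l = k" if "fst m = fst k" "snd m \<noteq> snd k"
    using that assms by (auto simp: prod_eq_iff)
  then show ?thesis
    using assms Cons by (cases u) auto
qed

lemma cons_red_reduced: "reduced (l # w) \<Longrightarrow> cons_red l w = l # w"
  by (cases w) auto

lemma reduced_foldr: "reduced v \<Longrightarrow> reduced (foldr cons_red u v)"
  by (induction u) (auto intro: reduced_cons_red)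

lemma foldr_cons_red_Nil: "reduced u \<Longrightarrow> foldr cons_red u [] = u"
proof (induction u)
  case (Cons l u)
  then show ?case using reduced_Cons[OF Cons.prems] cons_red_reduced[OF Cons.prems] by simp
qed simp

lemma foldr_cons_red:
  assumes "reduced v"
  shows "foldr cons_red (cons_red l u) v = cons_red l (foldr cons_red u v)"
proof (cases u)
  case (Cons m w)
  then show ?thesis using assms
    by (auto simp: cons_red_cancel reduced_foldr)
qed simp

lemma foldr_cons_red_assoc:
  "reduced w \<Longrightarrow> foldr cons_red (foldr cons_red u v) w = foldr cons_red u (foldr cons_red v w)"
  by (induction u) (auto simp: foldr_cons_red)

lemma cons_red_lists: "l \<in> A \<Longrightarrow> w \<in> lists A \<Longrightarrow> cons_red l w \<in> lists A"
  by (cases w) auto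

lemma foldr_cons_red_lists: "u \<in> lists A \<Longrightarrow> w \<in> lists A \<Longrightarrow> foldr cons_red u w \<in> lists A"
  by (induction u) (simp_all add: cons_red_lists del: in_lists_conv_set)

lemma foldr_cons_red_left_inverse:
  "reduced w \<Longrightarrow> foldr cons_red (rev (map (\<lambda>l. (fst l, \<not> snd l)) u)) (foldr cons_red u w) = w"
  by (induction u arbitrary: w) (auto simp: cons_red_cancel reduced_foldr)

lemma group_free_group: "group (free_group X)"
proof (rule groupI)
  fix u assume u: "u \<in> carrier (free_group X)"
  let ?i = "foldr cons_red (rev (map (\<lambda>l. (fst l, \<not> snd l)) u)) []"
  have "rev (map (\<lambda>l. (fst l, \<not> snd l)) u) \<in> lists (X \<times> UNIV)"
    using u by (force simp: free_group_def)
  then have "?i \<in> carrier (free_group X)"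
    by (simp add: free_group_def reduced_foldr foldr_cons_red_lists del: in_lists_conv_set)
  moreover have "?i \<otimes>\<^bsub>free_group X\<^esub> u = \<one>\<^bsub>free_group X\<^esub>"
    using u foldr_cons_red_left_inverse[of "[]" u]
    by (simp add: free_group_def foldr_cons_red_assoc foldr_cons_red_Nil)
  ultimately show "\<exists>y\<in>carrier (free_group X). y \<otimes>\<^bsub>free_group X\<^esub> u = \<one>\<^bsub>free_group X\<^esub>"
    by blast
qed (simp_all add: free_group_def reduced_foldr foldr_cons_red_assoc foldr_cons_red_lists
      del: in_lists_conv_set)

section \<open>The lower central series and free nilpotent groups\<close>

text \<open>\<open>lower_central G k\<close> is \<open>\<gamma>\<^sub>k(G)\<close>. The series starts at \<open>k = 1\<close>, and the value at \<open>k = 0\<close> is a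
  convention only.\<close>

fun lower_central :: "('a, 'b) monoid_scheme \<Rightarrow> nat \<Rightarrow> 'a set" where
  "lower_central G 0 = carrier G"
| "lower_central G (Suc 0) = carrier G"
| "lower_central G (Suc (Suc k)) =
     generate G {h \<otimes>\<^bsub>G\<^esub> g \<otimes>\<^bsub>G\<^esub> inv\<^bsub>G\<^esub> h \<otimes>\<^bsub>G\<^esub> inv\<^bsub>G\<^esub> g | h g. h \<in> lower_central G (Suc k) \<and> g \<in> carrier G}"

lemma (in group) commutators_normal:
  assumes "H \<lhd> G"
  shows "generate G {h \<otimes> g \<otimes> inv h \<otimes> inv g | h g. h \<in> H \<and> g \<in> carrier G} \<lhd> G"
proof (rule normal_generateI)
  interpret H: normal H G by fact
  show "{h \<otimes> g \<otimes> inv h \<otimes> inv g | h g. h \<in> H \<and> g \<in> carrier G} \<subseteq> carrier G"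
    by auto
  fix c x
  assume "c \<in> {h \<otimes> g \<otimes> inv h \<otimes> inv g | h g. h \<in> H \<and> g \<in> carrier G}" and x: "x \<in> carrier G"
  then obtain h g where h: "h \<in> H" and g: "g \<in> carrier G" and c: "c = h \<otimes> g \<otimes> inv h \<otimes> inv g"
    by blast
  let ?h = "x \<otimes> h \<otimes> inv x" and ?g = "x \<otimes> g \<otimes> inv x"
  have hG: "h \<in> carrier G" using h H.subset by blast
  have [simp]: "inv x \<otimes> (x \<otimes> y) = y" "x \<otimes> (inv x \<otimes> y) = y" if "y \<in> carrier G" for y
    using that x by (simp_all flip: m_assoc)
  have "x \<otimes> c \<otimes> inv x = ?h \<otimes> ?g \<otimes> inv ?h \<otimes> inv ?g"
    using x g hG by (simp add: c m_assoc inv_mult_group)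
  moreover have "?h \<in> H" using h x H.inv_op_closed2 by blast
  ultimately show "x \<otimes> c \<otimes> inv x \<in> {h \<otimes> g \<otimes> inv h \<otimes> inv g | h g. h \<in> H \<and> g \<in> carrier G}"
    using x g by blast
qed

lemma (in group) lower_central_normal: "lower_central G k \<lhd> G"
proof -
  have "lower_central G (Suc k) \<lhd> G" for k
  proof (induction k)
    case 0
    show ?case using normal_self by simp
  next
    case (Suc k)
    then show ?case unfolding lower_central.simps by (rule commutators_normal)
  qed
  then show ?thesis
    using normal_self by (cases k) simp_all
qed

definition fg_free_nilpotent_group :: "('a, 'b) monoid_scheme \<Rightarrow> nat \<Rightarrow> bool" where
  "fg_free_nilpotent_group N s \<longleftrightarrow> group N \<and>
     (\<exists>r::nat. r \<ge> 2 \<and> N \<cong> free_group {..<r} Mod lower_central (free_group {..<r}) (s + 1))"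

section \<open>The first-order language of groups\<close>

datatype gterm = Var nat | One | Mult gterm gterm | Inv gterm

datatype gformula = Eq gterm gterm | Neg gformula | Conj gformula gformula | Exists nat gformula

instance gterm :: countable by countable_datatype
instance gformula :: countable by countable_datatype

primrec tm_vars :: "gterm \<Rightarrow> nat set" where
  "tm_vars (Var x) = {x}"
| "tm_vars One = {}"
| "tm_vars (Mult s t) = tm_vars s \<union> tm_vars t"
| "tm_vars (Inv t) = tm_vars t"

primrec free_vars :: "gformula \<Rightarrow> nat set" where
  "free_vars (Eq s t) = tm_vars s \<union> tm_vars t"
| "free_vars (Neg \<phi>) = free_vars \<phi>"
| "free_vars (Conj \<phi> \<psi>) = free_vars \<phi> \<union> free_vars \<psi>"
| "free_vars (Exists x \<phi>) = free_vars \<phi> - {x}"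

primrec tm_val :: "('a, 'b) monoid_scheme \<Rightarrow> (nat \<Rightarrow> 'a) \<Rightarrow> gterm \<Rightarrow> 'a" where
  "tm_val G v (Var x) = v x"
| "tm_val G v One = \<one>\<^bsub>G\<^esub>"
| "tm_val G v (Mult s t) = tm_val G v s \<otimes>\<^bsub>G\<^esub> tm_val G v t"
| "tm_val G v (Inv t) = inv\<^bsub>G\<^esub> (tm_val G v t)"

primrec sat :: "('a, 'b) monoid_scheme \<Rightarrow> (nat \<Rightarrow> 'a) \<Rightarrow> gformula \<Rightarrow> bool" where
  "sat G v (Eq s t) \<longleftrightarrow> tm_val G v s = tm_val G v t"
| "sat G v (Neg \<phi>) \<longleftrightarrow> \<not> sat G v \<phi>"
| "sat G v (Conj \<phi> \<psi>) \<longleftrightarrow> sat G v \<phi> \<and> sat G v \<psi>"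
| "sat G v (Exists x \<phi>) \<longleftrightarrow> (\<exists>a\<in>carrier G. sat G (v(x := a)) \<phi>)"

definition is_sentence :: "gformula \<Rightarrow> bool" where
  "is_sentence \<phi> \<longleftrightarrow> free_vars \<phi> = {}"

definition holds_in :: "('a, 'b) monoid_scheme \<Rightarrow> gformula \<Rightarrow> bool" where
  "holds_in G \<phi> \<longleftrightarrow> (\<forall>v. range v \<subseteq> carrier G \<longrightarrow> sat G v \<phi>)"

definition fo_theory :: "('a, 'b) monoid_scheme \<Rightarrow> gformula set" where
  "fo_theory G = {\<phi>. is_sentence \<phi> \<and> holds_in G \<phi>}"

section \<open>Stability\<close>

text \<open>Only theories extending the axioms of groups are considered, so that models are groups.\<close>

definition is_model :: "('a, 'b) monoid_scheme \<Rightarrow> gformula set \<Rightarrow> bool" where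
  "is_model M T \<longleftrightarrow> group M \<and> (\<forall>\<phi>\<in>T. holds_in M \<phi>)"

text \<open>\<open>\<phi>(x\<^sub>0,\<dots>,x\<^sub>n\<^sub>-\<^sub>1; x\<^sub>n,\<dots>,x\<^sub>2\<^sub>n\<^sub>-\<^sub>1)\<close> orders the \<open>n\<close>-tuples \<open>a 0, a 1, \<dots>\<close> of \<open>M\<close>.\<close>

definition orders ::
  "('a, 'b) monoid_scheme \<Rightarrow> gformula \<Rightarrow> nat \<Rightarrow> (nat \<Rightarrow> 'a list) \<Rightarrow> bool" where
  "orders M \<phi> n a \<longleftrightarrow> free_vars \<phi> \<subseteq> {..<2 * n} \<and>
     (\<forall>i. length (a i) = n \<and> set (a i) \<subseteq> carrier M) \<and>
     (\<forall>i j. sat M (\<lambda>k. (a i @ a j) ! k) \<phi> \<longleftrightarrow> i < j)"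

text \<open>A complete theory is unstable if some formula has the order property in some model of it.
  The language being countable, models with carrier in \<open>nat\<close> suffice by the downward
  Loewenheim-Skolem theorem; see \<open>unstableI\<close> below.\<close>

definition unstable :: "gformula set \<Rightarrow> bool" where
  "unstable T \<longleftrightarrow> (\<exists>(M :: nat monoid) \<phi> n a. is_model M T \<and> orders M \<phi> n a)"

lemma tm_val_closed:
  assumes "group G" "range v \<subseteq> carrier G"
  shows "tm_val G v t \<in> carrier G"
proof -
  interpret group G by fact
  show ?thesis using assms(2) by (induction t) auto
qed

lemma tm_val_cong: "(\<And>x. x \<in> tm_vars t \<Longrightarrow> v x = w x) \<Longrightarrow> tm_val G v t = tm_val G w t"
  by (induction t) auto

lemma sat_cong: "(\<And>x. x \<in> free_vars \<phi> \<Longrightarrow> v x = w x) \<Longrightarrow> sat G v \<phi> = sat G w \<phi>"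
proof (induction \<phi> arbitrary: v w)
  case (Eq s t)
  have "tm_val G v s = tm_val G w s" "tm_val G v t = tm_val G w t"
    by (rule tm_val_cong; use Eq in simp)+
  then show ?case by simp
next
  case (Neg \<phi>)
  have "sat G v \<phi> = sat G w \<phi>" by (rule Neg.IH) (use Neg.prems in simp)
  then show ?case by simp
next
  case (Conj \<phi> \<psi>)
  have "sat G v \<phi> = sat G w \<phi>" by (rule Conj.IH) (use Conj.prems in simp)
  moreover have "sat G v \<psi> = sat G w \<psi>" by (rule Conj.IH) (use Conj.prems in simp)
  ultimately show ?case by simp
next
  case (Exists x \<phi>)
  have "sat G (v(x := a)) \<phi> = sat G (w(x := a)) \<phi>" for a
    by (rule Exists.IH) (use Exists.prems in auto)
  then show ?case by simp
qed

lemma sat_iso: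
  assumes "group G" "group H" "h \<in> iso G H" "range v \<subseteq> carrier G"
  shows "sat H (h \<circ> v) \<phi> = sat G v \<phi>"
proof -
  interpret group_hom G H h
    using assms by (simp add: group_hom_def group_hom_axioms_def iso_def)
  have bij: "bij_betw h (carrier G) (carrier H)"
    using assms(3) by (simp add: iso_def)
  have tm: "tm_val H (h \<circ> v) t = h (tm_val G v t)" if "range v \<subseteq> carrier G" for v t
    using that by (induction t) (auto simp: tm_val_closed[OF assms(1)])
  show ?thesis using assms(4)
  proof (induction \<phi> arbitrary: v)
    case (Eq s t)
    show ?case
      unfolding sat.simps tm[OF Eq.prems]
      by (intro inj_on_eq_iff[OF bij_betw_imp_inj_on[OF bij]] tm_val_closed assms(1) Eq.prems)
  next
    case (Exists x \<phi>)
    have "sat H ((h \<circ> v)(x := h a)) \<phi> = sat G (v(x := a)) \<phi>" if "a \<in> carrier G" for a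
    proof -
      have "sat H (h \<circ> v(x := a)) \<phi> = sat G (v(x := a)) \<phi>"
        by (rule Exists.IH) (use Exists.prems that in auto)
      then show ?thesis by (simp only: fun_upd_comp)
    qed
    moreover have "carrier H = h ` carrier G"
      using bij by (simp add: bij_betw_def)
    ultimately show ?case by (simp add: comp_def)
  qed auto
qed

lemma downward_Loewenheim_Skolem:
  fixes G :: "('a, 'b) monoid_scheme" (structure)
  assumes "group G" "countable C" "C \<subseteq> carrier G"
  obtains S where "countable S" "C \<subseteq> S" "subgroup S G"
    "\<And>v \<phi>. range v \<subseteq> S \<Longrightarrow> sat (G\<lparr>carrier := S\<rparr>) v \<phi> = sat G v \<phi>"
proof -
  interpret group G by fact
  define ext where "ext l k = (if k < length l then l ! k else \<one>)" for l :: "'a list" and k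
  define wit where "wit = (\<lambda>(\<phi>, x, l). SOME a. a \<in> carrier G \<and>
    ((\<exists>b\<in>carrier G. sat G ((ext l)(x := b)) \<phi>) \<longrightarrow> sat G ((ext l)(x := a)) \<phi>))"
  have wit: "wit (\<phi>, x, l) \<in> carrier G \<and>
      ((\<exists>b\<in>carrier G. sat G ((ext l)(x := b)) \<phi>) \<longrightarrow> sat G ((ext l)(x := wit (\<phi>, x, l))) \<phi>)"
    for \<phi> x l
    unfolding wit_def prod.case by (rule someI_ex) blast
  define step where "step A = A \<union> wit ` (UNIV \<times> UNIV \<times> lists A)" for A
  define A where "A n = (step ^^ n) C" for n
  define S where "S = (\<Union>n. A n)"
  have A_Suc: "A (Suc n) = step (A n)" for n by (simp add: A_def)
  have "countable (A n)" for n
    by (induction n) (auto simp: A_def step_def assms(2) countable_lists)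
  then have cS: "countable S" by (simp add: S_def)
  have "A n \<subseteq> carrier G" for n
    using wit by (induction n) (use assms(3) in \<open>auto simp: A_def step_def subset_iff\<close>)
  then have SG: "S \<subseteq> carrier G" by (auto simp: S_def)
  have "mono A" by (rule mono_iff_le_Suc[THEN iffD2]) (auto simp: A_Suc step_def)
  have fin: "\<exists>n. set l \<subseteq> A n" if "set l \<subseteq> S" for l
    using that
  proof (induction l)
    case (Cons a l)
    then obtain m n where "set l \<subseteq> A m" "a \<in> A n" by (auto simp: S_def)
    then have "set (a # l) \<subseteq> A (max m n)"
      using monoD[OF \<open>mono A\<close>, of m "max m n"] monoD[OF \<open>mono A\<close>, of n "max m n"] by auto
    then show ?case ..
  qed simp
  have wS: "wit (\<phi>, x, l) \<in> S" if l: "set l \<subseteq> S" for \<phi> x l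
  proof -
    obtain n where "set l \<subseteq> A n" using fin[OF l] ..
    then have "wit (\<phi>, x, l) \<in> A (Suc n)" by (auto simp: A_Suc step_def)
    then show ?thesis by (auto simp: S_def)
  qed
  have TV: "\<exists>a\<in>S. sat G (v(x := a)) \<phi>"
    if v: "range v \<subseteq> S" and ex: "\<exists>b\<in>carrier G. sat G (v(x := b)) \<phi>" for v x \<phi>
  proof -
    have "finite (tm_vars t)" for t by (induction t) auto
    then have "finite (free_vars \<phi>)" by (induction \<phi>) auto
    then obtain m where m: "\<And>k. k \<in> free_vars \<phi> \<Longrightarrow> k < m"
      by (meson finite_nat_set_iff_bounded)
    let ?l = "map v [0..<m]"
    have eq: "sat G (v(x := a)) \<phi> = sat G ((ext ?l)(x := a)) \<phi>" for a
      by (rule sat_cong) (simp add: ext_def m)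
    have "wit (\<phi>, x, ?l) \<in> S" by (rule wS) (use v in auto)
    moreover have "sat G (v(x := wit (\<phi>, x, ?l))) \<phi>"
      using wit[of \<phi> x ?l] ex by (simp add: eq)
    ultimately show ?thesis by blast
  qed
  have one: "\<one> \<in> S"
  proof -
    have "wit (Eq (Var 0) One, 0, []) = \<one>"
      using wit[of "Eq (Var 0) One" 0 "[]"] by auto
    then show ?thesis using wS[of "[]" "Eq (Var 0) One" 0] by simp
  qed
  have "subgroup S G"
  proof
    fix x y assume xy: "x \<in> S" "y \<in> S"
    show "x \<otimes> y \<in> S"
      using TV[of "\<lambda>k. if k = 0 then x else y" 2 "Eq (Var 2) (Mult (Var 0) (Var 1))"] xy SG by auto
    show "inv x \<in> S"
      using TV[of "\<lambda>k. x" 1 "Eq (Var 1) (Inv (Var 0))"] xy SG by auto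
  qed (use SG one in auto)
  then have inv: "m_inv (G\<lparr>carrier := S\<rparr>) x = m_inv G x" if "x \<in> S" for x
    using m_inv_consistent that by blast
  let ?M = "G\<lparr>carrier := S\<rparr>"
  have M: "group ?M" using \<open>subgroup S G\<close> by (rule subgroup.subgroup_is_group) fact
  have tm: "tm_val ?M v t = tm_val G v t" if "range v \<subseteq> S" for v t
  proof (induction t)
    case (Inv t)
    then show ?case using inv[of "tm_val ?M v t"] tm_val_closed[OF M, of v t] that by simp
  qed auto
  have "sat ?M v \<phi> = sat G v \<phi>" if "range v \<subseteq> S" for v \<phi>
    using that
  proof (induction \<phi> arbitrary: v)
    case (Exists x \<phi>)
    have "sat ?M (v(x := a)) \<phi> = sat G (v(x := a)) \<phi>" if "a \<in> S" for a
      by (rule Exists.IH) (use Exists.prems that in auto)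
    then have "sat ?M v (Exists x \<phi>) \<longleftrightarrow> (\<exists>a\<in>S. sat G (v(x := a)) \<phi>)"
      by simp
    also have "\<dots> \<longleftrightarrow> sat G v (Exists x \<phi>)"
      using TV[OF Exists.prems] SG by auto
    finally show ?case .
  qed (auto simp: tm)
  moreover have "C \<subseteq> S" using A_def[of 0] by (auto simp: S_def)
  ultimately show ?thesis using that cS \<open>subgroup S G\<close> by blast
qed

lemma group_iso_transfer:
  fixes G :: "('a, 'b) monoid_scheme" (structure) and f :: "'a \<Rightarrow> 'c"
  assumes "group G" "inj_on f (carrier G)"
  defines "H \<equiv> \<lparr>carrier = f ` carrier G,
    mult = (\<lambda>a b. f (inv_into (carrier G) f a \<otimes>\<^bsub>G\<^esub> inv_into (carrier G) f b)), one = f \<one>\<^bsub>G\<^esub>\<rparr>"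
  shows "group H" "f \<in> iso G H"
proof -
  interpret group G by fact
  note [simp] = inv_into_f_f[OF assms(2)]
  show "group H"
  proof (rule groupI)
    fix x assume "x \<in> carrier H"
    then obtain g where "g \<in> carrier G" "x = f g" by (auto simp: H_def)
    then show "\<exists>y\<in>carrier H. y \<otimes>\<^bsub>H\<^esub> x = \<one>\<^bsub>H\<^esub>"
      by (intro bexI[of _ "f (inv g)"]) (auto simp: H_def)
  qed (auto simp: H_def m_assoc)
  show "f \<in> iso G H"
    using assms(2) by (auto simp: iso_def hom_def bij_betw_def H_def)
qed

theorem unstableI:
  fixes G :: "('a, 'b) monoid_scheme"
  assumes "is_model G T" "\<And>\<phi>. \<phi> \<in> T \<Longrightarrow> is_sentence \<phi>" "orders G \<phi> n a"
  shows "unstable T"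
proof -
  have G: "group G" using assms(1) by (simp add: is_model_def)
  let ?C = "\<Union>i. set (a i)"
  have "countable ?C"
    by (intro countable_UN) (simp_all add: countable_finite)
  moreover have "?C \<subseteq> carrier G"
    using assms(3) by (auto simp: orders_def)
  ultimately obtain S where S: "countable S" "?C \<subseteq> S" "subgroup S G"
    and el: "\<And>v \<phi>. range v \<subseteq> S \<Longrightarrow> sat (G\<lparr>carrier := S\<rparr>) v \<phi> = sat G v \<phi>"
    using downward_Loewenheim_Skolem[OF G] by metis
  let ?M = "G\<lparr>carrier := S\<rparr>"
  have M: "group ?M" using S(3) G by (rule subgroup.subgroup_is_group)
  obtain f :: "'a \<Rightarrow> nat" where f: "inj_on f S"
    using S(1) by (auto simp: countable_def)
  then have "inj_on f (carrier ?M)" by simp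
  from group_iso_transfer[OF M this] obtain H :: "nat monoid" where H: "group H" "f \<in> iso ?M H"
    by blast
  have car: "carrier H = f ` S" using H(2) by (auto simp: iso_def bij_betw_def)
  have one: "\<one>\<^bsub>G\<^esub> \<in> S" and SG: "S \<subseteq> carrier G"
    using S(3) by (auto simp: subgroup_def)
  have tr: "sat H (f \<circ> v) \<phi> = sat G v \<phi>" if "range v \<subseteq> S" for v :: "nat \<Rightarrow> 'a" and \<phi>
    using sat_iso[OF M H] el that by simp
  have "holds_in H \<psi>" if "\<psi> \<in> T" for \<psi>
    unfolding holds_in_def
  proof (intro allI impI)
    fix v :: "nat \<Rightarrow> nat" assume v: "range v \<subseteq> carrier H"
    have fv: "free_vars \<psi> = {}" using assms(2)[OF that] by (simp add: is_sentence_def)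
    have "sat H v \<psi> = sat H (f \<circ> (\<lambda>_. \<one>\<^bsub>G\<^esub>)) \<psi>"
      by (rule sat_cong) (simp add: fv)
    also have "\<dots> = sat G (\<lambda>_. \<one>\<^bsub>G\<^esub>) \<psi>" by (rule tr) (use one in auto)
    also have "\<dots>" using assms(1) that one SG by (auto simp: is_model_def holds_in_def image_subset_iff)
    finally show "sat H v \<psi>" .
  qed
  then have "is_model H T" using H(1) by (simp add: is_model_def)
  moreover have "orders H \<phi> n (\<lambda>i. map f (a i))"
    unfolding orders_def
  proof (intro conjI allI)
    show fv: "free_vars \<phi> \<subseteq> {..<2 * n}" using assms(3) by (simp add: orders_def)
    have len: "length (a i) = n" for i using assms(3) by (simp add: orders_def)
    fix i
    show "length (map f (a i)) = n" using len by simp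
    show "set (map f (a i)) \<subseteq> carrier H" using S(2) by (auto simp: car)
    fix j
    let ?v = "\<lambda>k. if k < 2 * n then (a i @ a j) ! k else \<one>\<^bsub>G\<^esub>"
    have "(a i @ a j) ! k \<in> S" if "k < 2 * n" for k
    proof -
      have "(a i @ a j) ! k \<in> set (a i @ a j)" by (rule nth_mem) (use that len in simp)
      then show ?thesis using S(2) by auto
    qed
    then have v: "range ?v \<subseteq> S" using one by auto
    have "sat H (\<lambda>k. (map f (a i) @ map f (a j)) ! k) \<phi> = sat H (f \<circ> ?v) \<phi>"
    proof (rule sat_cong)
      fix k assume "k \<in> free_vars \<phi>"
      then have "k < 2 * n" using fv by auto
      then show "(map f (a i) @ map f (a j)) ! k = (f \<circ> ?v) k"
        using len by (simp flip: map_append)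
    qed
    also have "\<dots> = sat G ?v \<phi>" by (rule tr) (rule v)
    also have "\<dots> = sat G (\<lambda>k. (a i @ a j) ! k) \<phi>"
      by (rule sat_cong) (use fv in auto)
    also have "\<dots> = (i < j)" using assms(3) by (simp add: orders_def)
    finally show "sat H (\<lambda>k. (map f (a i) @ map f (a j)) ! k) \<phi> = (i < j)" .
  qed
  ultimately show ?thesis by (auto simp: unstable_def)
qed

section \<open>Decidability\<close>

text \<open>Partial recursive functions. \<open>PrimRec f g\<close> recurses on its first argument, and \<open>Mu f\<close> searches
  for the least zero in the first argument of \<open>f\<close>.\<close>

datatype recf = Zero | Succ | Proj nat | Comp recf "recf list" | PrimRec recf recf | Mu recf

inductive computes :: "recf \<Rightarrow> nat list \<Rightarrow> nat \<Rightarrow> bool" where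
  "computes Zero xs 0"
| "computes Succ [x] (Suc x)"
| "i < length xs \<Longrightarrow> computes (Proj i) xs (xs ! i)"
| "list_all2 (\<lambda>g y. computes g xs y) gs ys \<Longrightarrow> computes f ys z \<Longrightarrow> computes (Comp f gs) xs z"
| "computes f xs y \<Longrightarrow> computes (PrimRec f g) (0 # xs) y"
| "computes (PrimRec f g) (m # xs) y \<Longrightarrow> computes g (m # y # xs) z \<Longrightarrow>
     computes (PrimRec f g) (Suc m # xs) z"
| "computes f (m # xs) 0 \<Longrightarrow> (\<And>k. k < m \<Longrightarrow> \<exists>y. computes f (k # xs) (Suc y)) \<Longrightarrow>
     computes (Mu f) xs m"

definition recursive_set :: "nat set \<Rightarrow> bool" where
  "recursive_set A \<longleftrightarrow> (\<exists>f. \<forall>x. computes f [x] (if x \<in> A then 1 else 0))"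

primrec tm_code :: "gterm \<Rightarrow> nat" where
  "tm_code (Var x) = prod_encode (0, x)"
| "tm_code One = prod_encode (1, 0)"
| "tm_code (Mult s t) = prod_encode (2, prod_encode (tm_code s, tm_code t))"
| "tm_code (Inv t) = prod_encode (3, tm_code t)"

primrec fm_code :: "gformula \<Rightarrow> nat" where
  "fm_code (Eq s t) = prod_encode (0, prod_encode (tm_code s, tm_code t))"
| "fm_code (Neg \<phi>) = prod_encode (1, fm_code \<phi>)"
| "fm_code (Conj \<phi> \<psi>) = prod_encode (2, prod_encode (fm_code \<phi>, fm_code \<psi>))"
| "fm_code (Exists x \<phi>) = prod_encode (3, prod_encode (x, fm_code \<phi>))"

definition decidable :: "gformula set \<Rightarrow> bool" where
  "decidable T \<longleftrightarrow> recursive_set (fm_code ` T)"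

lemma inj_tm_code: "tm_code s = tm_code t \<Longrightarrow> s = t"
  by (induction s arbitrary: t) (case_tac t; auto)+

lemma inj_fm_code: "fm_code \<phi> = fm_code \<psi> \<Longrightarrow> \<phi> = \<psi>"
  by (induction \<phi> arbitrary: \<psi>) (case_tac \<psi>; auto dest: inj_tm_code)+

inductive_cases computes_ZeroE: "computes Zero xs z"
inductive_cases computes_SuccE: "computes Succ xs z"
inductive_cases computes_ProjE: "computes (Proj i) xs z"
inductive_cases computes_CompE: "computes (Comp f gs) xs z"
inductive_cases computes_PrimRec_0E: "computes (PrimRec f g) (0 # xs) z"
inductive_cases computes_PrimRec_SucE: "computes (PrimRec f g) (Suc m # xs) z"
inductive_cases computes_MuE: "computes (Mu f) xs z"

lemma computes_det: "computes f xs y \<Longrightarrow> computes f xs z \<Longrightarrow> y = z"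
proof (induction arbitrary: z rule: computes.induct)
  case (1 xs)
  then show ?case by (rule computes_ZeroE) simp
next
  case (2 x)
  then show ?case by (rule computes_SuccE) simp
next
  case (3 i xs)
  from 3(2) show ?case by (rule computes_ProjE) simp
next
  case (4 xs gs ys f y)
  from 4(4) obtain zs where zs: "list_all2 (\<lambda>g y. computes g xs y) gs zs" "computes f zs z"
    by (rule computes_CompE)
  have len: "length ys = length zs"
    using list_all2_lengthD[OF 4(1)] list_all2_lengthD[OF zs(1)] by simp
  have "ys ! i = zs ! i" if "i < length ys" for i
    using list_all2_nthD2[OF 4(1) that] list_all2_nthD2[OF zs(1), of i] that len by auto
  then have "ys = zs" using len by (simp add: nth_equalityI)
  then show ?case using 4(2,3) zs(2) by blast
next
  case (5 f xs y g)
  from 5(3) have "computes f xs z" by (rule computes_PrimRec_0E)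
  then show ?case by (rule "5.IH")
next
  case (6 f g m xs y z z')
  from 6(5) obtain y' where y': "computes (PrimRec f g) (m # xs) y'" "computes g (m # y' # xs) z'"
    by (rule computes_PrimRec_SucE)
  then show ?case using "6.IH" by blast
next
  case (7 f m xs z)
  from 7(4) have z: "computes f (z # xs) 0" "\<And>k. k < z \<Longrightarrow> \<exists>y. computes f (k # xs) (Suc y)"
    by (blast elim: computes_MuE)+
  show ?case
  proof (rule linorder_cases[of m z])
    assume "m < z"
    then obtain y where "computes f (m # xs) (Suc y)" using z(2) by blast
    then show ?thesis using "7.IH"(1) by blast
  next
    assume "z < m"
    then show ?thesis using "7.IH"(2)[of z] z(1) by blast
  qed
qed

end

theory Submission
  imports Defs "HOL-Number_Theory.Cong" "HOL-Computational_Algebra.Formal_Power_Series"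
    "HOL-Algebra.Elementary_Groups"
begin

text \<open>The argument is Mal'cev's interpretation of arithmetic. Let \<open>x\<^sub>1, \<dots>, x\<^sub>r\<close> be free generators of \<open>N\<close>,
  let \<open>c = [\<dots>[[x\<^sub>2, x\<^sub>1], x\<^sub>1], \<dots>, x\<^sub>1]\<close> be the left-normed commutator of weight \<open>s\<close>, which is central of
  infinite order, and let \<open>e\<^sub>i : N \<rightarrow> \<int>\<close> be the exponent sums. In \<open>Aut(N)\<close> take \<open>u : x\<^sub>2 \<mapsto> x\<^sub>2 x\<^sub>1\<close>, the central
  automorphism \<open>l : y \<mapsto> y c\<^bsup>e\<^sub>1(y)\<^esup>\<close>, and \<open>d\<close>, which inverts \<open>x\<^sub>3, \<dots>, x\<^sub>r\<close>. Then \<open>v = [u, l]\<close> is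
  \<open>y \<mapsto> y c\<^bsup>-e\<^sub>2(y)\<^esup>\<close>. Every \<open>x\<close> in the centralizer \<open>X\<close> of \<open>u, v, d\<close> satisfies \<open>[x, l] \<in> \<langle>v\<rangle>\<close>: commuting with
  \<open>u\<close> and \<open>d\<close> controls \<open>e\<^sub>1 \<circ> x\<close>, and commuting with \<open>v\<close> gives \<open>x(c) = c\<^bsup>k\<^esup>\<close> and \<open>e\<^sub>2 \<circ> x = k e\<^sub>2\<close> with the same sign
  \<open>k = \<plusminus>1\<close>. So \<open>\<langle>v\<rangle>\<close> is definable, and the commutator pairing of \<open>X\<close> with the centralizer of
  \<open>X \<inter> C(l)\<close> defines multiplication of exponents. The natural numbers are the \<open>n\<close> for which some \<open>n y\<^sup>2\<close>
  with \<open>y \<noteq> 0\<close> is a sum of four squares. The resulting order gives instability. For undecidability the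
  parameters \<open>u, l, d\<close> are quantified over all triples that satisfy a fragment of Robinson arithmetic; true
  \<open>\<Sigma>\<^sub>1\<close> statements hold at all of these, so a diagonal sentence contradicts a decision procedure.\<close>

section \<open>Multiples of sums of four squares\<close>

text \<open>Multiplicativity of the quaternion norm: the squares on the right are those of the
  coordinates of (e + fi + gj + hk) times the conjugate of (a + bi + cj + dk).\<close>

lemma euler_four_squares:
  fixes a b c d e f g h :: int
  shows "(a\<^sup>2 + b\<^sup>2 + c\<^sup>2 + d\<^sup>2) * (e\<^sup>2 + f\<^sup>2 + g\<^sup>2 + h\<^sup>2) =
    (a*e + b*f + c*g + d*h)\<^sup>2 + (a*f - b*e + c*h - d*g)\<^sup>2 +
    (a*g - b*h - c*e + d*f)\<^sup>2 + (a*h + b*g - c*f - d*e)\<^sup>2"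
  by (simp add: power2_eq_square algebra_simps)

text \<open>This says that \<open>n\<close> is a sum of four rational squares. The denominator
  \<open>y\<close> makes the property stable under exact division, and the body uses only sums and
  products, which the interpretation can express.\<close>

definition four_squares_over_square :: "int \<Rightarrow> bool" where
  "four_squares_over_square n \<longleftrightarrow>
     (\<exists>y a b c d. y \<noteq> 0 \<and> n * y\<^sup>2 = a\<^sup>2 + b\<^sup>2 + c\<^sup>2 + d\<^sup>2)"

lemma four_squares_over_square_mult:
  assumes "four_squares_over_square m" "four_squares_over_square n"
  shows "four_squares_over_square (m * n)"
proof -
  obtain y a b c d where 1: "y \<noteq> 0" "m * y\<^sup>2 = a\<^sup>2 + b\<^sup>2 + c\<^sup>2 + d\<^sup>2"
    using assms(1) unfolding four_squares_over_square_def by blast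
  obtain z e f g h where 2: "z \<noteq> 0" "n * z\<^sup>2 = e\<^sup>2 + f\<^sup>2 + g\<^sup>2 + h\<^sup>2"
    using assms(2) unfolding four_squares_over_square_def by blast
  have "m * n * (y * z)\<^sup>2 = (m * y\<^sup>2) * (n * z\<^sup>2)"
    by (simp add: power2_eq_square algebra_simps)
  also have "\<dots> = (a*e + b*f + c*g + d*h)\<^sup>2 + (a*f - b*e + c*h - d*g)\<^sup>2 +
    (a*g - b*h - c*e + d*f)\<^sup>2 + (a*h + b*g - c*f - d*e)\<^sup>2"
    unfolding 1(2) 2(2) by (rule euler_four_squares)
  finally show ?thesis
    unfolding four_squares_over_square_def using 1(1) 2(1) by (metis mult_eq_0_iff)
qed

text \<open>Multiplying by \<open>k\<close> once more produces the factor \<open>k\<^sup>2\<close>,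
  which is absorbed into the denominator.\<close>

lemma four_squares_over_square_cancel:
  assumes "four_squares_over_square (k * n)" "four_squares_over_square k" "k \<noteq> 0"
  shows "four_squares_over_square n"
proof -
  have "four_squares_over_square (k * (k * n))"
    using assms(1,2) by (rule four_squares_over_square_mult[rotated])
  then obtain y a b c d where "y \<noteq> 0" "k * (k * n) * y\<^sup>2 = a\<^sup>2 + b\<^sup>2 + c\<^sup>2 + d\<^sup>2"
    unfolding four_squares_over_square_def by blast
  then have "k * y \<noteq> 0" "n * (k * y)\<^sup>2 = a\<^sup>2 + b\<^sup>2 + c\<^sup>2 + d\<^sup>2"
    using assms(3) by (simp_all add: power2_eq_square algebra_simps)
  then show ?thesis unfolding four_squares_over_square_def by blast
qed

text \<open>\<open>p\<close> divides \<open>(a - b) * (a + b)\<close>, but both factors are below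
  \<open>p\<close> in absolute value, so one of them vanishes.\<close>

lemma inj_on_square_mod:
  fixes p :: int
  assumes "prime p" "2 * N < p"
  shows "inj_on (\<lambda>a. a\<^sup>2 mod p) {0..N}"
proof (rule inj_onI)
  fix a b assume ab: "a \<in> {0..N}" "b \<in> {0..N}" "a\<^sup>2 mod p = b\<^sup>2 mod p"
  then have "p dvd a\<^sup>2 - b\<^sup>2" by (simp add: mod_eq_dvd_iff)
  then have "p dvd (a - b) * (a + b)" by (simp add: power2_eq_square algebra_simps)
  then consider "p dvd a - b" | "p dvd a + b"
    using prime_dvd_multD[OF assms(1)] by blast
  then show "a = b"
  proof cases
    case 1
    then show ?thesis using zdvd_imp_le[of p "a - b"] zdvd_imp_le[of p "b - a"] ab assms(2)
      by (cases a b rule: linorder_cases) (auto simp: dvd_diff_commute)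
  next
    case 2
    then have "\<not> 0 < a + b" using zdvd_imp_le[of p "a + b"] ab assms(2) by auto
    then show ?thesis using ab(1,2) by simp
  qed
qed

text \<open>Pigeonhole: for a and b from 0 to (p - 1)/2, the residues of \<open>a\<^sup>2\<close>
  and of \<open>-1 - b\<^sup>2\<close> form two sets of size (p + 1)/2, so they meet. The small
  range of a and b keeps the sum below \<open>p * p\<close>, hence \<open>k < p\<close>.\<close>

lemma sum_two_squares_plus_one:
  fixes p :: int
  assumes "prime p" "odd p"
  obtains a b k where "k * p = a\<^sup>2 + b\<^sup>2 + 1" "0 < k" "k < p"
proof -
  define N where "N = (p - 1) div 2"
  have N: "2 * N + 1 = p" "0 < N"
    using assms prime_gt_1_int[OF assms(1)] by (auto simp: N_def elim!: oddE)
  let ?A = "(\<lambda>a. a\<^sup>2 mod p) ` {0..N}" and ?B = "(\<lambda>b. (-1 - b\<^sup>2) mod p) ` {0..N}"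
  have inj: "inj_on (\<lambda>a. a\<^sup>2 mod p) {0..N}"
    using assms(1) N by (intro inj_on_square_mod) auto
  have "inj_on (\<lambda>b. (-1 - b\<^sup>2) mod p) {0..N}"
  proof (rule inj_onI)
    fix x y assume xy: "x \<in> {0..N}" "y \<in> {0..N}" "(-1 - x\<^sup>2) mod p = (-1 - y\<^sup>2) mod p"
    then have "p dvd y\<^sup>2 - x\<^sup>2" by (simp add: mod_eq_dvd_iff)
    then have "x\<^sup>2 mod p = y\<^sup>2 mod p" by (simp add: mod_eq_dvd_iff dvd_diff_commute)
    then show "x = y" using inj xy by (auto dest: inj_onD)
  qed
  then have card: "card ?A = nat (N + 1)" "card ?B = nat (N + 1)"
    using card_image[OF inj] by (simp_all add: card_image)
  have "?A \<union> ?B \<subseteq> {0..<p}" using prime_gt_0_int[OF assms(1)] by auto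
  then have "card (?A \<union> ?B) \<le> nat p"
    using card_mono[of "{0..<p}" "?A \<union> ?B"] by simp
  moreover have "card ?A + card ?B = card (?A \<union> ?B) + card (?A \<inter> ?B)"
    by (rule card_Un_Int) auto
  ultimately have "?A \<inter> ?B \<noteq> {}"
    using card N by (auto simp del: Int_iff)
  then obtain a b where ab: "a \<in> {0..N}" "b \<in> {0..N}" "a\<^sup>2 mod p = (-1 - b\<^sup>2) mod p"
    by blast
  then have "p dvd a\<^sup>2 - (-1 - b\<^sup>2)" by (simp only: mod_eq_dvd_iff)
  then obtain k where "a\<^sup>2 - (-1 - b\<^sup>2) = p * k" by (elim dvdE)
  then have k: "k * p = a\<^sup>2 + b\<^sup>2 + 1" by (simp add: algebra_simps)
  have "0 < k * p" unfolding k by (simp add: add_nonneg_pos)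
  then have "0 < k" using N by (simp add: zero_less_mult_iff)
  have "a\<^sup>2 \<le> N\<^sup>2" "b\<^sup>2 \<le> N\<^sup>2" using ab by (auto intro: power_mono)
  then have "k * p \<le> 2 * N\<^sup>2 + 1" using k by simp
  also have "\<dots> < p * p"
  proof -
    have "p * p = 4 * (N * N) + 4 * N + 1"
      unfolding N(1)[symmetric] by (simp add: algebra_simps)
    then show ?thesis using N(2) zero_le_square[of N] unfolding power2_eq_square by linarith
  qed
  finally have "k < p" using N by simp
  with k \<open>0 < k\<close> show thesis by (rule that)
qed

text \<open>Composite numbers follow by multiplicativity. For an odd prime \<open>n\<close>, some
  \<open>k * n\<close> with \<open>0 < k < n\<close> is a sum of three squares, and \<open>k\<close>
  cancels by the induction hypothesis.\<close>

lemma four_squares_over_square_nat: "four_squares_over_square (int n)"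
proof (induction n rule: less_induct)
  case (less n)
  show ?case
  proof (cases "n \<le> 1")
    case True
    have "int n * 1\<^sup>2 = (int n)\<^sup>2 + 0\<^sup>2 + 0\<^sup>2 + 0\<^sup>2"
      using True by (cases n) auto
    then show ?thesis unfolding four_squares_over_square_def by (metis one_neq_zero)
  next
    case False
    show ?thesis
    proof (cases "prime n")
      case True
      show ?thesis
      proof (cases "n = 2")
        case True
        then have "int n * 1\<^sup>2 = 1\<^sup>2 + 1\<^sup>2 + 0\<^sup>2 + 0\<^sup>2" by simp
        then show ?thesis unfolding four_squares_over_square_def by (metis one_neq_zero)
      next
        case False
        then have "odd (int n)" using prime_odd_nat[OF True] \<open>\<not> n \<le> 1\<close> by auto
        moreover have "prime (int n)" using True by simp
        ultimately obtain a b k where k: "k * int n = a\<^sup>2 + b\<^sup>2 + 1" "0 < k" "k < int n"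
          using sum_two_squares_plus_one[of "int n"] by metis
        have "four_squares_over_square k" using less.IH[of "nat k"] k by auto
        moreover have "k * int n * 1\<^sup>2 = a\<^sup>2 + b\<^sup>2 + 1\<^sup>2 + 0\<^sup>2" using k by simp
        then have "four_squares_over_square (k * int n)"
          unfolding four_squares_over_square_def by (metis one_neq_zero)
        ultimately show ?thesis using four_squares_over_square_cancel k(2) by blast
      qed
    next
      case False
      then obtain a b where ab: "n = a * b" "a \<noteq> 1" "a \<noteq> n"
        using \<open>\<not> n \<le> 1\<close> by (auto simp: prime_nat_iff)
      then have "a < n" "b < n"
        using \<open>\<not> n \<le> 1\<close> by (auto simp: nat_neq_iff)
      then show ?thesis using four_squares_over_square_mult[OF less.IH less.IH] ab(1) by simp
    qed
  qed
qed

lemma four_squares_over_square_iff: "four_squares_over_square n \<longleftrightarrow> 0 \<le> n"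
proof
  assume "four_squares_over_square n"
  then obtain y a b c d where y: "y \<noteq> 0" "n * y\<^sup>2 = a\<^sup>2 + b\<^sup>2 + c\<^sup>2 + d\<^sup>2"
    unfolding four_squares_over_square_def by blast
  then have "0 \<le> n * y\<^sup>2" by simp
  then show "0 \<le> n" using y(1) by (simp add: zero_le_mult_iff)
qed (use four_squares_over_square_nat[of "nat n"] in simp)

section \<open>The beta function\<close>

text \<open>The graph of Goedel's beta function, the remainder of \<open>c\<close> modulo 1 + (i +
  1)d. The slack \<open>e\<close> expresses that \<open>a\<close> is at most
  \<open>Suc i * d\<close>, so only sums, products and existential quantifiers occur.\<close>

definition beta :: "nat \<Rightarrow> nat \<Rightarrow> nat \<Rightarrow> nat \<Rightarrow> bool" where
  "beta c d i a \<longleftrightarrow> (\<exists>q e. c = q * (a + e + 1) + a \<and> a + e = Suc i * d)"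

lemma beta_iff: "beta c d i a \<longleftrightarrow> a = c mod (Suc (Suc i * d))"
proof
  assume "beta c d i a"
  then obtain q e where "c = a + (a + e + 1) * q" "a + e = Suc i * d"
    unfolding beta_def by (metis add.commute mult.commute)
  moreover have "(a + (a + e + 1) * q) mod (a + e + 1) = a"
    by (subst mod_mult_self2) simp
  ultimately show "a = c mod (Suc (Suc i * d))" by (metis Suc_eq_plus1)
next
  assume a: "a = c mod (Suc (Suc i * d))"
  then have "a \<le> Suc i * d" using mod_less_divisor[of "Suc (Suc i * d)" c] by linarith
  then obtain e where e: "Suc i * d = a + e" by (rule le_Suc_ex[THEN exE])
  have "c = c div (Suc (Suc i * d)) * (Suc (Suc i * d)) + a"
    unfolding a by (rule div_mult_mod_eq[symmetric])
  then have "c = c div (Suc (Suc i * d)) * (a + e + 1) + a"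
    unfolding e by (metis Suc_eq_plus1)
  then show "beta c d i a" unfolding beta_def using e by metis
qed

text \<open>Goedel's sequence coding: for a suitable factorial \<open>d\<close> the moduli are
  pairwise coprime, and the Chinese remainder theorem supplies \<open>c\<close>.\<close>

lemma beta_exists: "\<exists>c d. \<forall>i\<le>m. \<forall>a. beta c d i a \<longleftrightarrow> a = h i"
proof -
  \<comment> \<open>\<open>M\<close> exceeds all index differences and all values, so its factorial
    is divisible by the former and bounds the latter.\<close>
  define M where "M = m + Max (h ` {..m}) + 1"
  define d :: nat where "d = fact M"
  define md where "md i = Suc (Suc i * d)" for i
  have coprime: "coprime (md i) (md j)" if "i \<le> m" "j \<le> m" "i \<noteq> j" for i j
  proof (rule ccontr)
    assume "\<not> coprime (md i) (md j)"
    then obtain q where "prime q" "q dvd gcd (md i) (md j)"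
      using prime_factor_nat[of "gcd (md i) (md j)"] unfolding coprime_iff_gcd_eq_1 by blast
    then have q: "prime q" "q dvd md i" "q dvd md j"
      by (blast intro: dvd_trans gcd_dvd1 gcd_dvd2)+
    have "\<not> q dvd d"
    proof
      assume "q dvd d"
      then have "q dvd Suc i * d" by simp
      then have "q dvd md i - Suc i * d" using q(2) by (rule dvd_diff_nat[rotated])
      then show False using q(1) by (simp add: md_def)
    qed
    \<comment> \<open>This combination eliminates \<open>d\<close>: a common prime divides j - i,
      hence \<open>d\<close>, although no prime factor of a modulus divides
      \<open>d\<close>.\<close>
    have "int q dvd int (md i) * int (Suc j) - int (md j) * int (Suc i)"
      using q(2,3) by (intro dvd_diff dvd_mult2) auto
    also have "int (md i) * int (Suc j) - int (md j) * int (Suc i) = int j - int i"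
      by (simp add: md_def algebra_simps)
    finally have "q dvd nat \<bar>int j - int i\<bar>" by simp
    moreover have "nat \<bar>int j - int i\<bar> dvd d"
      unfolding d_def by (rule dvd_fact) (use that in \<open>auto simp: M_def\<close>)
    ultimately show False using \<open>\<not> q dvd d\<close> dvd_trans by blast
  qed
  then obtain c where c: "\<forall>i\<in>{..m}. [c = h i] (mod md i)"
    using chinese_remainder_nat[of "{..m}" md h] by auto
  have "h i = c mod md i" if "i \<le> m" for i
  proof -
    have "h i \<le> Max (h ` {..m})" using that by simp
    also have "\<dots> \<le> M" unfolding M_def by linarith
    also have "M \<le> d" by (simp add: d_def fact_ge_self)
    also have "d \<le> Suc i * d" by simp
    finally have "h i < md i" by (simp add: md_def)
    then show ?thesis using c that by (simp add: cong_def)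
  qed
  then have "\<forall>i\<le>m. \<forall>a. beta c d i a \<longleftrightarrow> a = h i"
    by (simp add: beta_iff md_def)
  then show ?thesis by blast
qed

section \<open>Commutators and the interpretation of arithmetic\<close>

context group
begin

definition comm :: "'a \<Rightarrow> 'a \<Rightarrow> 'a" where
  "comm a b = a \<otimes> b \<otimes> inv a \<otimes> inv b"

lemma comm_closed [simp]: "a \<in> carrier G \<Longrightarrow> b \<in> carrier G \<Longrightarrow> comm a b \<in> carrier G"
  by (simp add: comm_def)

lemma inv_mult_cancel [simp]:
  assumes "x \<in> carrier G" "y \<in> carrier G"
  shows "inv x \<otimes> (x \<otimes> y) = y" "x \<otimes> (inv x \<otimes> y) = y"
  using assms by (simp_all flip: m_assoc)

lemma comm_mult_swap: "a \<in> carrier G \<Longrightarrow> b \<in> carrier G \<Longrightarrow> comm a b \<otimes> (b \<otimes> a) = a \<otimes> b"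
  by (simp add: comm_def m_assoc)

lemma inv_commute:
  assumes "x \<in> carrier G" "y \<in> carrier G" "x \<otimes> y = y \<otimes> x"
  shows "inv x \<otimes> y = y \<otimes> inv x"
proof -
  have "inv x \<otimes> y = inv x \<otimes> (y \<otimes> x) \<otimes> inv x" using assms(1,2) by (simp add: m_assoc)
  also have "\<dots> = y \<otimes> inv x" unfolding assms(3)[symmetric] using assms(1,2) by simp
  finally show ?thesis .
qed

lemma comm_eq_iff:
  assumes "a \<in> carrier G" "b \<in> carrier G" "c \<in> carrier G"
  shows "comm a b = c \<longleftrightarrow> a \<otimes> b = c \<otimes> (b \<otimes> a)"
  using comm_mult_swap[OF assms(1,2)] assms by (metis comm_closed m_closed right_cancel)

lemma comm_eq_one_iff:
  "a \<in> carrier G \<Longrightarrow> b \<in> carrier G \<Longrightarrow> comm a b = \<one> \<longleftrightarrow> a \<otimes> b = b \<otimes> a"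
  by (simp add: comm_eq_iff)

lemma conj_int_pow:
  assumes "g \<in> carrier G" "x \<in> carrier G"
  shows "(g \<otimes> x \<otimes> inv g) [^] (n::int) = g \<otimes> x [^] n \<otimes> inv g"
proof -
  have "(\<lambda>x. g \<otimes> x \<otimes> inv g) \<in> hom G G"
    using assms(1) by (auto simp: hom_def m_assoc)
  then show ?thesis 
    using hom_int_pow[of "\<lambda>x. g \<otimes> x \<otimes> inv g" G G x n] assms is_group by simp
qed

lemma int_pow_commute:
  assumes "x \<in> carrier G" "y \<in> carrier G" "x \<otimes> y = y \<otimes> x"
  shows "x [^] (n::int) \<otimes> y = y \<otimes> x [^] n"
proof -
  have "y \<otimes> x \<otimes> inv y = x" unfolding assms(3)[symmetric] using assms(1,2) by (simp add: m_assoc)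
  then have x: "x [^] n = y \<otimes> x [^] n \<otimes> inv y" using conj_int_pow[of y x n] assms(1,2) by simp
  have "x [^] n \<otimes> y = y \<otimes> x [^] n \<otimes> inv y \<otimes> y" using x by simp
  then show ?thesis using assms(1,2) by (simp add: m_assoc)
qed

text \<open>Conjugation by \<open>a\<close> sends \<open>b\<close> to
  \<open>comm a b \<otimes> b\<close>, and powers of this product split because its factors
  commute.\<close>

lemma comm_int_pow_right:
  assumes "a \<in> carrier G" "b \<in> carrier G" "comm a b \<otimes> b = b \<otimes> comm a b"
  shows "comm a (b [^] (n::int)) = comm a b [^] n"
proof -
  have "a \<otimes> b \<otimes> inv a = comm a b \<otimes> b"
    using assms(1,2) by (simp add: comm_def m_assoc)
  then have "a \<otimes> b [^] n \<otimes> inv a = (comm a b \<otimes> b) [^] n"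
    using conj_int_pow assms(1,2) by metis
  also have "\<dots> = comm a b [^] n \<otimes> b [^] n"
    using assms by (intro int_pow_mult_distrib) simp_all
  finally have "comm a (b [^] n) = comm a b [^] n \<otimes> b [^] n \<otimes> inv (b [^] n)"
    by (simp add: comm_def)
  then show ?thesis using assms(1,2) by (simp add: m_assoc)
qed

lemma comm_inv: "a \<in> carrier G \<Longrightarrow> b \<in> carrier G \<Longrightarrow> inv (comm a b) = comm b a"
  by (simp add: comm_def inv_mult_group m_assoc)

text \<open>Inversion swaps the entries of a commutator, which reduces this to
  \<open>comm_int_pow_right\<close>.\<close>

lemma comm_int_pow_left:
  assumes "a \<in> carrier G" "b \<in> carrier G" "a \<otimes> comm a b = comm a b \<otimes> a"
  shows "comm (a [^] (n::int)) b = comm a b [^] n"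
proof -
  have "comm b a \<otimes> a = a \<otimes> comm b a"
    using inv_commute[of "comm a b" a] assms by (simp add: comm_inv)
  then have "comm b (a [^] n) = comm b a [^] n"
    using assms(1,2) by (intro comm_int_pow_right)
  then have "inv (comm (a [^] n) b) = inv (comm a b) [^] n"
    using assms(1,2) by (simp add: comm_inv)
  then have "inv (comm (a [^] n) b) = inv (comm a b [^] n)"
    using assms(1,2) by (simp add: int_pow_inv)
  then show ?thesis using assms(1,2) by (metis comm_closed int_pow_closed inv_inv)
qed

definition centralizes :: "'a \<Rightarrow> 'a \<Rightarrow> 'a \<Rightarrow> 'a \<Rightarrow> bool" where
  "centralizes u l d x \<longleftrightarrow> x \<otimes> u = u \<otimes> x \<and> x \<otimes> d = d \<otimes> x \<and> x \<otimes> comm u l = comm u l \<otimes> x"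

text \<open>At the intended parameters these are the powers of \<open>comm u l\<close>, see
  \<open>scalar_iff\<close>; the n-th power stands for the integer n.\<close>

definition scalar :: "'a \<Rightarrow> 'a \<Rightarrow> 'a \<Rightarrow> 'a \<Rightarrow> bool" where
  "scalar u l d a \<longleftrightarrow> (\<exists>x\<in>carrier G. centralizes u l d x \<and> comm x l = a)"

text \<open>The condition on \<open>z\<close> makes \<open>[x, y]\<close> depend on \<open>x\<close> only through \<open>[x, l]\<close>, so that \<open>x\<close> can be replaced by a
  power of \<open>u\<close> with the same effect on \<open>l\<close>.\<close>

definition product :: "'a \<Rightarrow> 'a \<Rightarrow> 'a \<Rightarrow> 'a \<Rightarrow> 'a \<Rightarrow> 'a \<Rightarrow> bool" where
  "product u l d a b c \<longleftrightarrow> scalar u l d b \<and> (\<exists>x\<in>carrier G. centralizes u l d x \<and> comm x l = a \<and>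
     (\<exists>y\<in>carrier G. (\<forall>z\<in>carrier G. centralizes u l d z \<and> z \<otimes> l = l \<otimes> z \<longrightarrow> z \<otimes> y = y \<otimes> z) \<and>
        comm u y = b \<and> comm x y = c))"

definition square :: "'a \<Rightarrow> 'a \<Rightarrow> 'a \<Rightarrow> 'a \<Rightarrow> bool" where
  "square u l d c \<longleftrightarrow> (\<exists>b\<in>carrier G. product u l d b b c)"

text \<open>Encodes \<open>four_squares_over_square\<close> on exponents: \<open>q\<close> is the
  square of \<open>y\<close>, the element \<one> stands for the number 0, and group multiplication
  adds the four squares.\<close>

definition natural :: "'a \<Rightarrow> 'a \<Rightarrow> 'a \<Rightarrow> 'a \<Rightarrow> bool" where
  "natural u l d a \<longleftrightarrow> (\<exists>y\<in>carrier G. y \<noteq> \<one> \<and> (\<exists>q\<in>carrier G. product u l d y y q \<and>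
     (\<exists>c\<^sub>1\<in>carrier G. square u l d c\<^sub>1 \<and> (\<exists>c\<^sub>2\<in>carrier G. square u l d c\<^sub>2 \<and>
     (\<exists>c\<^sub>3\<in>carrier G. square u l d c\<^sub>3 \<and> (\<exists>c\<^sub>4\<in>carrier G. square u l d c\<^sub>4 \<and>
        product u l d a q (c\<^sub>1 \<otimes> c\<^sub>2 \<otimes> c\<^sub>3 \<otimes> c\<^sub>4)))))))"

text \<open>On exponents the equation reads m = k + 1 + z.\<close>

definition less :: "'a \<Rightarrow> 'a \<Rightarrow> 'a \<Rightarrow> 'a \<Rightarrow> 'a \<Rightarrow> bool" where
  "less u l d k m \<longleftrightarrow> natural u l d k \<and> (\<exists>z\<in>carrier G. natural u l d z \<and> m = k \<otimes> comm u l \<otimes> z)"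

text \<open>The parameters that satisfy enough of Robinson's arithmetic for the powers of \<open>comm u l\<close> to form an
  initial segment of the interpreted structure, which may be nonstandard.\<close>

definition good :: "'a \<Rightarrow> 'a \<Rightarrow> 'a \<Rightarrow> bool" where
  "good u l d \<longleftrightarrow> natural u l d \<one> \<and>
     (\<forall>x\<in>carrier G. natural u l d x \<longrightarrow> natural u l d (x \<otimes> comm u l)) \<and>
     (\<forall>x\<in>carrier G. natural u l d x \<longrightarrow> product u l d x \<one> \<one>) \<and>
     (\<forall>x\<in>carrier G. \<forall>y\<in>carrier G. \<forall>z\<in>carrier G. product u l d x y z \<longrightarrow>
        product u l d x (y \<otimes> comm u l) (z \<otimes> x)) \<and>
     (\<forall>x\<in>carrier G. \<not> less u l d x \<one>) \<and>
     (\<forall>x\<in>carrier G. \<forall>y\<in>carrier G. less u l d x (y \<otimes> comm u l) \<and> \<not> less u l d x y \<longrightarrow> x = y)"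

end

text \<open>What \<open>Aut(N)\<close> has to supply. By the commutation rules and the infinite
  order of \<open>comm u l\<close>, the elements \<open>u\<close> and \<open>l\<close> generate an
  integral Heisenberg group; the last assumption makes its center
  \<open>\<langle>comm u l\<rangle>\<close> definable.\<close>

locale malcev = group G for G (structure) +
  fixes u l d
  assumes ul_closed [simp]: "u \<in> carrier G" "l \<in> carrier G" "d \<in> carrier G"
    and ud: "u \<otimes> d = d \<otimes> u"
    and u_comm: "u \<otimes> comm u l = comm u l \<otimes> u"
    and l_comm: "l \<otimes> comm u l = comm u l \<otimes> l"
    and inj_pow: "comm u l [^] (n::int) = \<one> \<Longrightarrow> n = 0"
    and centralizes_comm: "x \<in> carrier G \<Longrightarrow> centralizes u l d x \<Longrightarrow> \<exists>n::int. comm x l = comm u l [^] n"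
begin

abbreviation v where "v \<equiv> comm u l"

lemma v_pow_eq_iff: "v [^] (m::int) = v [^] n \<longleftrightarrow> m = n"
proof
  assume "v [^] m = v [^] n"
  then have "v [^] (m - n) = \<one>" by (simp add: int_pow_diff)
  then show "m = n" using inj_pow by fastforce
qed simp

lemma v_pow_add: "v [^] (m::int) \<otimes> v [^] n = v [^] (m + n)"
  by (simp add: int_pow_mult)

lemma mult_v_pow: "v [^] (m::int) \<otimes> v = v [^] (m + 1)"
  using v_pow_add[of m 1] by simp

lemma centralizes_u_pow: "centralizes u l d (u [^] (m::int))"
  unfolding centralizes_def using ud u_comm by (simp add: int_pow_commute)

lemma comm_u_pow_l: "comm (u [^] (m::int)) l = v [^] m"
  using u_comm by (simp add: comm_int_pow_left)

text \<open>The powers of \<open>u\<close> lie in the centralizer and realise every exponent;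
  \<open>centralizes_comm\<close> excludes other values.\<close>

lemma scalar_iff: "scalar u l d a \<longleftrightarrow> (\<exists>n::int. a = v [^] n)"
  unfolding scalar_def using centralizes_comm comm_u_pow_l centralizes_u_pow
  by (metis int_pow_closed ul_closed(1))

lemma centralizes_mult:
  assumes "x \<in> carrier G" "y \<in> carrier G" "centralizes u l d x" "centralizes u l d y"
  shows "centralizes u l d (inv x \<otimes> y)"
proof -
  have "inv x \<otimes> y \<otimes> z = z \<otimes> (inv x \<otimes> y)" if "x \<otimes> z = z \<otimes> x" "y \<otimes> z = z \<otimes> y" "z \<in> carrier G" for z
  proof -
    have "inv x \<otimes> y \<otimes> z = inv x \<otimes> z \<otimes> y" using that assms(1,2) by (simp add: m_assoc)
    then show ?thesis using that assms(1,2) inv_commute[of x z] by (simp add: m_assoc)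
  qed
  then show ?thesis using assms by (simp add: centralizes_def)
qed

text \<open>For the forward direction \<open>x\<close> is replaced by the power of \<open>u\<close>
  with the same commutator with \<open>l\<close>; then \<open>comm (u [^] m) y\<close> is the m-th
  power of \<open>comm u y = b\<close>.\<close>

lemma product_iff:
  "product u l d a b c \<longleftrightarrow> (\<exists>m n :: int. a = v [^] m \<and> b = v [^] n \<and> c = v [^] (m * n))"
proof
  assume "product u l d a b c"
  then obtain x y where b: "scalar u l d b" and x: "x \<in> carrier G" "centralizes u l d x" "comm x l = a"
    and y: "y \<in> carrier G" "comm u y = b" "comm x y = c"
    and cy: "\<And>z. z \<in> carrier G \<Longrightarrow> centralizes u l d z \<Longrightarrow> z \<otimes> l = l \<otimes> z \<Longrightarrow> z \<otimes> y = y \<otimes> z"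
    unfolding product_def by blast
  obtain n :: int where n: "b = v [^] n" using b unfolding scalar_iff by blast
  obtain m :: int where m: "a = v [^] m" using centralizes_comm x by blast
  \<comment> \<open>\<open>x\<close> and \<open>u [^] m\<close> have the same commutator with
    \<open>l\<close>, so their quotient commutes with \<open>l\<close>, and therefore with
    \<open>y\<close> by the condition on \<open>z\<close>.\<close>
  let ?z = "inv (u [^] m) \<otimes> x"
  have z: "?z \<in> carrier G" "x = u [^] m \<otimes> ?z" using x(1) by simp_all
  have cz: "centralizes u l d ?z" using x centralizes_u_pow by (simp add: centralizes_mult)
  have "x \<otimes> l = comm (u [^] m) l \<otimes> (l \<otimes> x)"
    using comm_mult_swap[OF x(1) ul_closed(2)] unfolding x(3) m comm_u_pow_l by simp
  then have "x \<otimes> l = u [^] m \<otimes> l \<otimes> inv (u [^] m) \<otimes> x"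
    using x(1) by (simp add: comm_def m_assoc)
  then have "?z \<otimes> l = l \<otimes> ?z" using x(1) by (simp add: m_assoc)
  then have zy: "?z \<otimes> y = y \<otimes> ?z" using cy cz z(1) by blast
  have "comm x y = comm (u [^] m) y"
  proof -
    have "x \<otimes> y = u [^] m \<otimes> (?z \<otimes> y)" using x(1) y(1) by (simp add: m_assoc)
    also have "\<dots> = u [^] m \<otimes> y \<otimes> inv (u [^] m) \<otimes> x"
      unfolding zy using x(1) y(1) by (simp add: m_assoc)
    finally show ?thesis using x(1) y(1) unfolding comm_def
      by (simp add: m_assoc)
  qed
  also have "\<dots> = b [^] m"
    unfolding y(2)[symmetric]
  proof (rule comm_int_pow_left)
    show "u \<otimes> comm u y = comm u y \<otimes> u"
      unfolding y(2) n using u_comm by (simp add: int_pow_commute)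
  qed (use y in simp_all)
  also have "\<dots> = v [^] (m * n)" unfolding n by (simp add: int_pow_pow mult.commute)
  finally show "\<exists>m n :: int. a = v [^] m \<and> b = v [^] n \<and> c = v [^] (m * n)"
    using m n y(3) by blast
next
  assume "\<exists>m n :: int. a = v [^] m \<and> b = v [^] n \<and> c = v [^] (m * n)"
  then obtain m n :: int where abc: "a = v [^] m" "b = v [^] n" "c = v [^] (m * n)" by blast
  \<comment> \<open>The witnesses are x = \<open>u [^] m\<close> and y = \<open>l [^] n\<close>;
    whatever commutes with \<open>l\<close> commutes with its powers.\<close>
  have uy: "comm u (l [^] n) = b" unfolding abc using l_comm by (simp add: comm_int_pow_right)
  have "comm (u [^] m) (l [^] n) = b [^] m" unfolding uy[symmetric]
  proof (rule comm_int_pow_left)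
    show "u \<otimes> comm u (l [^] n) = comm u (l [^] n) \<otimes> u"
      unfolding uy abc using u_comm by (simp add: int_pow_commute)
  qed simp_all
  then have xy: "comm (u [^] m) (l [^] n) = c"
    unfolding abc by (simp add: int_pow_pow mult.commute)
  have "z \<otimes> l [^] n = l [^] n \<otimes> z" if "z \<in> carrier G" "z \<otimes> l = l \<otimes> z" for z
    using that int_pow_commute[of l z n] by simp
  then show "product u l d a b c"
    unfolding product_def scalar_iff
    using uy xy abc centralizes_u_pow[of m] comm_u_pow_l[of m]
    by (metis int_pow_closed ul_closed(1,2))
qed

lemma square_iff: "square u l d c \<longleftrightarrow> (\<exists>n::int. c = v [^] (n\<^sup>2))"
proof
  assume "square u l d c"
  then obtain b m n where "b = v [^] (m::int)" "b = v [^] n" "c = v [^] (m * n)"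
    unfolding square_def product_iff by blast
  then show "\<exists>n::int. c = v [^] (n\<^sup>2)"
    by (auto simp: v_pow_eq_iff power2_eq_square)
next
  assume "\<exists>n::int. c = v [^] (n\<^sup>2)"
  then obtain n where "c = v [^] (n * n :: int)" by (auto simp: power2_eq_square)
  then have "product u l d (v [^] n) (v [^] n) c" unfolding product_iff by blast
  moreover have "v [^] n \<in> carrier G" by simp
  ultimately show "square u l d c" unfolding square_def by blast
qed

lemma natural_iff: "natural u l d a \<longleftrightarrow> (\<exists>n::nat. a = v [^] int n)"
proof
  assume "natural u l d a"
  then obtain y q c1 c2 c3 c4 where y: "y \<noteq> \<one>" "product u l d y y q"
    and c: "square u l d c1" "square u l d c2" "square u l d c3" "square u l d c4"
    and p: "product u l d a q (c1 \<otimes> c2 \<otimes> c3 \<otimes> c4)"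
    unfolding natural_def by blast
  obtain m :: int where m: "y = v [^] m" "q = v [^] (m * m)"
    using y(2) unfolding product_iff by (auto simp: v_pow_eq_iff)
  obtain k1 k2 k3 k4 :: int where k: "c1 = v [^] (k1\<^sup>2)" "c2 = v [^] (k2\<^sup>2)" "c3 = v [^] (k3\<^sup>2)" "c4 = v [^] (k4\<^sup>2)"
    using c unfolding square_iff by blast
  obtain n n' where n: "a = v [^] (n::int)" "q = v [^] n'" "c1 \<otimes> c2 \<otimes> c3 \<otimes> c4 = v [^] (n * n')"
    using p unfolding product_iff by blast
  \<comment> \<open>As \<open>v\<close> has infinite order, equal powers have equal
    exponents.\<close>
  have "n * m\<^sup>2 = k1\<^sup>2 + k2\<^sup>2 + k3\<^sup>2 + k4\<^sup>2"
    using n(2,3) unfolding m(2) k v_pow_add v_pow_eq_iff by (simp add: power2_eq_square)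
  moreover have "m \<noteq> 0" using y(1) m(1) by auto
  ultimately have "0 \<le> n" unfolding four_squares_over_square_iff[symmetric] four_squares_over_square_def by blast
  then show "\<exists>n::nat. a = v [^] int n" using n(1) by (metis int_nat_eq)
next
  assume "\<exists>n::nat. a = v [^] int n"
  then obtain n where a: "a = v [^] int n" by blast
  obtain y k1 k2 k3 k4 where y: "y \<noteq> 0" and k: "int n * y\<^sup>2 = k1\<^sup>2 + k2\<^sup>2 + k3\<^sup>2 + k4\<^sup>2"
    using four_squares_over_square_nat[of n] unfolding four_squares_over_square_def by blast
  have 1: "v [^] y \<noteq> \<one>" using inj_pow y by blast
  have 2: "product u l d (v [^] y) (v [^] y) (v [^] (y\<^sup>2))"
    unfolding product_iff power2_eq_square by blast
  have 3: "square u l d (v [^] (k\<^sup>2))" for k :: int unfolding square_iff by blast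
  have "v [^] (k1\<^sup>2) \<otimes> v [^] (k2\<^sup>2) \<otimes> v [^] (k3\<^sup>2) \<otimes> v [^] (k4\<^sup>2) = v [^] (int n * y\<^sup>2)"
    unfolding k v_pow_add by (rule refl)
  then have 4: "product u l d a (v [^] (y\<^sup>2)) (v [^] (k1\<^sup>2) \<otimes> v [^] (k2\<^sup>2) \<otimes> v [^] (k3\<^sup>2) \<otimes> v [^] (k4\<^sup>2))"
    unfolding product_iff a by blast
  show "natural u l d a"
    unfolding natural_def
    by (intro bexI conjI, rule 1, rule 2, rule 3, rule 3, rule 3, rule 3, rule 4) simp_all
qed

lemma less_iff: "less u l d a b \<longleftrightarrow> (\<exists>m n::nat. m < n \<and> a = v [^] int m \<and> b = v [^] int n)"
proof
  assume "less u l d a b"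
  then obtain m k where a: "a = v [^] int m" and "b = a \<otimes> v \<otimes> v [^] int k"
    unfolding less_def natural_iff by blast
  moreover have "a \<otimes> v \<otimes> v [^] int k = v [^] int (m + k + 1)"
    unfolding a mult_v_pow v_pow_add v_pow_eq_iff by simp
  ultimately have "b = v [^] int (m + k + 1)" by simp
  moreover have "m < m + k + 1" by simp
  ultimately show "\<exists>m n::nat. m < n \<and> a = v [^] int m \<and> b = v [^] int n"
    using a by blast
next
  assume "\<exists>m n::nat. m < n \<and> a = v [^] int m \<and> b = v [^] int n"
  then obtain m n where mn: "m < n" "a = v [^] int m" "b = v [^] int n" by blast
  then obtain k where k: "n = Suc (m + k)" using less_imp_Suc_add by blast
  have "b = a \<otimes> v \<otimes> v [^] int k"
    unfolding mn(2,3) k mult_v_pow v_pow_add v_pow_eq_iff by simp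
  moreover have "natural u l d a" "natural u l d (v [^] int k)"
    unfolding natural_iff mn(2) by blast+
  moreover have "v [^] int k \<in> carrier G" by simp
  ultimately show "less u l d a b" unfolding less_def by blast
qed

text \<open>The intended parameters thus belong to the range of the universal quantifier in the
  diagonal sentence.\<close>

lemma good: "good u l d"
  unfolding good_def
proof (intro conjI ballI impI)
  show "natural u l d \<one>" unfolding natural_iff by (rule exI[of _ 0]) simp
  fix x assume x: "x \<in> carrier G"
  show "natural u l d (x \<otimes> v)" if h: "natural u l d x"
  proof -
    obtain n where "x = v [^] int n" using h unfolding natural_iff by blast
    then have "x \<otimes> v = v [^] int (n + 1)" by (simp add: mult_v_pow add.commute)
    then show ?thesis unfolding natural_iff by (intro exI)
  qed
  show "product u l d x \<one> \<one>" if h: "natural u l d x"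
  proof -
    obtain n where "x = v [^] int n" using h unfolding natural_iff by blast
    then have "x = v [^] int n \<and> \<one> = v [^] (0::int) \<and> \<one> = v [^] (int n * 0)" by simp
    then show ?thesis unfolding product_iff by (intro exI)
  qed
  show "\<not> less u l d x \<one>"
  proof
    assume "less u l d x \<one>"
    then obtain m n :: nat where "m < n" "\<one> = v [^] int n" unfolding less_iff by blast
    then show False using inj_pow[of "int n"] by simp
  qed
  fix y assume y: "y \<in> carrier G"
  show "x = y" if h: "less u l d x (y \<otimes> v) \<and> \<not> less u l d x y"
  proof -
    obtain m n :: nat where mn: "m < n" "x = v [^] int m" "y \<otimes> v = v [^] int n"
      using h unfolding less_iff by blast
    have "v [^] int n = v [^] int (n - 1) \<otimes> v" unfolding mult_v_pow using mn(1) by simp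
    then have y': "y = v [^] int (n - 1)" using mn(3) y by simp
    have "\<not> m < n - 1"
    proof
      assume "m < n - 1"
      then have "less u l d x y" unfolding less_iff mn(2) y'
        by (intro exI[of _ m] exI[of _ "n - 1"]) simp
      then show False using h by blast
    qed
    then have "m = n - 1" using mn(1) by linarith
    then show ?thesis using mn(2) y' by simp
  qed
  fix z assume z: "z \<in> carrier G"
  show "product u l d x (y \<otimes> v) (z \<otimes> x)" if h: "product u l d x y z"
  proof -
    obtain m n :: int where mn: "x = v [^] m" "y = v [^] n" "z = v [^] (m * n)"
      using h unfolding product_iff by blast
    have "x = v [^] m \<and> y \<otimes> v = v [^] (n + 1) \<and> z \<otimes> x = v [^] (m * (n + 1))"
      unfolding mn mult_v_pow v_pow_add v_pow_eq_iff by (simp add: algebra_simps)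
    then show ?thesis unfolding product_iff by (intro exI)
  qed
qed

end

section \<open>First-order formulas of the interpretation\<close>

definition F_all :: "nat \<Rightarrow> gformula \<Rightarrow> gformula" where
  "F_all x \<phi> = Neg (Exists x (Neg \<phi>))"

definition F_imp :: "gformula \<Rightarrow> gformula \<Rightarrow> gformula" where
  "F_imp \<phi> \<psi> = Neg (Conj \<phi> (Neg \<psi>))"

definition F_commute :: "gterm \<Rightarrow> gterm \<Rightarrow> gformula" where
  "F_commute s t = Eq (Mult s t) (Mult t s)"

definition T_comm :: "gterm \<Rightarrow> gterm \<Rightarrow> gterm" where
  "T_comm s t = Mult (Mult (Mult s t) (Inv s)) (Inv t)"

text \<open>The parameters \<open>u, l, d\<close> are the variables 0, 1, 2. The variables 3 to 19 are reserved for the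
  quantifiers below, and 20, 21, \<dots> stand for numbers.\<close>

definition T_unit :: gterm where
  "T_unit = T_comm (Var 0) (Var 1)"

definition F_centralizes :: "gterm \<Rightarrow> gformula" where
  "F_centralizes t = Conj (F_commute t (Var 0)) (Conj (F_commute t (Var 2)) (F_commute t T_unit))"

definition F_scalar :: "gterm \<Rightarrow> gformula" where
  "F_scalar a = Exists 3 (Conj (F_centralizes (Var 3)) (Eq (T_comm (Var 3) (Var 1)) a))"

text \<open>Bound variables are staggered against capture: 3 to 5 here, 6 in
  \<open>F_square\<close>, 7 to 12 in \<open>F_natural\<close>, 13 in \<open>F_less\<close>, 14 to
  16 in \<open>F_good\<close>. The disjointness hypotheses of the corresponding \<open>sat\<close>
  lemmas reflect this.\<close>

definition F_product :: "gterm \<Rightarrow> gterm \<Rightarrow> gterm \<Rightarrow> gformula" where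
  "F_product a b c = Conj (F_scalar b)
     (Exists 3 (Conj (F_centralizes (Var 3)) (Conj (Eq (T_comm (Var 3) (Var 1)) a)
       (Exists 4 (Conj
         (F_all 5 (F_imp (Conj (F_centralizes (Var 5)) (F_commute (Var 5) (Var 1))) (F_commute (Var 5) (Var 4))))
         (Conj (Eq (T_comm (Var 0) (Var 4)) b) (Eq (T_comm (Var 3) (Var 4)) c)))))))"

definition F_square :: "gterm \<Rightarrow> gformula" where
  "F_square c = Exists 6 (F_product (Var 6) (Var 6) c)"

definition F_natural :: "gterm \<Rightarrow> gformula" where
  "F_natural a = Exists 7 (Conj (Neg (Eq (Var 7) One))
     (Exists 8 (Conj (F_product (Var 7) (Var 7) (Var 8))
     (Exists 9 (Conj (F_square (Var 9)) (Exists 10 (Conj (F_square (Var 10))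
     (Exists 11 (Conj (F_square (Var 11)) (Exists 12 (Conj (F_square (Var 12))
       (F_product a (Var 8) (Mult (Mult (Mult (Var 9) (Var 10)) (Var 11)) (Var 12))))))))))))))"

definition F_less :: "gterm \<Rightarrow> gterm \<Rightarrow> gformula" where
  "F_less k m = Conj (F_natural k)
     (Exists 13 (Conj (F_natural (Var 13)) (Eq m (Mult (Mult k T_unit) (Var 13)))))"

definition F_good :: gformula where
  "F_good = Conj (F_natural One)
     (Conj (F_all 14 (F_imp (F_natural (Var 14)) (F_natural (Mult (Var 14) T_unit))))
     (Conj (F_all 14 (F_imp (F_natural (Var 14)) (F_product (Var 14) One One)))
     (Conj (F_all 14 (F_all 15 (F_all 16 (F_imp (F_product (Var 14) (Var 15) (Var 16))
        (F_product (Var 14) (Mult (Var 15) T_unit) (Mult (Var 16) (Var 14)))))))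
     (Conj (F_all 14 (Neg (F_less (Var 14) One)))
        (F_all 14 (F_all 15 (F_imp (Conj (F_less (Var 14) (Mult (Var 15) T_unit)) (Neg (F_less (Var 14) (Var 15))))
          (Eq (Var 14) (Var 15)))))))))"

lemma tm_vars_simps [simp]:
  "tm_vars T_unit = {0, 1}" "tm_vars (T_comm s t) = tm_vars s \<union> tm_vars t"
  by (auto simp: T_unit_def T_comm_def)

lemma free_vars_simps [simp]:
  "free_vars (F_all x \<phi>) = free_vars \<phi> - {x}" "free_vars (F_imp \<phi> \<psi>) = free_vars \<phi> \<union> free_vars \<psi>"
  "free_vars (F_commute s t) = tm_vars s \<union> tm_vars t"
  by (auto simp: F_all_def F_imp_def F_commute_def)

lemma free_vars_product: "free_vars (F_product a b c) \<subseteq> {0, 1, 2} \<union> tm_vars a \<union> tm_vars b \<union> tm_vars c"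
  by (auto simp: F_product_def F_scalar_def F_centralizes_def)

lemma free_vars_square: "free_vars (F_square c) \<subseteq> {0, 1, 2} \<union> tm_vars c"
  using free_vars_product[of "Var 6" "Var 6" c] by (auto simp: F_square_def)

lemma free_vars_natural: "free_vars (F_natural a) \<subseteq> {0, 1, 2} \<union> tm_vars a"
proof -
  have "free_vars (F_product a (Var 8) (Mult (Mult (Mult (Var 9) (Var 10)) (Var 11)) (Var 12)))
    \<subseteq> {0, 1, 2} \<union> tm_vars a \<union> {8, 9, 10, 11, 12}"
    by (rule order_trans[OF free_vars_product]) auto
  moreover have "free_vars (F_product (Var 7) (Var 7) (Var 8)) \<subseteq> {0, 1, 2} \<union> {7, 8}"
    by (rule order_trans[OF free_vars_product]) auto
  moreover have "free_vars (F_square (Var k)) \<subseteq> {0, 1, 2} \<union> {k}" for k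
    by (rule order_trans[OF free_vars_square]) auto
  ultimately show ?thesis
    unfolding F_natural_def free_vars.simps tm_vars.simps by blast
qed

lemma free_vars_less: "free_vars (F_less k m) \<subseteq> {0, 1, 2} \<union> tm_vars k \<union> tm_vars m"
  using free_vars_natural[of k] free_vars_natural[of "Var 13"] by (auto simp: F_less_def)

lemma free_vars_good: "free_vars F_good \<subseteq> {0, 1, 2}"
proof -
  have nat: "free_vars (F_natural One) \<subseteq> {0, 1, 2}" "free_vars (F_natural (Var 14)) \<subseteq> {0, 1, 2, 14}"
    "free_vars (F_natural (Mult (Var 14) T_unit)) \<subseteq> {0, 1, 2, 14}"
    by (rule order_trans[OF free_vars_natural]; auto)+
  have prod: "free_vars (F_product (Var 14) One One) \<subseteq> {0, 1, 2, 14}"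
    "free_vars (F_product (Var 14) (Var 15) (Var 16)) \<subseteq> {0, 1, 2, 14, 15, 16}"
    "free_vars (F_product (Var 14) (Mult (Var 15) T_unit) (Mult (Var 16) (Var 14))) \<subseteq> {0, 1, 2, 14, 15, 16}"
    by (rule order_trans[OF free_vars_product]; auto)+
  have less: "free_vars (F_less (Var 14) One) \<subseteq> {0, 1, 2, 14}"
    "free_vars (F_less (Var 14) (Mult (Var 15) T_unit)) \<subseteq> {0, 1, 2, 14, 15}"
    "free_vars (F_less (Var 14) (Var 15)) \<subseteq> {0, 1, 2, 14, 15}"
    by (rule order_trans[OF free_vars_less]; auto)+
  show ?thesis
    unfolding F_good_def free_vars.simps(3) Un_subset_iff
  proof (intro conjI)
    show "free_vars (F_all 14 (F_imp (F_natural (Var 14)) (F_natural (Mult (Var 14) T_unit)))) \<subseteq> {0, 1, 2}"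
      using nat(2,3) by auto
    show "free_vars (F_all 14 (F_imp (F_natural (Var 14)) (F_product (Var 14) One One))) \<subseteq> {0, 1, 2}"
      using nat(2) prod(1) by auto
    show "free_vars (F_all 14 (F_all 15 (F_all 16 (F_imp (F_product (Var 14) (Var 15) (Var 16))
        (F_product (Var 14) (Mult (Var 15) T_unit) (Mult (Var 16) (Var 14))))))) \<subseteq> {0, 1, 2}"
      using prod(2,3) by auto
    show "free_vars (F_all 14 (Neg (F_less (Var 14) One))) \<subseteq> {0, 1, 2}"
      using less(1) by auto
    show "free_vars (F_all 14 (F_all 15 (F_imp (Conj (F_less (Var 14) (Mult (Var 15) T_unit))
        (Neg (F_less (Var 14) (Var 15)))) (Eq (Var 14) (Var 15))))) \<subseteq> {0, 1, 2}"
      using less(2,3) by auto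
  qed (rule nat(1))
qed

lemma tm_val_upd [simp]: "x \<notin> tm_vars t \<Longrightarrow> tm_val G (v(x := a)) t = tm_val G v t"
  by (rule tm_val_cong) auto

lemma sat_all [simp]: "sat G v (F_all x \<phi>) \<longleftrightarrow> (\<forall>a\<in>carrier G. sat G (v(x := a)) \<phi>)"
  by (simp add: F_all_def)

lemma sat_imp [simp]: "sat G v (F_imp \<phi> \<psi>) \<longleftrightarrow> (sat G v \<phi> \<longrightarrow> sat G v \<psi>)"
  by (simp add: F_imp_def)

context group
begin

lemma tm_val_T_comm [simp]: "tm_val G v (T_comm s t) = comm (tm_val G v s) (tm_val G v t)"
  by (simp add: T_comm_def comm_def)

lemma tm_val_T_unit [simp]: "tm_val G v T_unit = comm (v 0) (v 1)"
  by (simp add: T_unit_def)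

lemma sat_centralizes [simp]:
  "sat G v (F_centralizes t) \<longleftrightarrow> centralizes (v 0) (v 1) (v 2) (tm_val G v t)"
  by (simp add: F_centralizes_def F_commute_def centralizes_def)

lemma sat_product [simp]:
  "{3, 4, 5} \<inter> (tm_vars a \<union> tm_vars b \<union> tm_vars c) = {} \<Longrightarrow>
     sat G v (F_product a b c) \<longleftrightarrow>
       product (v 0) (v 1) (v 2) (tm_val G v a) (tm_val G v b) (tm_val G v c)"
  by (simp add: F_product_def F_scalar_def product_def scalar_def F_commute_def)

lemma sat_square [simp]:
  "{3, 4, 5, 6} \<inter> tm_vars c = {} \<Longrightarrow>
     sat G v (F_square c) \<longleftrightarrow> square (v 0) (v 1) (v 2) (tm_val G v c)"
  by (simp add: F_square_def square_def)

lemma sat_natural [simp]: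
  "{3..12} \<inter> tm_vars a = {} \<Longrightarrow>
     sat G v (F_natural a) \<longleftrightarrow> natural (v 0) (v 1) (v 2) (tm_val G v a)"
  by (simp add: F_natural_def natural_def disjoint_iff)

lemma sat_less [simp]:
  "{3..13} \<inter> (tm_vars k \<union> tm_vars m) = {} \<Longrightarrow>
     sat G v (F_less k m) \<longleftrightarrow> less (v 0) (v 1) (v 2) (tm_val G v k) (tm_val G v m)"
  by (simp add: F_less_def less_def disjoint_iff)

lemma sat_good [simp]: "sat G v F_good \<longleftrightarrow> good (v 0) (v 1) (v 2)"
  by (simp add: F_good_def good_def)

end

section \<open>Representable relations\<close>

context group
begin

text \<open>Combines arbitrary group elements, among them the parameters, with standard numbers
  coded as powers of the commutator of the parameters.\<close>

definition env :: "(nat \<Rightarrow> 'a) \<Rightarrow> (nat \<Rightarrow> nat) \<Rightarrow> nat \<Rightarrow> 'a" where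
  "env p w k = (if k < 20 then p k else comm (p 0) (p 1) [^] int (w (k - 20)))"

lemma env_simps [simp]: "env p w 0 = p 0" "env p w 1 = p 1" "env p w (Suc 0) = p (Suc 0)" "env p w 2 = p 2"
  "env p w (20 + i) = comm (p 0) (p 1) [^] int (w i)"
  "env p w (i + 20) = comm (p 0) (p 1) [^] int (w i)"
  by (simp_all add: env_def)

lemma env_upd: "(env p w)(20 + i := comm (p 0) (p 1) [^] int n) = env p (w(i := n))"
  by (auto simp: env_def fun_eq_iff)

lemma env_closed:
  assumes "range p \<subseteq> carrier G"
  shows "range (env p w) \<subseteq> carrier G"
  using assms by (auto simp: env_def image_subset_iff intro!: int_pow_closed comm_closed)

text \<open>Even in a nonstandard good structure the numerals multiply correctly and only numerals
  lie below a numeral. Each part is an induction on \<open>n\<close> from the matching clauses of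
  \<open>good\<close>.\<close>

lemma good_pow:
  assumes p: "p \<in> carrier G" "q \<in> carrier G" and good: "good p q r"
  shows "natural p q r (comm p q [^] int n)"
    and "product p q r (comm p q [^] int m) (comm p q [^] int n) (comm p q [^] int (m * n))"
    and "x \<in> carrier G \<Longrightarrow> less p q r x (comm p q [^] int n) \<Longrightarrow> \<exists>k<n. x = comm p q [^] int k"
proof -
  have pow_Suc: "comm p q [^] int (Suc n) = comm p q [^] int n \<otimes> comm p q" for n
    using int_pow_mult[of "comm p q" "int n" 1] p by (simp add: add.commute)
  show nat: "natural p q r (comm p q [^] int n)" for n
  proof (induction n)
    case 0
    show ?case using good by (simp add: good_def)
  next
    case (Suc n)
    then show ?case unfolding pow_Suc using good p by (simp add: good_def)
  qed
  show "product p q r (comm p q [^] int m) (comm p q [^] int n) (comm p q [^] int (m * n))"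
  proof (induction n)
    case 0
    show ?case using good p nat[of m] by (simp add: good_def)
  next
    case (Suc n)
    have "comm p q [^] int (m * Suc n) = comm p q [^] int (m * n) \<otimes> comm p q [^] int m"
      using int_pow_mult[of "comm p q" "int (m * n)" "int m"] p by (simp add: algebra_simps)
    then show ?case unfolding pow_Suc using good p Suc.IH by (simp add: good_def)
  qed
  show "\<exists>k<n. x = comm p q [^] int k" if x: "x \<in> carrier G" and l: "less p q r x (comm p q [^] int n)"
    using l
  proof (induction n)
    case 0
    then show ?case using good x by (simp add: good_def)
  next
    case (Suc n)
    show ?case
    proof (cases "less p q r x (comm p q [^] int n)")
      case True
      then show ?thesis using Suc.IH less_Suc_eq by blast
    next
      case False
      then have "x = comm p q [^] int n"
        using Suc.prems good p x unfolding pow_Suc good_def by simp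
      then show ?thesis by blast
    qed
  qed
qed

end

context malcev
begin

text \<open>Only one implication is required at nonstandard parameters: \<open>\<Sigma>\<^sub>1\<close> facts persist upwards.\<close>

definition represents :: "gformula \<Rightarrow> ((nat \<Rightarrow> nat) \<Rightarrow> bool) \<Rightarrow> bool" where
  "represents \<phi> P \<longleftrightarrow>
     (\<forall>p w. range p \<subseteq> carrier G \<longrightarrow> good (p 0) (p 1) (p 2) \<longrightarrow> P w \<longrightarrow> sat G (env p w) \<phi>) \<and>
     (\<forall>p w. range p \<subseteq> carrier G \<longrightarrow> p 0 = u \<longrightarrow> p 1 = l \<longrightarrow> p 2 = d \<longrightarrow> sat G (env p w) \<phi> \<longrightarrow> P w)"

definition rep :: "((nat \<Rightarrow> nat) \<Rightarrow> bool) \<Rightarrow> bool" where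
  "rep P \<longleftrightarrow> (\<exists>\<phi>. represents \<phi> P)"

lemma repI:
  assumes "\<And>p w. range p \<subseteq> carrier G \<Longrightarrow> p 0 \<in> carrier G \<Longrightarrow> p 1 \<in> carrier G \<Longrightarrow>
      good (p 0) (p 1) (p 2) \<Longrightarrow> P w \<Longrightarrow> sat G (env p w) \<phi>"
    and "\<And>p w. range p \<subseteq> carrier G \<Longrightarrow> p 0 = u \<Longrightarrow> p 1 = l \<Longrightarrow> p 2 = d \<Longrightarrow> sat G (env p w) \<phi> \<Longrightarrow> P w"
  shows "rep P"
  unfolding rep_def represents_def using assms by (metis rangeI subsetD)

lemma rep_cong:
  assumes "rep P" "\<And>w. P w \<longleftrightarrow> Q w"
  shows "rep Q"
proof -
  have "P = Q" using assms(2) by (rule ext)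
  then show ?thesis using assms(1) by simp
qed

lemma rep_const: "rep (\<lambda>w. b)"
proof (cases b)
  case True
  then show ?thesis by (intro repI[of _ "Eq One One"]) auto
next
  case False
  then show ?thesis by (intro repI[of _ "Neg (Eq One One)"]) auto
qed

lemma rep_eq_var: "rep (\<lambda>w. w i = w j)"
  by (rule repI[of _ "Eq (Var (20 + i)) (Var (20 + j))"]) (simp_all add: v_pow_eq_iff)

lemma rep_eq_0: "rep (\<lambda>w. w i = 0)"
proof (rule repI[of _ "Eq (Var (20 + i)) One"])
  fix p :: "nat \<Rightarrow> 'a" and w assume "p 0 = u" "p 1 = l" "sat G (env p w) (Eq (Var (20 + i)) One)"
  then show "w i = 0" using inj_pow[of "int (w i)"] by simp
qed simp

lemma rep_eq_Suc: "rep (\<lambda>w. w j = Suc (w i))"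
proof (rule repI[of _ "Eq (Var (20 + j)) (Mult (Var (20 + i)) T_unit)"])
  fix p :: "nat \<Rightarrow> 'a" and w :: "nat \<Rightarrow> nat"
  assume "p 0 \<in> carrier G" "p 1 \<in> carrier G" "w j = Suc (w i)"
  then show "sat G (env p w) (Eq (Var (20 + j)) (Mult (Var (20 + i)) T_unit))"
    using int_pow_mult[of "comm (p 0) (p 1)" "int (w i)" 1] by (simp add: add.commute)
next
  fix p :: "nat \<Rightarrow> 'a" and w assume "p 0 = u" "p 1 = l"
    "sat G (env p w) (Eq (Var (20 + j)) (Mult (Var (20 + i)) T_unit))"
  then have "v [^] int (w j) = v [^] (int (w i) + 1)" by (simp add: mult_v_pow)
  then show "w j = Suc (w i)" unfolding v_pow_eq_iff by simp
qed

lemma rep_eq_add: "rep (\<lambda>w. w k = w i + w j)"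
proof (rule repI[of _ "Eq (Var (20 + k)) (Mult (Var (20 + i)) (Var (20 + j)))"])
  fix p :: "nat \<Rightarrow> 'a" and w :: "nat \<Rightarrow> nat"
  assume "p 0 \<in> carrier G" "p 1 \<in> carrier G" "w k = w i + w j"
  then show "sat G (env p w) (Eq (Var (20 + k)) (Mult (Var (20 + i)) (Var (20 + j))))"
    by (simp add: int_pow_mult)
next
  fix p :: "nat \<Rightarrow> 'a" and w assume "p 0 = u" "p 1 = l"
    "sat G (env p w) (Eq (Var (20 + k)) (Mult (Var (20 + i)) (Var (20 + j))))"
  then have "v [^] int (w k) = v [^] (int (w i) + int (w j))" by (simp add: v_pow_add)
  then show "w k = w i + w j" unfolding v_pow_eq_iff by simp
qed

lemma rep_eq_mult: "rep (\<lambda>w. w k = w i * w j)"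
proof (rule repI[of _ "F_product (Var (20 + i)) (Var (20 + j)) (Var (20 + k))"])
  fix p :: "nat \<Rightarrow> 'a" and w :: "nat \<Rightarrow> nat"
  assume "p 0 \<in> carrier G" "p 1 \<in> carrier G" "good (p 0) (p 1) (p 2)" "w k = w i * w j"
  then show "sat G (env p w) (F_product (Var (20 + i)) (Var (20 + j)) (Var (20 + k)))"
    using good_pow(2)[of "p 0" "p 1" "p 2" "w i" "w j"] by simp
next
  fix p :: "nat \<Rightarrow> 'a" and w assume "p 0 = u" "p 1 = l" "p 2 = d"
    "sat G (env p w) (F_product (Var (20 + i)) (Var (20 + j)) (Var (20 + k)))"
  then have "product u l d (v [^] int (w i)) (v [^] int (w j)) (v [^] int (w k))" by simp
  then have "int (w k) = int (w i) * int (w j)" unfolding product_iff v_pow_eq_iff by blast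
  then show "w k = w i * w j" by (metis of_nat_eq_iff of_nat_mult)
qed

text \<open>Since the first half of \<open>represents\<close> is a single implication, relations are
  combined only by conjunction, existential quantification and bounded universal
  quantification.\<close>

lemma rep_conj:
  assumes "rep P" "rep Q"
  shows "rep (\<lambda>w. P w \<and> Q w)"
proof -
  obtain \<phi> \<psi> where "represents \<phi> P" "represents \<psi> Q" using assms rep_def by blast
  then show ?thesis
    by (intro repI[of _ "Conj \<phi> \<psi>"]) (simp_all add: represents_def)
qed

text \<open>At good parameters the numeral of \<open>n\<close> is a witness by
  \<open>good_pow\<close>; at the intended ones \<open>natural_iff\<close> turns any witness into a
  number. The formula is explicit because \<open>rep_closed\<close> tracks free variables.\<close>

lemma represents_ex:
  assumes \<phi>: "represents \<phi> P"
  shows "represents (Exists (20 + i) (Conj (F_natural (Var (20 + i))) \<phi>)) (\<lambda>w. \<exists>n. P (w(i := n)))"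
  unfolding represents_def
proof (intro conjI allI impI)
  fix p :: "nat \<Rightarrow> 'a" and w
  assume p: "range p \<subseteq> carrier G" "good (p 0) (p 1) (p 2)" and "\<exists>n. P (w(i := n))"
  then obtain n where "P (w(i := n))" by blast
  then have "sat G (env p (w(i := n))) \<phi>" using \<phi> p by (simp add: represents_def)
  moreover have pc: "p 0 \<in> carrier G" "p 1 \<in> carrier G" using p(1) by auto
  ultimately show "sat G (env p w) (Exists (20 + i) (Conj (F_natural (Var (20 + i))) \<phi>))"
    using good_pow(1)[OF pc p(2)]
    by (auto simp: env_upd[symmetric] intro!: bexI[of _ "comm (p 0) (p 1) [^] int n"])
next
  fix p :: "nat \<Rightarrow> 'a" and w
  assume p: "range p \<subseteq> carrier G" "p 0 = u" "p 1 = l" "p 2 = d"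
    and "sat G (env p w) (Exists (20 + i) (Conj (F_natural (Var (20 + i))) \<phi>))"
  then obtain a where a: "natural u l d a" "sat G ((env p w)(20 + i := a)) \<phi>" by auto
  then obtain n where "a = v [^] int n" unfolding natural_iff by blast
  then have "sat G (env p (w(i := n))) \<phi>" using a(2) env_upd[of p w i n] p by simp
  then have "P (w(i := n))" using \<phi> p unfolding represents_def by blast
  then show "\<exists>n. P (w(i := n))" by blast
qed

lemma rep_ex: "rep P \<Longrightarrow> rep (\<lambda>w. \<exists>n. P (w(i := n)))"
  unfolding rep_def using represents_ex by blast

text \<open>By \<open>good_pow(3)\<close> everything below a numeral is a numeral, so nonstandard
  elements do not enter the bounded quantifier.\<close>

lemma rep_ball:
  assumes "rep P" "i \<noteq> j"
  shows "rep (\<lambda>w. \<forall>n < w j. P (w(i := n)))"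
proof -
  obtain \<phi> where \<phi>: "represents \<phi> P" using assms rep_def by blast
  let ?F = "F_all (20 + i) (F_imp (F_less (Var (20 + i)) (Var (20 + j))) \<phi>)"
  show ?thesis
  proof (rule repI[of _ ?F])
    fix p :: "nat \<Rightarrow> 'a" and w
    assume p: "range p \<subseteq> carrier G" "p 0 \<in> carrier G" "p 1 \<in> carrier G" "good (p 0) (p 1) (p 2)"
      and P: "\<forall>n < w j. P (w(i := n))"
    have "sat G ((env p w)(20 + i := a)) \<phi>"
      if a: "a \<in> carrier G" "less (p 0) (p 1) (p 2) a (comm (p 0) (p 1) [^] int (w j))" for a
    proof -
      obtain n where n: "n < w j" "a = comm (p 0) (p 1) [^] int n"
        using good_pow(3)[OF p(2-4) a] by blast
      then show ?thesis using P \<phi> p unfolding n(2) env_upd by (simp add: represents_def)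
    qed
    then show "sat G (env p w) ?F" using assms(2) by simp
  next
    fix p :: "nat \<Rightarrow> 'a" and w
    assume p: "range p \<subseteq> carrier G" "p 0 = u" "p 1 = l" "p 2 = d" and F: "sat G (env p w) ?F"
    show "\<forall>n < w j. P (w(i := n))"
    proof (intro allI impI)
      fix n assume n: "n < w j"
      have "less u l d (v [^] int n) (v [^] int (w j))" unfolding less_iff using n by blast
      then have "sat G ((env p w)(20 + i := v [^] int n)) \<phi>"
        using F p assms(2) by (auto dest!: bspec[of _ _ "v [^] int n"])
      then have "sat G (env p (w(i := n))) \<phi>" using env_upd[of p w i n] p by simp
      then show "P (w(i := n))" using \<phi> p unfolding represents_def by blast
    qed
  qed
qed

text \<open>Quantifies a block of variables at once; composition uses one for each inner
  function.\<close>

lemma rep_ex_set: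
  assumes "finite A" "rep P"
  shows "rep (\<lambda>w. \<exists>w'. (\<forall>i. i \<notin> A \<longrightarrow> w' i = w i) \<and> P w')"
  using assms(1)
proof (induction A)
  case empty
  show ?case by (rule rep_cong[OF assms(2)]) (metis empty_iff ext)
next
  case (insert a A)
  show ?case
  proof (rule rep_cong[OF rep_ex[OF insert.IH, of a]], rule iffI)
    fix w assume "\<exists>n w'. (\<forall>i. i \<notin> A \<longrightarrow> w' i = (w(a := n)) i) \<and> P w'"
    then obtain n w' where "\<forall>i. i \<notin> A \<longrightarrow> w' i = (w(a := n)) i" "P w'" by blast
    then show "\<exists>w'. (\<forall>i. i \<notin> insert a A \<longrightarrow> w' i = w i) \<and> P w'"
      by (intro exI[of _ w']) simp
  next
    fix w assume "\<exists>w'. (\<forall>i. i \<notin> insert a A \<longrightarrow> w' i = w i) \<and> P w'"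
    then obtain w' where "\<forall>i. i \<notin> insert a A \<longrightarrow> w' i = w i" "P w'" by blast
    then show "\<exists>n w'. (\<forall>i. i \<notin> A \<longrightarrow> w' i = (w(a := n)) i) \<and> P w'"
      by (intro exI[of _ "w' a"] exI[of _ w']) simp
  qed
qed

lemma rep_all_less: "(\<And>i. i < (n::nat) \<Longrightarrow> rep (P i)) \<Longrightarrow> rep (\<lambda>w. \<forall>i<n. P i w)"
proof (induction n)
  case 0
  show ?case by (rule rep_cong[OF rep_const[of True]]) simp
next
  case (Suc n)
  show ?case
    by (rule rep_cong[OF rep_conj[OF Suc.IH[OF Suc.prems] Suc.prems[of n]]]) (auto simp: less_Suc_eq)
qed

text \<open>Variables from \<open>N\<close> on do not influence the value, so they are free to hold
  auxiliary values.\<close>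

definition rep_fun :: "nat \<Rightarrow> ((nat \<Rightarrow> nat) \<Rightarrow> nat) \<Rightarrow> bool" where
  "rep_fun N f \<longleftrightarrow> (\<forall>j. rep (\<lambda>w. w j = f w)) \<and> (\<forall>w w'. (\<forall>i<N. w i = w' i) \<longrightarrow> f w = f w')"

lemma rep_fun_eqI: "rep_fun N f \<Longrightarrow> (\<And>i. i < N \<Longrightarrow> w i = w' i) \<Longrightarrow> f w = f w'"
  by (simp add: rep_fun_def)

lemma rep_fun_mono:
  assumes "rep_fun N f" "N \<le> M"
  shows "rep_fun M f"
proof -
  have "f w = f w'" if "\<forall>i<M. w i = w' i" for w w'
    using that assms(2) by (intro rep_fun_eqI[OF assms(1)]) simp
  then show ?thesis using assms(1) by (simp add: rep_fun_def)
qed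

lemma rep_fun_upd: "rep_fun N f \<Longrightarrow> N \<le> i \<Longrightarrow> f (w(i := x)) = f w"
  by (erule rep_fun_eqI) simp

lemma rep_fun_var: "i < N \<Longrightarrow> rep_fun N (\<lambda>w. w i)"
  by (simp add: rep_fun_def rep_eq_var)

lemma rep_fun_binary:
  assumes "rep_fun N f" "rep_fun N g" and op: "\<And>i j k. rep (\<lambda>w. w k = h (w i) (w j))"
  shows "rep_fun N (\<lambda>w. h (f w) (g w))"
  unfolding rep_fun_def
proof (intro conjI allI impI)
  fix j
  \<comment> \<open>Fresh variables for the values of \<open>f\<close> and \<open>g\<close>,
    different from the result variable \<open>j\<close>.\<close>
  define x y where "x = N + j + 1" and "y = N + j + 2"
  have xy: "x \<noteq> y" "j \<noteq> x" "j \<noteq> y" "N \<le> x" "N \<le> y" by (auto simp: x_def y_def)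
  have "rep (\<lambda>w. w x = f w \<and> w y = g w \<and> w j = h (w x) (w y))"
    using assms(1,2) by (intro rep_conj op) (auto simp: rep_fun_def)
  from rep_ex[OF rep_ex[OF this, of y], of x]
  show "rep (\<lambda>w. w j = h (f w) (g w))"
    by (rule rep_cong) (use xy in \<open>simp add: rep_fun_upd[OF assms(1)] rep_fun_upd[OF assms(2)]\<close>)
next
  fix w w' :: "nat \<Rightarrow> nat" assume w: "\<forall>i<N. w i = w' i"
  have "f w = f w'" "g w = g w'"
    by (rule rep_fun_eqI[OF assms(1)], use w in simp) (rule rep_fun_eqI[OF assms(2)], use w in simp)
  then show "h (f w) (g w) = h (f w') (g w')" by simp
qed

lemma rep_fun_add: "rep_fun N f \<Longrightarrow> rep_fun N g \<Longrightarrow> rep_fun N (\<lambda>w. f w + g w)"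
  using rep_fun_binary[of N f g "(+)"] rep_eq_add by blast

lemma rep_fun_mult: "rep_fun N f \<Longrightarrow> rep_fun N g \<Longrightarrow> rep_fun N (\<lambda>w. f w * g w)"
  using rep_fun_binary[of N f g "(*)"] rep_eq_mult by blast

lemma rep_fun_Suc: "rep_fun N f \<Longrightarrow> rep_fun N (\<lambda>w. Suc (f w))"
  using rep_fun_binary[of N f f "\<lambda>a b. Suc a"] rep_eq_Suc by simp

lemma rep_fun_const: "rep_fun N (\<lambda>w. c)"
proof (induction c)
  case 0
  show ?case by (simp add: rep_fun_def rep_eq_0)
qed (rule rep_fun_Suc)

lemma rep_eq_fun:
  assumes "rep_fun N f" "rep_fun N g"
  shows "rep (\<lambda>w. f w = g w)"
proof -
  have "rep (\<lambda>w. w N = f w \<and> w N = g w)"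
    using assms by (intro rep_conj) (auto simp: rep_fun_def)
  from rep_ex[OF this, of N] show ?thesis
    by (rule rep_cong) (simp add: rep_fun_upd[OF assms(1)] rep_fun_upd[OF assms(2)])
qed

lemmas rep_fun_intros = rep_fun_var rep_fun_add rep_fun_mult rep_fun_Suc rep_fun_const

lemma rep_fun_prod_encode:
  assumes "rep_fun N f" "rep_fun N g"
  shows "rep_fun N (\<lambda>w. prod_encode (f w, g w))"
proof -
  have "rep (\<lambda>w. w k = prod_encode (w i, w j))" for i j k
  proof -
    let ?M = "i + j + k + 1"
    \<comment> \<open>The Cantor pairing is a triangular number plus the first component; doubling
      it removes the division by 2.\<close>
    have "rep (\<lambda>w. w k + w k = (w i + w j) * Suc (w i + w j) + (w i + w i))"
      by (rule rep_eq_fun[of ?M]) (intro rep_fun_intros; simp)+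
    then show ?thesis
    proof (rule rep_cong)
      fix w :: "nat \<Rightarrow> nat"
      have "even ((w i + w j) * Suc (w i + w j))" by simp
      then have "(w i + w j) * Suc (w i + w j) = 2 * ((w i + w j) * Suc (w i + w j) div 2)" by simp
      then show "w k + w k = (w i + w j) * Suc (w i + w j) + (w i + w i) \<longleftrightarrow> w k = prod_encode (w i, w j)"
        unfolding prod_encode_def triangle_def prod.case by linarith
    qed
  qed
  then show ?thesis using rep_fun_binary[OF assms, of "\<lambda>a b. prod_encode (a, b)"] by blast
qed

lemma rep_beta:
  assumes "rep_fun N f\<^sub>1" "rep_fun N f\<^sub>2" "rep_fun N f\<^sub>3" "rep_fun N f\<^sub>4"
  shows "rep (\<lambda>w. beta (f\<^sub>1 w) (f\<^sub>2 w) (f\<^sub>3 w) (f\<^sub>4 w))"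
proof -
  have f: "rep_fun (N + 2) f\<^sub>1" "rep_fun (N + 2) f\<^sub>2" "rep_fun (N + 2) f\<^sub>3" "rep_fun (N + 2) f\<^sub>4"
    using assms by (auto intro: rep_fun_mono)
  have x: "rep_fun (N + 2) (\<lambda>w. w N)" and y: "rep_fun (N + 2) (\<lambda>w. w (N + 1))"
    by (simp_all add: rep_fun_var)
  have "rep (\<lambda>w. f\<^sub>1 w = w N * (f\<^sub>4 w + w (N + 1) + 1) + f\<^sub>4 w \<and> f\<^sub>4 w + w (N + 1) = Suc (f\<^sub>3 w) * f\<^sub>2 w)"
    by (intro rep_conj rep_eq_fun[OF f(1) rep_fun_add[OF rep_fun_mult[OF x rep_fun_add[OF
      rep_fun_add[OF f(4) y] rep_fun_const[of _ 1]]] f(4)]]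
      rep_eq_fun[OF rep_fun_add[OF f(4) y] rep_fun_mult[OF rep_fun_Suc[OF f(3)] f(2)]])
  from rep_ex[OF rep_ex[OF this, of "N + 1"], of N] show ?thesis
    by (rule rep_cong)
      (simp add: beta_def rep_fun_upd[OF assms(1)] rep_fun_upd[OF assms(2)] rep_fun_upd[OF assms(3)]
        rep_fun_upd[OF assms(4)] del: mult_Suc mult_Suc_right add_Suc add_Suc_right)
qed

end

section \<open>Unfolding the computation relation\<close>

lemma computes_Zero_iff: "computes Zero xs y \<longleftrightarrow> y = 0"
  by (auto intro: computes.intros elim: computes_ZeroE)

lemma computes_Succ_iff: "computes Succ xs y \<longleftrightarrow> (\<exists>x. xs = [x] \<and> y = Suc x)"
  by (auto intro: computes.intros elim: computes_SuccE)

lemma computes_Proj_iff: "computes (Proj i) xs y \<longleftrightarrow> i < length xs \<and> y = xs ! i"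
  by (auto intro: computes.intros elim: computes_ProjE)

lemma computes_Comp_iff:
  "computes (Comp f gs) xs z \<longleftrightarrow> (\<exists>ys. list_all2 (\<lambda>g y. computes g xs y) gs ys \<and> computes f ys z)"
  by (auto elim: computes_CompE intro: computes.intros(4))

lemma computes_Mu_iff:
  "computes (Mu f) xs m \<longleftrightarrow> computes f (m # xs) 0 \<and> (\<forall>k<m. \<exists>y. computes f (k # xs) (Suc y))"
proof
  assume "computes (Mu f) xs m"
  then show "computes f (m # xs) 0 \<and> (\<forall>k<m. \<exists>y. computes f (k # xs) (Suc y))"
    by (rule computes_MuE) blast
qed (simp add: computes.intros(7))

text \<open>Primitive recursion through the sequence \<open>h\<close> of intermediate values, for
  arbitrary relations, so that it also covers \<open>pow_code\<close>.\<close>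

definition prim_rec :: "(nat list \<Rightarrow> nat \<Rightarrow> bool) \<Rightarrow> (nat list \<Rightarrow> nat \<Rightarrow> bool) \<Rightarrow> nat list \<Rightarrow> nat \<Rightarrow> bool" where
  "prim_rec F H xs y \<longleftrightarrow> (case xs of [] \<Rightarrow> False | m # xs \<Rightarrow>
     (\<exists>h. F xs (h 0) \<and> (\<forall>k<m. H (k # h k # xs) (h (Suc k))) \<and> h m = y))"

lemma computes_PrimRec_iff: "computes (PrimRec f g) xs y \<longleftrightarrow> prim_rec (computes f) (computes g) xs y"
proof (cases xs)
  case Nil
  have "\<not> computes (PrimRec f g) [] y"
    by (rule notI, erule computes.cases) auto
  then show ?thesis by (simp add: Nil prim_rec_def)
next
  case (Cons m xs')
  have "computes (PrimRec f g) (m # xs') y \<Longrightarrow>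
      \<exists>h. computes f xs' (h 0) \<and> (\<forall>k<m. computes g (k # h k # xs') (h (Suc k))) \<and> h m = y"
  proof (induction m arbitrary: y)
    case 0
    then have "computes f xs' y" by (rule computes_PrimRec_0E)
    then show ?case by (intro exI[of _ "\<lambda>_. y"]) simp
  next
    case (Suc m)
    from Suc.prems obtain z where z: "computes (PrimRec f g) (m # xs') z" "computes g (m # z # xs') y"
      by (rule computes_PrimRec_SucE)
    then obtain h where "computes f xs' (h 0)" "\<forall>k<m. computes g (k # h k # xs') (h (Suc k))" "h m = z"
      using Suc.IH by blast
    then show ?case using z(2) by (intro exI[of _ "h(Suc m := y)"]) (auto simp: less_Suc_eq)
  qed
  moreover have "computes (PrimRec f g) (m # xs') (h m)"
    if "computes f xs' (h 0)" "\<forall>k<m. computes g (k # h k # xs') (h (Suc k))" for h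
    using that
  proof (induction m)
    case (Suc m)
    then have "computes (PrimRec f g) (m # xs') (h m)" "computes g (m # h m # xs') (h (Suc m))" by simp_all
    then show ?case by (rule computes.intros(6))
  qed (simp add: computes.intros(5))
  ultimately show ?thesis by (auto simp: Cons prim_rec_def)
qed

lemma ex_fresh: "\<exists>N. \<forall>i\<in>set is. i < (N::nat)"
  by (rule exI[of _ "Suc (Max (set is))"]) (auto simp: less_Suc_eq_le)

section \<open>Representability of the graphs of partial recursive functions\<close>

context malcev
begin

text \<open>The arguments may be any variables, in any order and with repetitions, so variables can
  be substituted freely.\<close>

definition rep_rel :: "(nat list \<Rightarrow> nat \<Rightarrow> bool) \<Rightarrow> bool" where
  "rep_rel R \<longleftrightarrow> (\<forall>is j. rep (\<lambda>w. R (map w is) (w j)))"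

lemma rep_relD: "rep_rel R \<Longrightarrow> rep (\<lambda>w. R (map w is) (w j))"
  by (simp add: rep_rel_def)

text \<open>The sequence of intermediate values is coded by two numbers through \<open>beta\<close>,
  and the recursion step becomes a bounded universal quantifier.\<close>

lemma rep_rel_prim_rec:
  assumes F: "rep_rel F" and H: "rep_rel H"
  shows "rep_rel (prim_rec F H)"
  unfolding rep_rel_def
proof (intro allI)
  fix "is" :: "nat list" and y :: nat
  show "rep (\<lambda>w. prim_rec F H (map w is) (w y))"
  proof (cases "is")
    case Nil
    then show ?thesis by (simp add: prim_rec_def rep_const)
  next
    case (Cons m js)
    obtain N where "\<forall>i\<in>set (y # m # js). i < N" using ex_fresh by blast
    then have N: "y < N" "m < N" and fresh: "N \<le> i \<Longrightarrow> i \<notin> set js" for i by (auto dest: leD)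
    let ?M = "N + 5"
    have var: "i < ?M \<Longrightarrow> rep_fun ?M (\<lambda>w. w i)" for i by (rule rep_fun_var)
    \<comment> \<open>Fresh variables: \<open>?c\<close> and \<open>?d\<close> hold the code of the
      sequence, \<open>?k\<close> the stage, \<open>?a\<close> and \<open>?b\<close> two consecutive
      values.\<close>
    let ?c = N and ?d = "N + 1" and ?k = "N + 2" and ?a = "N + 3" and ?b = "N + 4"
    have "rep (\<lambda>w. beta (w ?c) (w ?d) 0 (w ?a) \<and> F (map w js) (w ?a))"
      by (intro rep_conj rep_relD F rep_beta[of ?M] var rep_fun_const) simp_all
    from rep_ex[OF this, of ?a]
    have 1: "rep (\<lambda>w. \<exists>a. beta (w ?c) (w ?d) 0 a \<and> F (map w js) a)"
      by (rule rep_cong) (simp add: fresh)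
    have "rep (\<lambda>w. beta (w ?c) (w ?d) (w ?k) (w ?a) \<and> beta (w ?c) (w ?d) (Suc (w ?k)) (w ?b) \<and>
        H (map w (?k # ?a # js)) (w ?b))"
      by (intro rep_conj rep_relD H rep_beta[of ?M] var rep_fun_Suc) simp_all
    from rep_ex[OF rep_ex[OF this, of ?b], of ?a]
    have "rep (\<lambda>w. \<exists>a b. beta (w ?c) (w ?d) (w ?k) a \<and> beta (w ?c) (w ?d) (Suc (w ?k)) b \<and>
        H (w ?k # a # map w js) b)"
      by (rule rep_cong) (simp add: fresh)
    from rep_ball[OF this, of ?k m]
    have 2: "rep (\<lambda>w. \<forall>k<w m. \<exists>a b. beta (w ?c) (w ?d) k a \<and> beta (w ?c) (w ?d) (Suc k) b \<and>
        H (k # a # map w js) b)"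
      by (rule rep_cong) (use N in \<open>auto simp: fresh\<close>)
    have 3: "rep (\<lambda>w. beta (w ?c) (w ?d) (w m) (w y))"
      by (intro rep_beta[of ?M] var) (use N in simp_all)
    from rep_ex[OF rep_ex[OF rep_conj[OF 1 rep_conj[OF 2 3]], of ?d], of ?c]
    have "rep (\<lambda>w. \<exists>c d. (\<exists>a. beta c d 0 a \<and> F (map w js) a) \<and>
        (\<forall>k<w m. \<exists>a b. beta c d k a \<and> beta c d (Suc k) b \<and> H (k # a # map w js) b) \<and>
        beta c d (w m) (w y))"
      by (rule rep_cong) (use N in \<open>simp add: fresh\<close>)
    then show ?thesis
    proof (rule rep_cong, intro iffI)
      fix w assume "\<exists>c d. (\<exists>a. beta c d 0 a \<and> F (map w js) a) \<and>
        (\<forall>k<w m. \<exists>a b. beta c d k a \<and> beta c d (Suc k) b \<and> H (k # a # map w js) b) \<and>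
        beta c d (w m) (w y)"
      then obtain c d where cd: "\<exists>a. beta c d 0 a \<and> F (map w js) a"
        "\<forall>k<w m. \<exists>a b. beta c d k a \<and> beta c d (Suc k) b \<and> H (k # a # map w js) b"
        "beta c d (w m) (w y)" by blast
      \<comment> \<open>Any pair \<open>c\<close>, \<open>d\<close> codes some sequence, which is
        read off by remainders.\<close>
      define h where "h i = c mod (Suc (Suc i * d))" for i
      have "beta c d i a \<longleftrightarrow> a = h i" for i a by (simp only: beta_iff h_def)
      with cd have "F (map w js) (h 0) \<and> (\<forall>k<w m. H (k # h k # map w js) (h (Suc k))) \<and> h (w m) = w y"
        by simp
      then show "prim_rec F H (map w is) (w y)" unfolding Cons prim_rec_def by auto
    next
      fix w assume "prim_rec F H (map w is) (w y)"
      then obtain h where h: "F (map w js) (h 0)" "\<forall>k<w m. H (k # h k # map w js) (h (Suc k))" "h (w m) = w y"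
        unfolding Cons prim_rec_def by auto
      obtain c d where "\<forall>i\<le>w m. \<forall>a. beta c d i a \<longleftrightarrow> a = h i" using beta_exists by blast
      then have "\<And>i a. i \<le> w m \<Longrightarrow> beta c d i a \<longleftrightarrow> a = h i" by blast
      with h have "(\<exists>a. beta c d 0 a \<and> F (map w js) a) \<and>
        (\<forall>k<w m. \<exists>a b. beta c d k a \<and> beta c d (Suc k) b \<and> H (k # a # map w js) b) \<and>
        beta c d (w m) (w y)" by simp
      then show "\<exists>c d. (\<exists>a. beta c d 0 a \<and> F (map w js) a) \<and>
        (\<forall>k<w m. \<exists>a b. beta c d k a \<and> beta c d (Suc k) b \<and> H (k # a # map w js) b) \<and>
        beta c d (w m) (w y)" by blast
    qed
  qed
qed

text \<open>Induction on the program: every partial recursive graph is \<Sigma>1, and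
  \<open>rep\<close> is closed under the operations that build it.\<close>

lemma rep_rel_computes: "rep_rel (computes f)"
proof (induction f)
  case Zero
  show ?case by (simp add: rep_rel_def computes_Zero_iff rep_eq_0)
next
  case Succ
  show ?case unfolding rep_rel_def
  proof (intro allI)
    fix "is" :: "nat list" and j :: nat
    show "rep (\<lambda>w. computes Succ (map w is) (w j))"
    proof (cases "\<exists>i. is = [i]")
      case True
      then show ?thesis by (auto simp: computes_Succ_iff rep_eq_Suc)
    next
      case False
      then have "\<not> computes Succ (map w is) (w j)" for w by (auto simp: computes_Succ_iff)
      then show ?thesis by (simp add: rep_const)
    qed
  qed
next
  case (Proj i)
  show ?case unfolding rep_rel_def
  proof (intro allI)
    fix "is" :: "nat list" and j :: nat
    show "rep (\<lambda>w. computes (Proj i) (map w is) (w j))"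
      by (cases "i < length is") (simp_all add: computes_Proj_iff rep_const rep_eq_var)
  qed
next
  case (Comp f gs)
  show ?case unfolding rep_rel_def
  proof (intro allI)
    fix "is" :: "nat list" and j :: nat
    obtain N where "\<forall>i\<in>set (j # is). i < N" using ex_fresh by blast
    then have N: "j < N" "\<And>i. i \<in> set is \<Longrightarrow> i < N" by auto
    let ?n = "length gs"
    \<comment> \<open>The values of the inner functions sit in fresh variables from \<open>N\<close>
      on, later bound by \<open>rep_ex_set\<close>.\<close>
    let ?ks = "[N..<N + ?n]"
    have "rep (\<lambda>w. (\<forall>i<?n. computes (gs ! i) (map w is) (w (N + i))) \<and> computes f (map w ?ks) (w j))"
      by (intro rep_conj rep_all_less rep_relD Comp.IH) simp_all
    from rep_ex_set[OF _ this, of "{N..<N + ?n}"]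
    show "rep (\<lambda>w. computes (Comp f gs) (map w is) (w j))"
    proof (rule rep_cong[OF _ iffI])
      fix w assume "\<exists>w'. (\<forall>i. i \<notin> {N..<N + ?n} \<longrightarrow> w' i = w i) \<and>
        (\<forall>i<?n. computes (gs ! i) (map w' is) (w' (N + i))) \<and> computes f (map w' ?ks) (w' j)"
      then obtain w' where w': "\<And>i. i \<notin> {N..<N + ?n} \<Longrightarrow> w' i = w i"
        "\<And>i. i < ?n \<Longrightarrow> computes (gs ! i) (map w' is) (w' (N + i))" "computes f (map w' ?ks) (w' j)"
        by blast
      have "w' i = w i" if "i < N" for i using w'(1) that by simp
      then have eq: "map w' is = map w is" "w' j = w j" using N by simp_all
      have "list_all2 (\<lambda>g y. computes g (map w is) y) gs (map w' ?ks)"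
        using w'(2) unfolding eq(1) by (simp add: list_all2_conv_all_nth)
      moreover have "computes f (map w' ?ks) (w j)" using w'(3) unfolding eq(2) .
      ultimately show "computes (Comp f gs) (map w is) (w j)" unfolding computes_Comp_iff by blast
    next
      fix w assume "computes (Comp f gs) (map w is) (w j)"
      then obtain ys where ys: "list_all2 (\<lambda>g y. computes g (map w is) y) gs ys" "computes f ys (w j)"
        unfolding computes_Comp_iff by blast
      then have len: "length ys = ?n" by (simp add: list_all2_lengthD)
      define w' where "w' i = (if i \<in> {N..<N + ?n} then ys ! (i - N) else w i)" for i
      have ks: "map w' ?ks = ys" using len by (intro nth_equalityI) (simp_all add: w'_def)
      have "w' i = w i" if "i < N" for i using that by (simp add: w'_def)
      then have eq: "map w' is = map w is" "w' j = w j" using N by simp_all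
      have "w' (N + i) = ys ! i" if "i < ?n" for i using that by (simp add: w'_def)
      then have "\<forall>i<?n. computes (gs ! i) (map w' is) (w' (N + i))"
        unfolding eq(1) using ys(1) by (simp add: list_all2_conv_all_nth)
      moreover have "\<forall>i. i \<notin> {N..<N + ?n} \<longrightarrow> w' i = w i" by (simp add: w'_def)
      ultimately have "(\<forall>i. i \<notin> {N..<N + ?n} \<longrightarrow> w' i = w i) \<and>
        (\<forall>i<?n. computes (gs ! i) (map w' is) (w' (N + i))) \<and> computes f (map w' ?ks) (w' j)"
        unfolding ks eq(2) using ys(2) by blast
      then show "\<exists>w'. (\<forall>i. i \<notin> {N..<N + ?n} \<longrightarrow> w' i = w i) \<and>
        (\<forall>i<?n. computes (gs ! i) (map w' is) (w' (N + i))) \<and> computes f (map w' ?ks) (w' j)"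
        by blast
    qed simp
  qed
next
  case (PrimRec f g)
  have "computes (PrimRec f g) = prim_rec (computes f) (computes g)"
    by (intro ext) (rule computes_PrimRec_iff)
  then show ?case using rep_rel_prim_rec PrimRec.IH by simp
next
  case (Mu f)
  show ?case unfolding rep_rel_def
  proof (intro allI)
    fix "is" :: "nat list" and j :: nat
    obtain N where "\<forall>i\<in>set (j # is). i < N" using ex_fresh by blast
    then have N: "j < N" and fresh: "N \<le> i \<Longrightarrow> i \<notin> set is" for i by (auto dest: leD)
    \<comment> \<open>\<open>rep_rel\<close> takes only variables as values, so the value 0 is held
      in variable \<open>N\<close>, and the value \<open>Suc y\<close> below in variable
      \<open>N + 2\<close>.\<close>
    have "rep (\<lambda>w. w N = 0 \<and> computes f (map w (j # is)) (w N))"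
      by (intro rep_conj rep_relD Mu.IH rep_eq_0)
    from rep_ex[OF this, of N]
    have 1: "rep (\<lambda>w. computes f (w j # map w is) 0)"
      by (rule rep_cong) (use N in \<open>simp add: fresh\<close>)
    have "rep (\<lambda>w. w (N + 2) = Suc (w (N + 1)) \<and> computes f (map w (N # is)) (w (N + 2)))"
      by (intro rep_conj rep_relD Mu.IH rep_eq_Suc)
    from rep_ex[OF rep_ex[OF this, of "N + 2"], of "N + 1"]
    have "rep (\<lambda>w. \<exists>y. computes f (w N # map w is) (Suc y))"
      by (rule rep_cong) (use N in \<open>simp add: fresh\<close>)
    from rep_ball[OF this, of N j]
    have 2: "rep (\<lambda>w. \<forall>k<w j. \<exists>y. computes f (k # map w is) (Suc y))"
      by (rule rep_cong) (use N in \<open>auto simp: fresh\<close>)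
    show "rep (\<lambda>w. computes (Mu f) (map w is) (w j))"
      unfolding computes_Mu_iff by (rule rep_conj[OF 1 2])
  qed
qed

end

section \<open>The diagonal sentence\<close>

text \<open>The numeral of \<open>n\<close>, as a term in the parameters.\<close>

primrec pow_term :: "nat \<Rightarrow> gterm" where
  "pow_term 0 = One"
| "pow_term (Suc n) = Mult (pow_term n) T_unit"

lemma tm_vars_pow_term: "tm_vars (pow_term n) \<subseteq> {0, 1}"
  by (induction n) auto

text \<open>The numeral enters through an equation for variable 20 instead of by substitution, so
  the code of the sentence is computed from the codes of \<open>\<phi>\<close> and of the numeral
  alone. Quantifying over good triples removes the parameters.\<close>

definition diag_sentence :: "gformula \<Rightarrow> nat \<Rightarrow> gformula" where
  "diag_sentence \<phi> n = F_all 0 (F_all 1 (F_all 2 (F_imp F_good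
     (Exists 20 (Conj (Eq (Var 20) (pow_term n)) \<phi>)))))"

definition all_code :: "nat \<Rightarrow> nat \<Rightarrow> nat" where
  "all_code x c = prod_encode (1, prod_encode (3, prod_encode (x, prod_encode (1, c))))"

definition diag_code :: "nat \<Rightarrow> nat \<Rightarrow> nat" where
  "diag_code t c = all_code 0 (all_code 1 (all_code 2 (prod_encode (1, prod_encode (2, prod_encode
     (fm_code F_good, prod_encode (1, prod_encode (3, prod_encode (20, prod_encode (2, prod_encode
       (prod_encode (0, prod_encode (prod_encode (0, 20), t)), c)))))))))))"

lemma fm_code_diag_sentence:
  "fm_code (diag_sentence \<phi> n) = diag_code (tm_code (pow_term n)) (fm_code \<phi>)"
  by (simp add: diag_sentence_def diag_code_def all_code_def F_all_def F_imp_def)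

lemma is_sentence_diag:
  assumes "free_vars \<phi> \<subseteq> {0, 1, 2, 20}"
  shows "is_sentence (diag_sentence \<phi> n)"
proof -
  have "free_vars (Exists 20 (Conj (Eq (Var 20) (pow_term n)) \<phi>)) \<subseteq> {0, 1, 2}"
    using assms tm_vars_pow_term[of n] by auto
  then show ?thesis using free_vars_good by (auto simp: is_sentence_def diag_sentence_def)
qed

lemma (in group) tm_val_pow_term:
  assumes "w 0 \<in> carrier G" "w 1 \<in> carrier G"
  shows "tm_val G w (pow_term n) = comm (w 0) (w 1) [^] int n"
proof (induction n)
  case (Suc n)
  then show ?case
    using int_pow_mult[of "comm (w 0) (w 1)" "int n" 1] assms by (simp add: add.commute)
qed simp

lemma finite_free_vars: "finite (free_vars \<phi>)"
proof -
  have "finite (tm_vars t)" for t by (induction t) auto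
  then show ?thesis by (induction \<phi>) auto
qed

context malcev
begin

lemma rep_fun_diag_code:
  assumes "rep_fun N f" "rep_fun N g"
  shows "rep_fun N (\<lambda>w. diag_code (f w) (g w))"
  unfolding diag_code_def all_code_def by (intro rep_fun_prod_encode assms rep_fun_const)

text \<open>Stated through \<open>prim_rec\<close> to inherit representability. In the step the list
  begins with the stage and the previous value, so \<open>xs ! 1\<close> is the code of the previous
  numeral.\<close>

definition pow_code :: "nat list \<Rightarrow> nat \<Rightarrow> bool" where
  "pow_code = prim_rec (\<lambda>xs y. y = tm_code One)
     (\<lambda>xs y. length xs \<ge> 2 \<and> y = prod_encode (2, prod_encode (xs ! 1, tm_code T_unit)))"

lemma pow_code_iff: "pow_code [n] y \<longleftrightarrow> y = tm_code (pow_term n)"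
proof
  assume "pow_code [n] y"
  then obtain h where h: "h 0 = tm_code One" "h n = y"
    "\<And>k. k < n \<Longrightarrow> h (Suc k) = prod_encode (2, prod_encode (h k, tm_code T_unit))"
    by (auto simp: pow_code_def prim_rec_def)
  have "h k = tm_code (pow_term k)" if "k \<le> n" for k
    using that by (induction k) (simp_all add: h)
  then show "y = tm_code (pow_term n)" using h(2) by auto
next
  assume "y = tm_code (pow_term n)"
  then show "pow_code [n] y"
    by (auto simp: pow_code_def prim_rec_def intro!: exI[of _ "\<lambda>k. tm_code (pow_term k)"])
qed

lemma rep_rel_pow_code: "rep_rel pow_code"
  unfolding pow_code_def
proof (rule rep_rel_prim_rec)
  have *: "rep (\<lambda>w. w j = f w)" if "rep_fun N f" for j N f
    using that by (simp add: rep_fun_def)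
  show "rep_rel (\<lambda>xs y. y = tm_code One)"
    unfolding rep_rel_def by (intro allI *[of 0] rep_fun_const)
  show "rep_rel (\<lambda>xs y. length xs \<ge> 2 \<and> y = prod_encode (2, prod_encode (xs ! 1, tm_code T_unit)))"
    unfolding rep_rel_def
  proof (intro allI)
    fix "is" :: "nat list" and j :: nat
    have "rep (\<lambda>w. w j = prod_encode (2, prod_encode (w (is ! 1), tm_code T_unit)))"
      by (intro *[of "Suc (is ! 1)"] rep_fun_prod_encode rep_fun_const rep_fun_var) simp
    then show "rep (\<lambda>w. length (map w is) \<ge> 2 \<and>
        w j = prod_encode (2, prod_encode (map w is ! 1, tm_code T_unit)))"
      by (cases "length is \<ge> 2") (simp_all add: rep_const)
  qed
qed

text \<open>Removes stray free variables so that the diagonal sentence is closed. A reserved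
  variable is bound by a plain quantifier, a number variable by one relativised to
  \<open>natural\<close>; the latter is harmless since \<open>P\<close> depends only on
  \<open>w 0\<close>.\<close>

lemma rep_closed:
  assumes "rep P" and P: "\<And>w w'. w 0 = w' 0 \<Longrightarrow> P w = P w'"
  obtains \<phi> where "represents \<phi> P" "free_vars \<phi> \<subseteq> {0, 1, 2, 20}"
proof -
  obtain \<psi> where \<psi>: "represents \<psi> P" using assms(1) rep_def by blast
  \<comment> \<open>\<open>B\<close> collects the variables already bound, so that they can be
    treated one by one.\<close>
  have "\<exists>\<phi>. represents \<phi> P \<and> free_vars \<phi> \<subseteq> {0, 1, 2, 20} \<union> (free_vars \<psi> - B)"
    if "finite B" "B \<inter> {0, 1, 2, 20} = {}" for B
    using that
  proof (induction B)
    case empty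
    then show ?case using \<psi> by auto
  next
    case (insert b B)
    then obtain \<phi> where \<phi>: "represents \<phi> P" "free_vars \<phi> \<subseteq> {0, 1, 2, 20} \<union> (free_vars \<psi> - B)" by auto
    have b: "b \<noteq> 0" "b \<noteq> 1" "b \<noteq> 2" "b \<noteq> 20" using insert.prems by auto
    show ?case
    proof (cases "b < 20")
      case True
      have upd: "(env p w)(b := a) = env (p(b := a)) w" for p w a
        using True b by (auto simp: env_def fun_eq_iff)
      have "represents (Exists b \<phi>) P"
        unfolding represents_def
      proof (intro conjI allI impI)
        fix p :: "nat \<Rightarrow> 'a" and w
        assume p: "range p \<subseteq> carrier G" "good (p 0) (p 1) (p 2)" "P w"
        then have "sat G (env p w) \<phi>" using \<phi>(1) by (simp add: represents_def)
        then show "sat G (env p w) (Exists b \<phi>)"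
          using env_closed[OF p(1), of w] by (auto intro!: bexI[of _ "env p w b"])
      next
        fix p :: "nat \<Rightarrow> 'a" and w
        assume p: "range p \<subseteq> carrier G" "p 0 = u" "p 1 = l" "p 2 = d" "sat G (env p w) (Exists b \<phi>)"
        then obtain a where a: "a \<in> carrier G" "sat G (env (p(b := a)) w) \<phi>" by (auto simp: upd)
        have "range (p(b := a)) \<subseteq> carrier G" using p(1) a(1) by auto
        moreover have "(p(b := a)) 0 = u" "(p(b := a)) 1 = l" "(p(b := a)) 2 = d" using p b by simp_all
        ultimately show "P w" using \<phi>(1) a(2) unfolding represents_def by blast
      qed
      moreover have "free_vars (Exists b \<phi>) \<subseteq> {0, 1, 2, 20} \<union> (free_vars \<psi> - insert b B)"
        using \<phi>(2) by auto
      ultimately show ?thesis by blast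
    next
      case False
      then obtain i where i: "b = 20 + i" using le_Suc_ex not_less by metis
      have "(\<exists>n. P (w(i := n))) \<longleftrightarrow> P w" for w
        using P[of "w(i := n)" w for n] b i by auto
      then have "represents (Exists b (Conj (F_natural (Var b)) \<phi>)) P"
        using represents_ex[OF \<phi>(1), of i] unfolding i by simp
      moreover have "free_vars (Exists b (Conj (F_natural (Var b)) \<phi>)) \<subseteq> {0, 1, 2, 20} \<union> (free_vars \<psi> - insert b B)"
        using \<phi>(2) free_vars_natural[of "Var b"] by auto
      ultimately show ?thesis by blast
    qed
  qed
  from this[of "free_vars \<psi> - {0, 1, 2, 20}"] obtain \<phi> where
    "represents \<phi> P" "free_vars \<phi> \<subseteq> {0, 1, 2, 20} \<union> (free_vars \<psi> - (free_vars \<psi> - {0, 1, 2, 20}))"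
    using finite_free_vars[of \<psi>] by auto
  then show thesis by (intro that[of \<phi>]) auto
qed

text \<open>Truth of the sentence is instantiated at \<open>u\<close>, \<open>l\<close>,
  \<open>d\<close>, where representation is faithful. Conversely \<open>P\<close> gives
  \<open>\<phi>\<close> at all good parameters.\<close>

lemma holds_diag_sentence:
  assumes \<phi>: "represents \<phi> P" "free_vars \<phi> \<subseteq> {0, 1, 2, 20}"
  shows "holds_in G (diag_sentence \<phi> n) \<longleftrightarrow> P (\<lambda>_. n)"
proof -
  have sat: "sat G w (diag_sentence \<phi> n) \<longleftrightarrow> (\<forall>a\<in>carrier G. \<forall>b\<in>carrier G. \<forall>c\<in>carrier G.
      good a b c \<longrightarrow> sat G (env (w(0 := a, 1 := b, 2 := c)) (\<lambda>_. n)) \<phi>)" for w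
  proof -
    have "sat G (w(0 := a, 1 := b, 2 := c)) (Exists 20 (Conj (Eq (Var 20) (pow_term n)) \<phi>)) \<longleftrightarrow>
        sat G (env (w(0 := a, 1 := b, 2 := c)) (\<lambda>_. n)) \<phi>"
      if "a \<in> carrier G" "b \<in> carrier G" "c \<in> carrier G" for a b c
    proof -
      let ?w = "w(0 := a, 1 := b, 2 := c)"
      have "tm_val G (?w(20 := x)) (pow_term n) = comm a b [^] int n" for x
        using that by (subst tm_val_pow_term) simp_all
      then have "sat G ?w (Exists 20 (Conj (Eq (Var 20) (pow_term n)) \<phi>)) \<longleftrightarrow>
          sat G (?w(20 := comm a b [^] int n)) \<phi>"
        using that by auto
      also have "\<dots> \<longleftrightarrow> sat G (env ?w (\<lambda>_. n)) \<phi>"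
      proof (rule sat_cong)
        fix x assume "x \<in> free_vars \<phi>"
        then have "x \<in> {0, 1, 2, 20}" using \<phi>(2) by blast
        then show "(?w(20 := comm a b [^] int n)) x = env ?w (\<lambda>_. n) x"
          by (auto simp: env_def)
      qed
      finally show ?thesis .
    qed
    then show ?thesis by (simp add: diag_sentence_def)
  qed
  show ?thesis
  proof
    assume "holds_in G (diag_sentence \<phi> n)"
    then have "sat G (\<lambda>_. \<one>) (diag_sentence \<phi> n)" by (simp add: holds_in_def image_subset_iff)
    moreover define p where "p = (\<lambda>_::nat. \<one>)(0 := u, 1 := l, 2 := d)"
    ultimately have "sat G (env p (\<lambda>_. n)) \<phi>"
      unfolding sat using good by simp
    moreover have "range p \<subseteq> carrier G" "p 0 = u" "p 1 = l" "p 2 = d" by (auto simp: p_def)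
    ultimately show "P (\<lambda>_. n)" using \<phi>(1) unfolding represents_def by blast
  next
    assume P: "P (\<lambda>_. n)"
    show "holds_in G (diag_sentence \<phi> n)"
      unfolding holds_in_def sat
    proof (intro allI impI ballI)
      fix w :: "nat \<Rightarrow> 'a" and a b c
      assume w: "range w \<subseteq> carrier G" "a \<in> carrier G" "b \<in> carrier G" "c \<in> carrier G" "good a b c"
      have "range (w(0 := a, 1 := b, 2 := c)) \<subseteq> carrier G" using w by auto
      then show "sat G (env (w(0 := a, 1 := b, 2 := c)) (\<lambda>_. n)) \<phi>"
        using \<phi>(1) w(5) P unfolding represents_def by simp
    qed
  qed
qed

text \<open>\<open>P\<close> says of \<open>n\<close> that the assumed procedure rejects the
  diagonal sentence formed from code \<open>n\<close>. If \<open>\<phi>\<close> represents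
  \<open>P\<close>, its diagonal sentence at its own code holds exactly when it is rejected.\<close>

theorem not_decidable: "\<not> decidable (fo_theory G)"
proof
  assume "decidable (fo_theory G)"
  then obtain f where f: "\<And>x. computes f [x] (if x \<in> fm_code ` fo_theory G then 1 else 0)"
    unfolding decidable_def recursive_set_def by blast
  define P where "P w \<longleftrightarrow> computes f [diag_code (tm_code (pow_term (w 0))) (w 0)] 0" for w :: "nat \<Rightarrow> nat"
  \<comment> \<open>Variables 1, 2, 3 hold the code of the numeral, the code of the diagonal
    sentence and the output 0.\<close>
  have "rep (\<lambda>w. pow_code (map w [0]) (w 1) \<and> w 2 = diag_code (w 1) (w 0) \<and> w 3 = 0 \<and> computes f (map w [2]) (w 3))"
    by (intro rep_conj rep_relD rep_rel_pow_code rep_rel_computes rep_eq_0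
      rep_eq_fun[of 3] rep_fun_diag_code rep_fun_var) simp_all
  from rep_ex[OF rep_ex[OF rep_ex[OF this, of 3], of 2], of 1]
  have "rep P"
    by (rule rep_cong) (simp add: pow_code_iff P_def)
  moreover have "P w = P w'" if "w 0 = w' 0" for w w' using that by (simp add: P_def)
  ultimately obtain \<phi> where \<phi>: "represents \<phi> P" "free_vars \<phi> \<subseteq> {0, 1, 2, 20}"
    using rep_closed by blast
  define S where "S = diag_sentence \<phi> (fm_code \<phi>)"
  have "S \<in> fo_theory G \<longleftrightarrow> P (\<lambda>_. fm_code \<phi>)"
    using holds_diag_sentence[OF \<phi>] is_sentence_diag[OF \<phi>(2)] by (simp add: fo_theory_def S_def)
  also have "\<dots> \<longleftrightarrow> computes f [fm_code S] 0"
    by (simp add: P_def S_def fm_code_diag_sentence)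
  also have "\<dots> \<longleftrightarrow> fm_code S \<notin> fm_code ` fo_theory G"
    using f[of "fm_code S"] computes_det[OF f[of "fm_code S"], of 0] by (auto split: if_splits)
  also have "\<dots> \<longleftrightarrow> S \<notin> fo_theory G"
    using inj_fm_code by blast
  finally show False by blast
qed

theorem unstable: "unstable (fo_theory G)"
proof -
  \<comment> \<open>Padding by \<one> puts the parameters at positions 0 to 2 and the number at
    position 20; in the second tuple of length 21 the number is at position 41.\<close>
  define a where "a i = [u, l, d] @ replicate 17 \<one> @ [v [^] int i]" for i
  have len: "length (a i) = 21" for i by (simp add: a_def)
  have nth: "a i ! 0 = u" "a i ! 1 = l" "a i ! 2 = d" "a i ! 20 = v [^] int i" for i
    by (simp_all add: a_def nth_append)
  have "orders G (F_less (Var 20) (Var 41)) 21 a"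
    unfolding orders_def
  proof (intro conjI allI)
    show "free_vars (F_less (Var 20) (Var 41)) \<subseteq> {..<2 * 21}"
      by (rule order_trans[OF free_vars_less]) auto
    fix i
    show "length (a i) = 21" by (rule len)
    show "set (a i) \<subseteq> carrier G" by (auto simp: a_def)
    fix j
    have "(a i @ a j) ! 41 = v [^] int j" using nth(4)[of j] by (simp add: nth_append len)
    moreover have "(a i @ a j) ! k = a i ! k" if "k < 21" for k using that by (simp add: nth_append len)
    ultimately have "sat G (\<lambda>k. (a i @ a j) ! k) (F_less (Var 20) (Var 41)) \<longleftrightarrow>
        less u l d (v [^] int i) (v [^] int j)"
      using nth[of i] by simp
    also have "\<dots> \<longleftrightarrow> i < j" unfolding less_iff v_pow_eq_iff by simp
    finally show "sat G (\<lambda>k. (a i @ a j) ! k) (F_less (Var 20) (Var 41)) = (i < j)" .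
  qed
  then show ?thesis
    by (rule unstableI[rotated 2]) (auto simp: is_model_def fo_theory_def)
qed

end

section \<open>Free groups and lower central series\<close>

text \<open>The homomorphism given by the universal property of the free group.\<close>

definition free_eval :: "('a, 'b) monoid_scheme \<Rightarrow> ('x \<Rightarrow> 'a) \<Rightarrow> ('x \<times> bool) list \<Rightarrow> 'a" where
  "free_eval G f w = foldr (\<lambda>l a. (if snd l then f (fst l) else inv\<^bsub>G\<^esub> f (fst l)) \<otimes>\<^bsub>G\<^esub> a) w \<one>\<^bsub>G\<^esub>"

context group
begin

lemma free_eval_Nil [simp]: "free_eval G f [] = \<one>"
  by (simp add: free_eval_def)

lemma free_eval_Cons [simp]:
  "free_eval G f (l # w) = (if snd l then f (fst l) else inv f (fst l)) \<otimes> free_eval G f w"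
  by (simp add: free_eval_def)

lemma free_eval_closed: "f \<in> X \<rightarrow> carrier G \<Longrightarrow> w \<in> lists (X \<times> UNIV) \<Longrightarrow> free_eval G f w \<in> carrier G"
  by (induction w) (auto simp: Pi_iff)

lemma free_eval_cons_red:
  assumes f: "f \<in> X \<rightarrow> carrier G" and l: "fst l \<in> X" and w: "w \<in> lists (X \<times> UNIV)"
  shows "free_eval G f (cons_red l w) = free_eval G f (l # w)"
proof (cases w)
  case (Cons m u)
  have "free_eval G f u \<in> carrier G" using w unfolding Cons by (intro free_eval_closed[OF f]) auto
  then show ?thesis using f l by (auto simp: Cons Pi_iff)
qed simp

lemma free_eval_foldr:
  assumes f: "f \<in> X \<rightarrow> carrier G" and w: "w \<in> lists (X \<times> UNIV)"
  shows "u \<in> lists (X \<times> UNIV) \<Longrightarrow>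
    free_eval G f (foldr cons_red u w) = free_eval G f u \<otimes> free_eval G f w"
proof (induction u)
  case (Cons l u)
  then have u: "u \<in> lists (X \<times> UNIV)" "fst l \<in> X" by auto
  have "free_eval G f u \<in> carrier G" "free_eval G f w \<in> carrier G"
    using f u w by (simp_all add: free_eval_closed)
  moreover have "f (fst l) \<in> carrier G" using f u(2) by auto
  moreover have "foldr cons_red u w \<in> lists (X \<times> UNIV)" using u(1) w by (rule foldr_cons_red_lists)
  then have "free_eval G f (foldr cons_red (l # u) w) = free_eval G f (l # foldr cons_red u w)"
    using free_eval_cons_red[OF f u(2)] by simp
  ultimately show ?case using Cons.IH[OF u(1)] by (simp add: m_assoc)
qed (use free_eval_closed[OF f w] in simp)

lemma free_eval_hom:
  assumes "f \<in> X \<rightarrow> carrier G"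
  shows "free_eval G f \<in> hom (free_group X) G"
proof (rule homI)
  fix u w assume "u \<in> carrier (free_group X)" "w \<in> carrier (free_group X)"
  then have "u \<in> lists (X \<times> UNIV)" "w \<in> lists (X \<times> UNIV)" by (simp_all add: free_group_def)
  then show "free_eval G f (u \<otimes>\<^bsub>free_group X\<^esub> w) = free_eval G f u \<otimes> free_eval G f w"
    "free_eval G f u \<in> carrier G"
    using free_eval_foldr[OF assms] free_eval_closed[OF assms] by (simp_all add: free_group_def)
qed

end

lemma free_group_hom_eqI:
  assumes "group H" "g \<in> hom (free_group X) H" "h \<in> hom (free_group X) H"
    and gen: "\<And>x. x \<in> X \<Longrightarrow> g [(x, True)] = h [(x, True)]"
    and w: "w \<in> carrier (free_group X)"
  shows "g w = h w"
proof -
  interpret F: group "free_group X" by (rule group_free_group)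
  interpret H: group H by fact
  interpret g: group_hom "free_group X" H g
    using assms by (simp add: group_hom_def group_hom_axioms_def)
  interpret h: group_hom "free_group X" H h
    using assms by (simp add: group_hom_def group_hom_axioms_def)
  have let_closed: "[(x, b)] \<in> carrier (free_group X)" if "x \<in> X" for x b
    using that by (simp add: free_group_def)
  have inv_let: "inv\<^bsub>free_group X\<^esub> [(x, True)] = [(x, False)]" if "x \<in> X" for x
    by (rule F.inv_equality) (use that let_closed in \<open>simp_all add: free_group_def\<close>)
  have let_eq: "g [(x, b)] = h [(x, b)]" if "x \<in> X" for x b
  proof (cases b)
    case False
    then show ?thesis using g.hom_inv[OF let_closed[OF that, of True]] h.hom_inv[OF let_closed[OF that, of True]]
      by (simp add: inv_let that gen)
  qed (simp add: that gen)
  show ?thesis using w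
  proof (induction w)
    case Nil
    show ?case using g.hom_one h.hom_one by (simp add: free_group_def)
  next
    case (Cons l w)
    then have w: "w \<in> carrier (free_group X)" and x: "fst l \<in> X"
      using reduced_Cons by (auto simp: free_group_def)
    have "cons_red l w = l # w" using Cons.prems by (simp add: cons_red_reduced free_group_def)
    then have lw: "l # w = [(fst l, snd l)] \<otimes>\<^bsub>free_group X\<^esub> w" by (simp add: free_group_def)
    show ?case
      unfolding lw using let_closed[OF x, of "snd l"] let_eq[OF x, of "snd l"] w Cons.IH[OF w] by simp
  qed
qed

section \<open>The lower central series under homomorphisms\<close>

lemma lower_central_subset: "group G \<Longrightarrow> lower_central G k \<subseteq> carrier G"
  using group.lower_central_normal[of G k] by (simp add: normal_def subgroup.subset)

lemma comm_in_lower_central: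
  assumes "group G" "h \<in> lower_central G (Suc k)" "g \<in> carrier G"
  shows "group.comm G h g \<in> lower_central G (Suc (Suc k))"
  using assms by (auto simp: group.comm_def intro: generate.incl)

lemma lower_central_hom:
  assumes "group G" "group H" "h \<in> hom G H"
  shows "h ` lower_central G (Suc k) \<subseteq> lower_central H (Suc k)"
proof -
  interpret h: group_hom G H h using assms by (simp add: group_hom_def group_hom_axioms_def)
  show ?thesis
  proof (induction k)
    case 0
    show ?case using h.hom_closed by auto
  next
    case (Suc k)
    let ?K = "{a \<otimes>\<^bsub>G\<^esub> g \<otimes>\<^bsub>G\<^esub> inv\<^bsub>G\<^esub> a \<otimes>\<^bsub>G\<^esub> inv\<^bsub>G\<^esub> g | a g. a \<in> lower_central G (Suc k) \<and> g \<in> carrier G}"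
    let ?L = "{a \<otimes>\<^bsub>H\<^esub> g \<otimes>\<^bsub>H\<^esub> inv\<^bsub>H\<^esub> a \<otimes>\<^bsub>H\<^esub> inv\<^bsub>H\<^esub> g | a g. a \<in> lower_central H (Suc k) \<and> g \<in> carrier H}"
    have sub: "lower_central G (Suc k) \<subseteq> carrier G" using assms(1) by (rule lower_central_subset)
    then have "?K \<subseteq> carrier G" by auto
    then have "h ` generate G ?K = generate H (h ` ?K)" by (rule h.generate_img[symmetric])
    also have "h ` ?K \<subseteq> ?L"
    proof
      fix y assume "y \<in> h ` ?K"
      then obtain a g where ag: "a \<in> lower_central G (Suc k)" "g \<in> carrier G"
        "y = h (a \<otimes>\<^bsub>G\<^esub> g \<otimes>\<^bsub>G\<^esub> inv\<^bsub>G\<^esub> a \<otimes>\<^bsub>G\<^esub> inv\<^bsub>G\<^esub> g)" by blast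
      then have "a \<in> carrier G" using sub by blast
      then have "y = h a \<otimes>\<^bsub>H\<^esub> h g \<otimes>\<^bsub>H\<^esub> inv\<^bsub>H\<^esub> h a \<otimes>\<^bsub>H\<^esub> inv\<^bsub>H\<^esub> h g" using ag by simp
      moreover have "h a \<in> lower_central H (Suc k)" "h g \<in> carrier H" using ag Suc.IH by auto
      ultimately show "y \<in> ?L" by blast
    qed
    then have "generate H (h ` ?K) \<subseteq> generate H ?L" by (rule h.H.mono_generate)
    finally show ?case by simp
  qed
qed

text \<open>Used to see that the term of index s + 1 of the series of \<open>N\<close> is trivial:
  commutators lift along a surjection.\<close>

lemma lower_central_surj_hom:
  assumes "group G" "group H" "h \<in> hom G H" "h ` carrier G = carrier H"
  shows "lower_central H (Suc k) \<subseteq> h ` lower_central G (Suc k)"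
proof -
  interpret h: group_hom G H h using assms by (simp add: group_hom_def group_hom_axioms_def)
  show ?thesis
  proof (induction k)
    case 0
    show ?case using assms(4) by simp
  next
    case (Suc k)
    let ?K = "{a \<otimes>\<^bsub>G\<^esub> g \<otimes>\<^bsub>G\<^esub> inv\<^bsub>G\<^esub> a \<otimes>\<^bsub>G\<^esub> inv\<^bsub>G\<^esub> g | a g. a \<in> lower_central G (Suc k) \<and> g \<in> carrier G}"
    let ?L = "{a \<otimes>\<^bsub>H\<^esub> g \<otimes>\<^bsub>H\<^esub> inv\<^bsub>H\<^esub> a \<otimes>\<^bsub>H\<^esub> inv\<^bsub>H\<^esub> g | a g. a \<in> lower_central H (Suc k) \<and> g \<in> carrier H}"
    have sub: "lower_central G (Suc k) \<subseteq> carrier G" using assms(1) by (rule lower_central_subset)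
    have "?L \<subseteq> h ` ?K"
    proof
      fix y assume "y \<in> ?L"
      then obtain a' g' where y: "a' \<in> lower_central H (Suc k)" "g' \<in> carrier H"
        "y = a' \<otimes>\<^bsub>H\<^esub> g' \<otimes>\<^bsub>H\<^esub> inv\<^bsub>H\<^esub> a' \<otimes>\<^bsub>H\<^esub> inv\<^bsub>H\<^esub> g'" by blast
      obtain a where a: "a \<in> lower_central G (Suc k)" "a' = h a" using y(1) Suc.IH by blast
      obtain g where g: "g \<in> carrier G" "g' = h g" using y(2) assms(4) by blast
      have "a \<in> carrier G" using a(1) sub by blast
      then have "y = h (a \<otimes>\<^bsub>G\<^esub> g \<otimes>\<^bsub>G\<^esub> inv\<^bsub>G\<^esub> a \<otimes>\<^bsub>G\<^esub> inv\<^bsub>G\<^esub> g)" using y(3) a(2) g by simp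
      then show "y \<in> h ` ?K" using a(1) g(1) by blast
    qed
    then have "generate H ?L \<subseteq> generate H (h ` ?K)" by (rule h.H.mono_generate)
    also have "?K \<subseteq> carrier G" using sub by auto
    then have "generate H (h ` ?K) = h ` generate G ?K" by (rule h.generate_img)
    finally show ?case by simp
  qed
qed

lemma lower_central_comm_group:
  fixes G (structure)
  assumes "comm_group G"
  shows "lower_central G (Suc (Suc k)) \<subseteq> {\<one>\<^bsub>G\<^esub>}"
proof -
  interpret comm_group G by fact
  have "h \<otimes> g \<otimes> inv h \<otimes> inv g = \<one>" if "h \<in> carrier G" "g \<in> carrier G" for h g
    using that by (simp add: m_comm[of h g] m_assoc)
  then show ?thesis
    unfolding lower_central.simps
    by (intro generate_subgroup_incl triv_subgroup) (use lower_central_subset[OF is_group] in blast)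
qed

primrec (in group) left_comm :: "'a \<Rightarrow> 'a \<Rightarrow> nat \<Rightarrow> 'a" where
  "left_comm a b 0 = a"
| "left_comm a b (Suc n) = comm (left_comm a b n) b"

lemma (in group) left_comm_closed [simp]: "a \<in> carrier G \<Longrightarrow> b \<in> carrier G \<Longrightarrow> left_comm a b n \<in> carrier G"
  by (induction n) auto

lemma (in group) left_comm_lower_central:
  assumes "a \<in> carrier G" "b \<in> carrier G"
  shows "left_comm a b n \<in> lower_central G (Suc n)"
proof (induction n)
  case (Suc n)
  then show ?case using comm_in_lower_central[OF is_group Suc.IH assms(2)] by simp
qed (use assms in simp)

lemma (in group_hom) hom_comm: "a \<in> carrier G \<Longrightarrow> b \<in> carrier G \<Longrightarrow> h (G.comm a b) = H.comm (h a) (h b)"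
  by (simp add: G.comm_def H.comm_def)

lemma (in group_hom) hom_left_comm:
  "a \<in> carrier G \<Longrightarrow> b \<in> carrier G \<Longrightarrow> h (G.left_comm a b n) = H.left_comm (h a) (h b) n"
  by (induction n) (simp_all add: hom_comm)

text \<open>Here \<open>[\<dots>[b, a], \<dots>, a]\<close> with \<open>a = (0, 1)\<close> and \<open>b = (1, 0)\<close> is \<open>(\<plusminus>X\<^sup>n, 0)\<close>, and the lower central series consists
  of multiples of powers of \<open>X\<close>. This shows that the corresponding commutator in a free nilpotent group has
  infinite order.\<close>

definition fps_semidirect :: "(rat fps \<times> rat) monoid" where
  "fps_semidirect = \<lparr>carrier = UNIV,
     monoid.mult = (\<lambda>(f, k) (g, m). (f + fps_binomial k * g, k + m)), one = (0, 0)\<rparr>"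

lemma carrier_fps_semidirect [simp]: "carrier fps_semidirect = UNIV"
  by (simp add: fps_semidirect_def)

lemma mult_fps_semidirect [simp]:
  "(f, k) \<otimes>\<^bsub>fps_semidirect\<^esub> (g, m) = (f + fps_binomial k * g, k + m)"
  by (simp add: fps_semidirect_def)

lemma one_fps_semidirect [simp]: "\<one>\<^bsub>fps_semidirect\<^esub> = (0, 0)"
  by (simp add: fps_semidirect_def)

lemma group_fps_semidirect: "group fps_semidirect"
proof (rule groupI)
  fix x :: "rat fps \<times> rat"
  obtain f k where x: "x = (f, k)" by (cases x)
  show "\<exists>y\<in>carrier fps_semidirect. y \<otimes>\<^bsub>fps_semidirect\<^esub> x = \<one>\<^bsub>fps_semidirect\<^esub>"
    by (rule bexI[of _ "(- (fps_binomial (- k) * f), - k)"]) (simp_all add: x)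
qed (auto simp: algebra_simps fps_binomial_add_mult)

interpretation fps_semidirect: group fps_semidirect
  by (rule group_fps_semidirect)

lemma inv_fps_semidirect: "inv\<^bsub>fps_semidirect\<^esub> (f, k) = (- (fps_binomial (- k) * f), - k)"
  by (rule fps_semidirect.inv_equality) simp_all

lemma comm_fps_semidirect:
  "fps_semidirect.comm (f, a) (g, b) = ((fps_binomial a - 1) * g - (fps_binomial b - 1) * f, 0)"
proof -
  have "fps_semidirect.comm (f, a) (g, b) =
      ((fps_binomial a - 1) * g - (fps_binomial b - 1) * f, 0) \<longleftrightarrow>
    (f, a) \<otimes>\<^bsub>fps_semidirect\<^esub> (g, b) =
      ((fps_binomial a - 1) * g - (fps_binomial b - 1) * f, 0) \<otimes>\<^bsub>fps_semidirect\<^esub>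
        ((g, b) \<otimes>\<^bsub>fps_semidirect\<^esub> (f, a))"
    by (rule fps_semidirect.comm_eq_iff) simp_all
  then show ?thesis by (simp add: algebra_simps)
qed

text \<open>The binomial series (1 + X)^a has constant term 1.\<close>

lemma fps_X_dvd_fps_binomial: "fps_X dvd (fps_binomial a - 1 :: rat fps)"
proof -
  have "fps_binomial a - 1 = fps_X * fps_shift 1 (fps_binomial a - 1 :: rat fps)"
    by (rule fps_ext) simp
  then show ?thesis by (rule dvdI)
qed

text \<open>Commutation of (a, 0) with (f, b) multiplies \<open>a\<close> by 1 - (1 + X)^b, so each
  step of the series gains a factor X.\<close>

lemma lower_central_fps_semidirect:
  "lower_central fps_semidirect (Suc (Suc k)) \<subseteq> {(f, 0) | f. fps_X ^ Suc k dvd f}"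
proof -
  have sub: "subgroup {(f, 0) | f. fps_X ^ k dvd f} fps_semidirect" for k
    by (rule fps_semidirect.subgroupI) (auto simp: inv_fps_semidirect intro: exI[of _ 0])
  have comm_eq: "h \<otimes>\<^bsub>fps_semidirect\<^esub> g \<otimes>\<^bsub>fps_semidirect\<^esub> inv\<^bsub>fps_semidirect\<^esub> h \<otimes>\<^bsub>fps_semidirect\<^esub> inv\<^bsub>fps_semidirect\<^esub> g
     = fps_semidirect.comm h g" for h g by (simp add: fps_semidirect.comm_def)
  show ?thesis
  proof (induction k)
    case 0
    show ?case
      unfolding lower_central.simps comm_eq
    proof (rule fps_semidirect.generate_subgroup_incl[OF _ sub])
      show "{fps_semidirect.comm h g |h g. h \<in> carrier fps_semidirect \<and> g \<in> carrier fps_semidirect}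
          \<subseteq> {(f, 0) | f. fps_X ^ Suc 0 dvd f}"
        by (auto simp: comm_fps_semidirect intro!: dvd_diff dvd_mult2 fps_X_dvd_fps_binomial)
    qed
  next
    case (Suc k)
    show ?case
      unfolding lower_central.simps(3)[of _ "Suc k"] comm_eq
    proof (rule fps_semidirect.generate_subgroup_incl[OF subsetI sub])
      fix y assume "y \<in> {fps_semidirect.comm h g |h g.
        h \<in> lower_central fps_semidirect (Suc (Suc k)) \<and> g \<in> carrier fps_semidirect}"
      then obtain h g where h: "h \<in> lower_central fps_semidirect (Suc (Suc k))"
        and y: "y = fps_semidirect.comm h g" by blast
      obtain a where a: "h = (a, 0)" "fps_X ^ Suc k dvd a" using h Suc.IH by blast
      obtain f b where g: "g = (f, b)" by (cases g)
      have "fps_X * fps_X ^ Suc k dvd (fps_binomial b - 1) * a"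
        by (intro mult_dvd_mono fps_X_dvd_fps_binomial a)
      then show "y \<in> {(f, 0) |f. fps_X ^ Suc (Suc k) dvd f}"
        by (simp add: y a(1) g comm_fps_semidirect)
    qed
  qed
qed

text \<open>Commutation with (0, 1) multiplies the first coordinate by 1 - (1 + X) = -X.\<close>

lemma left_comm_fps_semidirect: "fps_semidirect.left_comm (1, 0) (0, 1) n = ((- fps_X) ^ n, 0)"
proof (induction n)
  case (Suc n)
  then show ?case by (simp add: comm_fps_semidirect fps_binomial_1)
qed simp

text \<open>Compare the coefficients of X^k, after removing the sign by a factor (-1)^k.\<close>

lemma fps_X_power_dvd_imp:
  assumes "fps_X ^ Suc k dvd of_nat n * (- fps_X :: rat fps) ^ k"
  shows "n = 0"
proof -
  have "fps_X ^ Suc k dvd of_nat n * (- fps_X :: rat fps) ^ k * (- 1) ^ k"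
    using assms by (rule dvd_mult2)
  also have "of_nat n * (- fps_X :: rat fps) ^ k * (- 1) ^ k = fps_const (of_nat n) * fps_X ^ k"
    by (simp add: mult.assoc fps_of_nat flip: power_mult_distrib)
  finally obtain g :: "rat fps" where g: "fps_const (of_nat n) * fps_X ^ k = fps_X ^ Suc k * g"
    by (elim dvdE)
  have "fps_nth (fps_const (of_nat n) * fps_X ^ k) k = (of_nat n :: rat)"
    by simp
  moreover have "fps_nth (fps_X ^ Suc k * g) k = 0"
    by (simp only: fps_X_power_mult_nth) simp
  ultimately show ?thesis using g by simp
qed

lemma pow_fps_semidirect: "(f, 0) [^]\<^bsub>fps_semidirect\<^esub> (n::nat) = (of_nat n * f, 0)"
  by (induction n) (simp_all add: algebra_simps)

section \<open>Automorphisms of free nilpotent groups\<close>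

text \<open>The projection \<open>\<pi>\<close> replaces the quotient map, so that elements of
  \<open>N\<close> are not cosets; the last two assumptions identify its kernel.\<close>

locale free_nilpotent = group N for N (structure) +
  fixes r s :: nat and \<pi> :: "(nat \<times> bool) list \<Rightarrow> 'a"
  assumes rank: "2 \<le> r" and class_ge: "2 \<le> s"
    and \<pi>_hom: "\<pi> \<in> hom (free_group {..<r}) N"
    and \<pi>_surj: "\<pi> ` carrier (free_group {..<r}) = carrier N"
    and \<pi>_kernel: "w \<in> carrier (free_group {..<r}) \<Longrightarrow>
      \<pi> w = \<one> \<Longrightarrow> w \<in> lower_central (free_group {..<r}) (Suc s)"
    and \<pi>_lower_central: "w \<in> lower_central (free_group {..<r}) (Suc s) \<Longrightarrow> \<pi> w = \<one>"
begin

abbreviation F where "F \<equiv> free_group {..<r}"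

sublocale \<pi>: group_hom F N \<pi>
  using \<pi>_hom group_free_group is_group by (simp add: group_hom_def group_hom_axioms_def)

text \<open>Indices start at 0: \<open>gen 0\<close> and \<open>gen 1\<close> are the outline's
  first two generators, and \<open>expo 0\<close> and \<open>expo 1\<close> their exponent
  sums.\<close>

definition gen :: "nat \<Rightarrow> 'a" where
  "gen i = \<pi> [(i, True)]"

lemma letter_closed: "i < r \<Longrightarrow> [(i, True)] \<in> carrier F"
  by (simp add: free_group_def)

lemma gen_closed [simp]: "i < r \<Longrightarrow> gen i \<in> carrier N"
  unfolding gen_def using letter_closed \<pi>.hom_closed by blast

lemma gen01_closed [simp]: "gen 0 \<in> carrier N" "gen (Suc 0) \<in> carrier N"
  using rank by simp_all

lemma hom_eqI:
  assumes "group H" "g \<in> hom N H" "h \<in> hom N H" "\<And>i. i < r \<Longrightarrow> g (gen i) = h (gen i)" "y \<in> carrier N"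
  shows "g y = h y"
proof -
  obtain w where w: "w \<in> carrier F" "y = \<pi> w" using \<pi>_surj assms(5) by blast
  have "(g \<circ> \<pi>) w = (h \<circ> \<pi>) w"
    by (rule free_group_hom_eqI[OF assms(1) Group.hom_compose[OF \<pi>_hom assms(2)] Group.hom_compose[OF \<pi>_hom assms(3)]])
      (use assms(4) w(1) in \<open>auto simp: gen_def\<close>)
  then show ?thesis using w(2) by simp
qed

text \<open>The universal property of the quotient: the value is taken at any preimage, and the
  kernel of \<open>\<pi>\<close> makes the choice irrelevant.\<close>

lemma factor_hom:
  assumes "group H" and e: "e \<in> hom F H"
    and triv: "\<And>w. w \<in> lower_central F (Suc s) \<Longrightarrow> e w = \<one>\<^bsub>H\<^esub>"
  obtains h where "h \<in> hom N H" "\<And>w. w \<in> carrier F \<Longrightarrow> h (\<pi> w) = e w"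
proof -
  interpret e: group_hom F H e
    using assms group_free_group by (simp add: group_hom_def group_hom_axioms_def)
  have eq: "e a = e b" if "a \<in> carrier F" "b \<in> carrier F" "\<pi> a = \<pi> b" for a b
  proof -
    have "\<pi> (a \<otimes>\<^bsub>F\<^esub> inv\<^bsub>F\<^esub> b) = \<one>" using that by simp
    then have "e (a \<otimes>\<^bsub>F\<^esub> inv\<^bsub>F\<^esub> b) = \<one>\<^bsub>H\<^esub>" using that by (intro triv \<pi>_kernel) auto
    then have "e a \<otimes>\<^bsub>H\<^esub> inv\<^bsub>H\<^esub> e b = \<one>\<^bsub>H\<^esub>" using that by simp
    then show ?thesis using that e.hom_closed by (simp add: e.H.inv_solve_right')
  qed
  define h where "h y = e (inv_into (carrier F) \<pi> y)" for y
  have h: "h (\<pi> w) = e w" if "w \<in> carrier F" for w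
    unfolding h_def by (rule eq) (use that in \<open>auto intro: inv_into_into f_inv_into_f\<close>)
  have "h \<in> hom N H"
  proof (rule homI)
    fix x y assume "x \<in> carrier N" "y \<in> carrier N"
    then obtain a b where ab: "a \<in> carrier F" "x = \<pi> a" "b \<in> carrier F" "y = \<pi> b" using \<pi>_surj by blast
    show "h x \<in> carrier H" using ab h by simp
    have "x \<otimes> y = \<pi> (a \<otimes>\<^bsub>F\<^esub> b)" using ab by simp
    then have "h (x \<otimes> y) = e (a \<otimes>\<^bsub>F\<^esub> b)" using h[of "a \<otimes>\<^bsub>F\<^esub> b"] ab by simp
    then show "h (x \<otimes> y) = h x \<otimes>\<^bsub>H\<^esub> h y" using ab h by simp
  qed
  then show thesis using h that by blast
qed

lemma lower_central_trivial: "lower_central N (Suc s) \<subseteq> {\<one>}"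
  using lower_central_surj_hom[OF group_free_group is_group \<pi>_hom \<pi>_surj, of s] \<pi>_lower_central by blast

text \<open>Relative freeness: evaluation of words maps the term of index s + 1 of the series of
  \<open>F\<close> into that of \<open>N\<close>, which is trivial.\<close>

lemma endomorphism_exists:
  assumes "\<And>i. i < r \<Longrightarrow> f i \<in> carrier N"
  obtains h where "h \<in> hom N N" "\<And>i. i < r \<Longrightarrow> h (gen i) = f i"
proof -
  have f: "f \<in> {..<r} \<rightarrow> carrier N" using assms by auto
  have hom: "free_eval N f \<in> hom F N" by (rule free_eval_hom[OF f])
  have "free_eval N f w = \<one>" if "w \<in> lower_central F (Suc s)" for w
    using lower_central_hom[OF group_free_group is_group hom, of s] lower_central_trivial that by blast
  then obtain h where h: "h \<in> hom N N" "\<And>w. w \<in> carrier F \<Longrightarrow> h (\<pi> w) = free_eval N f w"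
    using factor_hom[OF is_group hom] by blast
  have "h (gen i) = f i" if "i < r" for i
    using h(2)[OF letter_closed[OF that]] assms[OF that] by (simp add: gen_def)
  then show thesis using h(1) that by blast
qed

text \<open>The integers are abelian, so the exponent sum on \<open>F\<close> kills commutators and
  factors through \<open>N\<close>.\<close>

lemma exponent_exists:
  "\<exists>e. e \<in> hom N integer_group \<and> (\<forall>j<r. e (gen j) = (if i = j then 1 else 0))"
proof -
  interpret Z: group integer_group by simp
  let ?f = "\<lambda>j. if i = j then 1 else 0 :: int"
  have hom: "free_eval integer_group ?f \<in> hom F integer_group"
    by (rule Z.free_eval_hom) simp
  have s: "Suc s = Suc (Suc (s - 1))" using class_ge by simp
  have "free_eval integer_group ?f w = \<one>\<^bsub>integer_group\<^esub>" if "w \<in> lower_central F (Suc s)" for w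
  proof -
    have "free_eval integer_group ?f w \<in> lower_central integer_group (Suc s)"
      using lower_central_hom[OF group_free_group Z.is_group hom, of s] that by blast
    then show ?thesis
      using lower_central_comm_group[OF abelian_integer_group, of "s - 1"] unfolding s by blast
  qed
  then obtain e where e: "e \<in> hom N integer_group" "\<And>w. w \<in> carrier F \<Longrightarrow> e (\<pi> w) = free_eval integer_group ?f w"
    using factor_hom[OF Z.is_group hom] by blast
  have "e (gen j) = ?f j" if "j < r" for j
    using e(2)[OF letter_closed[OF that]] by (simp add: gen_def)
  then show ?thesis using e(1) by blast
qed

definition expo :: "nat \<Rightarrow> 'a \<Rightarrow> int" where
  "expo i = (SOME e. e \<in> hom N integer_group \<and> (\<forall>j<r. e (gen j) = (if i = j then 1 else 0)))"

lemma expo: "expo i \<in> hom N integer_group" "j < r \<Longrightarrow> expo i (gen j) = (if i = j then 1 else 0)"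
  using someI_ex[OF exponent_exists[of i]] unfolding expo_def by auto

sublocale expo: group_hom N integer_group "expo i" for i
  using expo(1) is_group by (simp add: group_hom_def group_hom_axioms_def)

lemma expo_mult [simp]: "x \<in> carrier N \<Longrightarrow> y \<in> carrier N \<Longrightarrow> expo i (x \<otimes> y) = expo i x + expo i y"
  using expo.hom_mult by simp

lemma expo_int_pow: "x \<in> carrier N \<Longrightarrow> expo i (x [^] (n::int)) = n * expo i x"
  using expo.hom_int_pow by simp

lemma int_hom_eqI:
  assumes "\<And>x y. x \<in> carrier N \<Longrightarrow> y \<in> carrier N \<Longrightarrow> g (x \<otimes> y) = g x + (g y :: int)"
    "\<And>x y. x \<in> carrier N \<Longrightarrow> y \<in> carrier N \<Longrightarrow> h (x \<otimes> y) = h x + (h y :: int)"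
    "\<And>i. i < r \<Longrightarrow> g (gen i) = h (gen i)" "y \<in> carrier N"
  shows "g y = h y"
  by (rule hom_eqI[of integer_group]) (use assms in \<open>auto simp: hom_def\<close>)

text \<open>With s - 1 brackets the commutator has weight s, so it lies in the last nontrivial term
  of the series.\<close>

definition c :: 'a where
  "c = left_comm (gen 1) (gen 0) (s - 1)"

lemma c_closed [simp]: "c \<in> carrier N"
  by (simp add: c_def)

lemma c_central: "y \<in> carrier N \<Longrightarrow> c \<otimes> y = y \<otimes> c"
proof -
  assume y: "y \<in> carrier N"
  have "c \<in> lower_central N (Suc (s - 1))"
    unfolding c_def by (rule left_comm_lower_central) simp_all
  then have "comm c y \<in> lower_central N (Suc (Suc (s - 1)))"
    using y by (rule comm_in_lower_central[OF is_group])
  then have "comm c y = \<one>" using lower_central_trivial class_ge by auto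
  then show ?thesis using y by (simp add: comm_eq_one_iff)
qed

text \<open>Because s is at least 2, \<open>c\<close> is a commutator, and commutators vanish in the
  integers.\<close>

lemma expo_c [simp]: "expo i c = 0"
proof -
  have "expo i (comm a b) = 0" if "a \<in> carrier N" "b \<in> carrier N" for a b
    using that by (simp add: comm_def expo.hom_inv)
  moreover obtain n where "s - 1 = Suc n" using class_ge by (cases "s - 1") auto
  ultimately show ?thesis by (simp add: c_def)
qed

text \<open>If the n-th power of \<open>c\<close> is trivial, its lift to \<open>F\<close> lies in
  the term of index s + 1. The image n(-X)^(s - 1) in the power series model is then divisible by
  X^s, which forces n = 0.\<close>

lemma c_int_pow_eq_one: "c [^] (n::int) = \<one> \<Longrightarrow> n = 0"
proof -
  have nat: "n = 0" if c: "c [^] (n::nat) = \<one>" for n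
  proof -
    define f where "f i = (if i = 0 then (0, 1) else if i = (1::nat) then (1, 0) else (0 :: rat fps, 0 :: rat))" for i
    let ?e = "free_eval fps_semidirect f"
    have hom: "?e \<in> hom F fps_semidirect" by (rule fps_semidirect.free_eval_hom) simp
    interpret e: group_hom F fps_semidirect ?e
      using hom group_free_group group_fps_semidirect by (simp add: group_hom_def group_hom_axioms_def)
    let ?a = "[(1, True)] :: (nat \<times> bool) list" and ?b = "[(0, True)] :: (nat \<times> bool) list"
    have ab: "?a \<in> carrier F" "?b \<in> carrier F" using rank by (auto intro!: letter_closed)
    define W where "W = \<pi>.G.left_comm ?a ?b (s - 1) [^]\<^bsub>F\<^esub> n"
    have W: "W \<in> carrier F" using ab by (simp add: W_def)
    have "\<pi> W = c [^] n"
      using ab by (simp add: W_def \<pi>.hom_nat_pow \<pi>.hom_left_comm c_def gen_def)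
    then have "W \<in> lower_central F (Suc s)" using c W by (intro \<pi>_kernel) simp_all
    then have "?e W \<in> lower_central fps_semidirect (Suc s)"
      using lower_central_hom[OF group_free_group group_fps_semidirect hom, of s] by blast
    moreover have "lower_central fps_semidirect (Suc s) \<subseteq> {(f, 0) | f. fps_X ^ s dvd f}"
      using lower_central_fps_semidirect[of "s - 1"] class_ge by simp
    ultimately obtain q where q: "?e W = (q, 0)" "fps_X ^ s dvd q" by blast
    have "?e W = fps_semidirect.left_comm (?e ?a) (?e ?b) (s - 1) [^]\<^bsub>fps_semidirect\<^esub> n"
      using ab by (simp only: W_def e.hom_nat_pow e.hom_left_comm \<pi>.G.left_comm_closed)
    moreover have "?e ?a = (1, 0)" "?e ?b = (0, 1)" by (simp_all add: f_def)
    ultimately have "?e W = (of_nat n * (- fps_X) ^ (s - 1), 0)"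
      by (simp only: left_comm_fps_semidirect pow_fps_semidirect)
    then have "fps_X ^ s dvd of_nat n * (- fps_X :: rat fps) ^ (s - 1)" using q by simp
    then show "n = 0" using fps_X_power_dvd_imp[of "s - 1" n] class_ge by simp
  qed
  assume c: "c [^] n = \<one>"
  show "n = 0"
  proof (cases n rule: int_cases2)
    case (nonneg k)
    then show ?thesis using nat[of k] c by (simp add: int_pow_int)
  next
    case (nonpos k)
    then have "inv (c [^] k) = \<one>" using c by (simp add: int_pow_neg_int)
    then have "c [^] k = \<one>" by (simp add: inv_eq_1_iff)
    then show ?thesis using nat[of k] nonpos by simp
  qed
qed

lemma c_int_pow_eq_iff: "c [^] (m::int) = c [^] n \<longleftrightarrow> m = n"
proof
  assume "c [^] m = c [^] n"
  then have "c [^] (m - n) = \<one>" by (simp add: int_pow_diff)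
  then show "m = n" using c_int_pow_eq_one by fastforce
qed simp

lemma c_int_pow_central: "y \<in> carrier N \<Longrightarrow> c [^] (n::int) \<otimes> y = y \<otimes> c [^] n"
  by (rule int_pow_commute) (simp_all add: c_central)

text \<open>Central automorphisms: \<open>l\<close> will be \<open>transvect 1 0\<close> and its
  commutator with \<open>u\<close> will be \<open>transvect 0 (- 1)\<close>. The restriction is
  there because elements of \<open>AutoGroup\<close> are extensional.\<close>

definition transvect :: "int \<Rightarrow> int \<Rightarrow> 'a \<Rightarrow> 'a" where
  "transvect a b = (\<lambda>x\<in>carrier N. x \<otimes> c [^] (a * expo 0 x + b * expo 1 x))"

lemma transvect_apply:
  "x \<in> carrier N \<Longrightarrow> transvect a b x = x \<otimes> c [^] (a * expo 0 x + b * expo 1 x)"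
  by (simp add: transvect_def)

lemma transvect_closed: "x \<in> carrier N \<Longrightarrow> transvect a b x \<in> carrier N"
  by (simp add: transvect_apply)

lemma expo_transvect: "x \<in> carrier N \<Longrightarrow> expo i (transvect a b x) = expo i x"
  by (simp add: transvect_apply expo_int_pow)

text \<open>The parameters add up since multiplication by a power of \<open>c\<close> leaves
  exponent sums unchanged.\<close>

lemma transvect_transvect:
  "x \<in> carrier N \<Longrightarrow> transvect a b (transvect a' b' x) = transvect (a + a') (b + b') x"
proof -
  assume x: "x \<in> carrier N"
  have "transvect a b (transvect a' b' x) =
      transvect a' b' x \<otimes> c [^] (a * expo 0 x + b * expo 1 x)"
    using x by (simp add: transvect_apply[of "transvect a' b' x"] transvect_closed expo_transvect)
  also have "\<dots> = x \<otimes> c [^] (a' * expo 0 x + b' * expo 1 x + (a * expo 0 x + b * expo 1 x))"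
    using x by (simp add: transvect_apply m_assoc int_pow_mult)
  finally show ?thesis using x by (simp add: transvect_apply algebra_simps)
qed

lemma transvect_0: "x \<in> carrier N \<Longrightarrow> transvect 0 0 x = x"
  by (simp add: transvect_apply)

lemma transvect_hom: "transvect a b \<in> hom N N"
proof (rule homI)
  fix x y assume xy: "x \<in> carrier N" "y \<in> carrier N"
  let ?f = "\<lambda>x. a * expo 0 x + b * expo 1 x"
  have "transvect a b (x \<otimes> y) = x \<otimes> y \<otimes> (c [^] ?f x \<otimes> c [^] ?f y)"
    using xy by (simp add: transvect_apply int_pow_mult[symmetric] algebra_simps)
  also have "\<dots> = x \<otimes> (y \<otimes> c [^] ?f x) \<otimes> c [^] ?f y"
    using xy by (simp add: m_assoc)
  also have "\<dots> = x \<otimes> c [^] ?f x \<otimes> (y \<otimes> c [^] ?f y)"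
    using xy by (subst c_int_pow_central[OF xy(2), symmetric]) (simp add: m_assoc)
  finally show "transvect a b (x \<otimes> y) = transvect a b x \<otimes> transvect a b y"
    using xy by (simp add: transvect_apply)
qed (rule transvect_closed)

section \<open>Automorphisms determined on generators\<close>

lemma auto_iff: "f \<in> auto N \<longleftrightarrow> f \<in> hom N N \<and> f \<in> extensional (carrier N) \<and> bij_betw f (carrier N) (carrier N)"
  by (auto simp: auto_def Bij_def)

lemma autoI:
  assumes f: "f \<in> hom N N" "f \<in> extensional (carrier N)" and g: "g \<in> hom N N"
    and "\<And>x. x \<in> carrier N \<Longrightarrow> g (f x) = x" "\<And>x. x \<in> carrier N \<Longrightarrow> f (g x) = x"
  shows "f \<in> auto N"
  unfolding auto_iff using assms by (auto intro!: bij_betw_byWitness[of _ g] simp: hom_in_carrier)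

lemma transvect_auto: "transvect a b \<in> auto N"
  by (rule autoI[of _ "transvect (- a) (- b)"])
    (simp_all add: transvect_hom transvect_transvect transvect_0, simp add: transvect_def)

text \<open>The endomorphisms extending \<open>f\<close> and \<open>g\<close> are mutually inverse
  because their composites fix the generators. The last two assumptions are about any extension, as
  the extensions are only constructed inside.\<close>

lemma auto_from_generators:
  assumes f: "\<And>i. i < r \<Longrightarrow> f i \<in> carrier N" and g: "\<And>i. i < r \<Longrightarrow> g i \<in> carrier N"
    and fg: "\<And>h i. h \<in> hom N N \<Longrightarrow> (\<And>j. j < r \<Longrightarrow> h (gen j) = f j) \<Longrightarrow> i < r \<Longrightarrow> h (g i) = gen i"
    and gf: "\<And>h i. h \<in> hom N N \<Longrightarrow> (\<And>j. j < r \<Longrightarrow> h (gen j) = g j) \<Longrightarrow> i < r \<Longrightarrow> h (f i) = gen i"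
  obtains h where "h \<in> auto N" "\<And>i. i < r \<Longrightarrow> h (gen i) = f i"
proof -
  obtain h where h: "h \<in> hom N N" "\<And>i. i < r \<Longrightarrow> h (gen i) = f i"
    using endomorphism_exists[of f] f by blast
  obtain k where k: "k \<in> hom N N" "\<And>i. i < r \<Longrightarrow> k (gen i) = g i"
    using endomorphism_exists[of g] g by blast
  have id: "(\<lambda>x. x) \<in> hom N N" by (simp add: hom_def)
  have kh: "k (h x) = x" if "x \<in> carrier N" for x
    using hom_eqI[OF is_group Group.hom_compose[OF h(1) k(1)] id _ that] gf[OF k] h(2) by simp
  have hk: "h (k x) = x" if "x \<in> carrier N" for x
    using hom_eqI[OF is_group Group.hom_compose[OF k(1) h(1)] id _ that] fg[OF h] k(2) by simp
  let ?h = "restrict h (carrier N)"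
  have "?h \<in> hom N N" using h(1) by (auto simp: hom_def)
  then have "?h \<in> auto N"
    by (rule autoI[OF _ _ k(1)]) (use kh hk k(1) in \<open>auto simp: hom_in_carrier\<close>)
  then show thesis using that[of ?h] h(2) by simp
qed

lemma auto_eqI:
  assumes "f \<in> auto N" "g \<in> auto N" "\<And>i. i < r \<Longrightarrow> f (gen i) = g (gen i)"
  shows "f = g"
  using assms hom_eqI[OF is_group, of f g] unfolding auto_iff by (auto intro: extensionalityI)

sublocale G: group "AutoGroup N"
  by (rule AutoGroup)

lemma carrier_AutoGroup: "carrier (AutoGroup N) = auto N"
  by (simp add: AutoGroup_def)

lemma mult_AutoGroup:
  "f \<in> auto N \<Longrightarrow> g \<in> auto N \<Longrightarrow> x \<in> carrier N \<Longrightarrow> (f \<otimes>\<^bsub>AutoGroup N\<^esub> g) x = f (g x)"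
  by (simp add: AutoGroup_def BijGroup_def auto_def compose_def)

lemma mult_AutoGroup_eqI:
  assumes "f \<in> auto N" "g \<in> auto N" "f' \<in> auto N" "g' \<in> auto N"
    and "\<And>i. i < r \<Longrightarrow> f (g (gen i)) = f' (g' (gen i))"
  shows "f \<otimes>\<^bsub>AutoGroup N\<^esub> g = f' \<otimes>\<^bsub>AutoGroup N\<^esub> g'"
proof (rule auto_eqI)
  show "f \<otimes>\<^bsub>AutoGroup N\<^esub> g \<in> auto N" "f' \<otimes>\<^bsub>AutoGroup N\<^esub> g' \<in> auto N"
    using assms(1-4) G.m_closed unfolding carrier_AutoGroup by blast+
qed (use assms in \<open>simp add: mult_AutoGroup\<close>)

end

section \<open>The parameters \<open>u\<close>, \<open>l\<close>, \<open>d\<close> in the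
  automorphism group\<close>

context free_nilpotent
begin

lemma auto_hom: "f \<in> auto N \<Longrightarrow> group_hom N N f"
  using is_group by (simp add: auto_iff group_hom_def group_hom_axioms_def)

lemma upper_transvection_exists:
  obtains u where "u \<in> auto N" "u (gen 1) = gen 1 \<otimes> gen 0" "\<And>i. i < r \<Longrightarrow> i \<noteq> 1 \<Longrightarrow> u (gen i) = gen i"
proof -
  obtain u where u: "u \<in> auto N" "\<And>i. i < r \<Longrightarrow> u (gen i) = (if i = 1 then gen 1 \<otimes> gen 0 else gen i)"
  proof (rule auto_from_generators[of "\<lambda>i. if i = 1 then gen 1 \<otimes> gen 0 else gen i"
        "\<lambda>i. if i = 1 then gen 1 \<otimes> inv gen 0 else gen i"])
    fix h i assume h: "h \<in> hom N N" and i: "i < r"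
    interpret h: group_hom N N h using h is_group by (simp add: group_hom_def group_hom_axioms_def)
    show "h (if i = 1 then gen 1 \<otimes> inv gen 0 else gen i) = gen i"
      if "\<And>j. j < r \<Longrightarrow> h (gen j) = (if j = 1 then gen 1 \<otimes> gen 0 else gen j)"
      using that[of 0] that[of 1] that[of i] i rank by (auto simp: m_assoc)
    show "h (if i = 1 then gen 1 \<otimes> gen 0 else gen i) = gen i"
      if "\<And>j. j < r \<Longrightarrow> h (gen j) = (if j = 1 then gen 1 \<otimes> inv gen 0 else gen j)"
      using that[of 0] that[of 1] that[of i] i rank by (auto simp: m_assoc)
  qed (use rank in auto)
  show thesis by (rule that[OF u(1)]) (use u(2) rank in auto)
qed

lemma sign_change_exists:
  obtains d where "d \<in> auto N" "\<And>i. i < 2 \<Longrightarrow> d (gen i) = gen i"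
    "\<And>i. i < r \<Longrightarrow> 2 \<le> i \<Longrightarrow> d (gen i) = inv gen i"
proof -
  have hd: "h (if i < 2 then gen i else inv gen i) = gen i"
    if "h \<in> hom N N" "\<And>j. j < r \<Longrightarrow> h (gen j) = (if j < 2 then gen j else inv gen j)" "i < r" for h i
  proof -
    interpret h: group_hom N N h using that(1) is_group by (simp add: group_hom_def group_hom_axioms_def)
    show ?thesis using that(2,3) by simp
  qed
  obtain d where d: "d \<in> auto N" "\<And>i. i < r \<Longrightarrow> d (gen i) = (if i < 2 then gen i else inv gen i)"
  proof (rule auto_from_generators[of "\<lambda>i. if i < 2 then gen i else inv gen i"
        "\<lambda>i. if i < 2 then gen i else inv gen i"])
    fix h i assume h: "h \<in> hom N N" and i: "i < r"
    show "h (if i < 2 then gen i else inv gen i) = gen i"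
      if "\<And>j. j < r \<Longrightarrow> h (gen j) = (if j < 2 then gen j else inv gen j)"
      using h that i by (rule hd)
    show "h (if i < 2 then gen i else inv gen i) = gen i"
      if "\<And>j. j < r \<Longrightarrow> h (gen j) = (if j < 2 then gen j else inv gen j)"
      using h that i by (rule hd)
  qed auto
  show thesis by (rule that[OF d(1)]) (use d(2) rank in auto)
qed

text \<open>\<open>\<lambda>n. transvect 0 (- n)\<close> is a homomorphism from the integers, hence
  compatible with powers.\<close>

lemma transvect_int_pow: "transvect 0 (- 1) [^]\<^bsub>AutoGroup N\<^esub> (n::int) = transvect 0 (- n)"
proof -
  have "(\<lambda>n. transvect 0 (- n)) \<in> hom integer_group (AutoGroup N)"
  proof (rule homI)
    fix m n :: int
    show "transvect 0 (- m) \<in> carrier (AutoGroup N)" by (simp add: carrier_AutoGroup transvect_auto)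
    have "transvect 0 (- m) \<otimes>\<^bsub>AutoGroup N\<^esub> transvect 0 (- n) \<in> auto N"
      using G.m_closed transvect_auto unfolding carrier_AutoGroup by blast
    then show "transvect 0 (- (m \<otimes>\<^bsub>integer_group\<^esub> n)) = transvect 0 (- m) \<otimes>\<^bsub>AutoGroup N\<^esub> transvect 0 (- n)"
      by (intro auto_eqI) (simp_all add: transvect_auto mult_AutoGroup transvect_transvect)
  qed
  then have "transvect 0 (- (1 [^]\<^bsub>integer_group\<^esub> n)) = transvect 0 (- 1) [^]\<^bsub>AutoGroup N\<^esub> n"
    by (rule hom_int_pow) (simp_all add: AutoGroup)
  then show ?thesis by simp
qed

theorem malcev_AutoGroup: "\<exists>u l d. malcev (AutoGroup N) u l d"
proof -
  obtain u where u: "u \<in> auto N" "u (gen 1) = gen 1 \<otimes> gen 0" "\<And>i. i < r \<Longrightarrow> i \<noteq> 1 \<Longrightarrow> u (gen i) = gen i"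
    using upper_transvection_exists by blast
  obtain d where d: "d \<in> auto N" "\<And>i. i < 2 \<Longrightarrow> d (gen i) = gen i"
    "\<And>i. i < r \<Longrightarrow> 2 \<le> i \<Longrightarrow> d (gen i) = inv gen i"
    using sign_change_exists by blast
  interpret u: group_hom N N u using u(1) by (rule auto_hom)
  interpret d: group_hom N N d using d(1) by (rule auto_hom)
  let ?l = "transvect 1 0" and ?v = "transvect 0 (- 1)"
  have l: "?l \<in> auto N" and v: "?v \<in> auto N" by (rule transvect_auto)+
  have expo0_u: "expo 0 (u x) = expo 0 x + expo 1 x" if "x \<in> carrier N" for x
  proof (rule int_hom_eqI[OF _ _ _ that])
    show "expo 0 (u (gen i)) = expo 0 (gen i) + expo 1 (gen i)" if "i < r" for i
      by (cases "i = 1") (use u(2,3) that rank in \<open>auto simp: expo\<close>)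
  qed auto
  have expo1_u: "expo 1 (u x) = expo 1 x" if "x \<in> carrier N" for x
  proof (rule int_hom_eqI[OF _ _ _ that])
    show "expo 1 (u (gen i)) = expo 1 (gen i)" if "i < r" for i
      by (cases "i = 1") (use u(2,3) that rank in \<open>auto simp: expo\<close>)
  qed auto
  have expo_d: "expo i (d x) = expo i x" if "x \<in> carrier N" "i < 2" for x i
  proof (rule int_hom_eqI[OF _ _ _ that(1)])
    show "expo i (d (gen j)) = expo i (gen j)" if "j < r" for j
      by (cases "j < 2") (use d(2,3) that \<open>i < 2\<close> in \<open>auto simp: expo\<close>)
  qed auto
  have uc: "u c = c"
  proof -
    \<comment> \<open>The innermost bracket is already unchanged by \<open>u\<close>, and the
      remaining brackets are with the fixed generator \<open>gen 0\<close>.\<close>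
    have "comm (gen 1 \<otimes> gen 0) (gen 0) = comm (gen 1) (gen 0)"
      by (simp add: comm_def m_assoc inv_mult_group)
    then have "left_comm (gen 1 \<otimes> gen 0) (gen 0) (Suc n) = left_comm (gen 1) (gen 0) (Suc n)" for n
      by (induction n) simp_all
    moreover obtain n where "s - 1 = Suc n" using class_ge by (cases "s - 1") auto
    moreover have "u (gen 0) = gen 0" using u(3) rank by simp
    ultimately show ?thesis using u(2) by (simp only: c_def u.hom_left_comm gen01_closed One_nat_def)
  qed
  \<comment> \<open>Conjugation by \<open>u\<close> turns \<open>transvect a b\<close> into
    \<open>transvect a (b - a)\<close>; for a = 1 and b = 0 this computes the commutator of
    \<open>u\<close> and \<open>l\<close>.\<close>
  have ut: "u (transvect a b x) = transvect a (b - a) (u x)" if "x \<in> carrier N" for a b x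
  proof -
    have "u (transvect a b x) = u x \<otimes> c [^] (a * expo 0 x + b * expo 1 x)"
      using that by (simp add: transvect_apply u.hom_int_pow uc)
    also have "a * expo 0 x + b * expo 1 x = a * expo 0 (u x) + (b - a) * expo 1 (u x)"
      using that by (simp only: expo0_u expo1_u) (simp add: algebra_simps)
    finally show ?thesis using that by (simp add: transvect_apply)
  qed
  have comm_ul: "G.comm u ?l = ?v"
  proof -
    have lu: "?l \<otimes>\<^bsub>AutoGroup N\<^esub> u \<in> auto N" using G.m_closed u(1) l unfolding carrier_AutoGroup by blast
    have "u \<otimes>\<^bsub>AutoGroup N\<^esub> ?l = ?v \<otimes>\<^bsub>AutoGroup N\<^esub> (?l \<otimes>\<^bsub>AutoGroup N\<^esub> u)"
      using mult_AutoGroup[OF l u(1)]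
      by (intro mult_AutoGroup_eqI[OF u(1) l v lu]) (simp add: ut transvect_transvect)
    then show ?thesis using G.comm_eq_iff u(1) l v unfolding carrier_AutoGroup by blast
  qed
  have "malcev (AutoGroup N) u ?l d"
  proof (unfold_locales, unfold comm_ul)
    show "u \<in> carrier (AutoGroup N)" "?l \<in> carrier (AutoGroup N)" "d \<in> carrier (AutoGroup N)"
      using u(1) l d(1) by (simp_all add: carrier_AutoGroup)
    show "u \<otimes>\<^bsub>AutoGroup N\<^esub> d = d \<otimes>\<^bsub>AutoGroup N\<^esub> u"
    proof (rule mult_AutoGroup_eqI[OF u(1) d(1) d(1) u(1)])
      fix i assume i: "i < r"
      consider "i = 1" | "i = 0" | "2 \<le> i" by linarith
      then show "u (d (gen i)) = d (u (gen i))"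
        by cases (use u(2,3) d(2,3) i in auto)
    qed
    show "u \<otimes>\<^bsub>AutoGroup N\<^esub> ?v = ?v \<otimes>\<^bsub>AutoGroup N\<^esub> u"
      by (rule mult_AutoGroup_eqI[OF u(1) v v u(1)]) (simp add: ut)
    show "?l \<otimes>\<^bsub>AutoGroup N\<^esub> ?v = ?v \<otimes>\<^bsub>AutoGroup N\<^esub> ?l"
      by (rule mult_AutoGroup_eqI[OF l v v l]) (simp add: transvect_transvect)
    show "n = 0" if "?v [^]\<^bsub>AutoGroup N\<^esub> n = \<one>\<^bsub>AutoGroup N\<^esub>" for n :: int
    proof -
      have "transvect 0 (- n) = transvect 0 0"
        using that transvect_int_pow[of n] transvect_int_pow[of 0] by simp
      then have "transvect 0 (- n) (gen 1) = transvect 0 0 (gen 1)" by simp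
      then have "gen 1 \<otimes> c [^] (- n) = gen 1 \<otimes> c [^] (0::int)"
        using rank by (simp add: transvect_apply expo)
      then have "c [^] (- n) = c [^] (0::int)" by simp
      then show ?thesis unfolding c_int_pow_eq_iff by simp
    qed
    show "\<exists>n::int. G.comm x ?l = ?v [^]\<^bsub>AutoGroup N\<^esub> n"
      if x: "x \<in> carrier (AutoGroup N)" and central: "G.centralizes u ?l d x" for x
    proof -
      have xa: "x \<in> auto N" using x by (simp add: carrier_AutoGroup)
      interpret x: group_hom N N x using xa by (rule auto_hom)
      have xu: "x (u y) = u (x y)" and xd: "x (d y) = d (x y)" and xv: "x (?v y) = ?v (x y)"
        if y: "y \<in> carrier N" for y
        using central mult_AutoGroup[OF xa u(1) y] mult_AutoGroup[OF u(1) xa y]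
          mult_AutoGroup[OF xa d(1) y] mult_AutoGroup[OF d(1) xa y]
          mult_AutoGroup[OF xa v y] mult_AutoGroup[OF v xa y]
        unfolding G.centralizes_def comm_ul by simp_all
      define k where "k = expo 1 (x (gen 1))"
      \<comment> \<open>Commuting with \<open>v\<close> at \<open>y\<close> compares the central
        factors added before and after applying \<open>x\<close>.\<close>
      have c1: "x c [^] expo 1 y = c [^] expo 1 (x y)" if y: "y \<in> carrier N" for y
      proof -
        have "x y \<otimes> x c [^] (- expo 1 y) = x y \<otimes> c [^] (- expo 1 (x y))"
          using xv[OF y] y by (simp add: transvect_apply x.hom_int_pow)
        then have "x c [^] (- expo 1 y) = c [^] (- expo 1 (x y))"
          using y by simp
        then have "inv (inv (x c [^] expo 1 y)) = inv (inv (c [^] expo 1 (x y)))"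
          by (simp add: int_pow_neg)
        then show ?thesis by simp
      qed
      have xc: "x c = c [^] k"
        using c1[of "gen 1"] rank by (simp add: k_def expo)
      have e1: "expo 1 (x y) = k * expo 1 y" if y: "y \<in> carrier N" for y
        using c1[OF y] unfolding xc by (simp add: int_pow_pow c_int_pow_eq_iff mult.commute)
      \<comment> \<open>By surjectivity some \<open>x y\<close> equals \<open>gen 1\<close>, so
        \<open>k\<close> divides 1.\<close>
      have kk: "k * k = 1"
      proof -
        have "gen 1 \<in> x ` carrier N"
          using xa by (simp add: auto_iff bij_betw_def)
        then obtain y where "y \<in> carrier N" "gen 1 = x y" by blast
        then have "k * expo 1 y = 1" using e1[of y] expo(2)[of 1 1] rank by simp
        then have "k = 1 \<or> k = - 1" by (metis zmult_eq_1_iff)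
        then show ?thesis by auto
      qed
      \<comment> \<open>Forced by the identity \<open>e0\<close> at \<open>gen 1\<close>, where it
        reads n * k = \<open>expo 0 (x (gen 1))\<close>; \<open>k\<close> is its own
        inverse.\<close>
      define n where "n = k * expo 0 (x (gen 1))"
      have e0: "k * expo 0 y = expo 0 (x y) - n * expo 1 (x y)" if "y \<in> carrier N" for y
      proof (rule int_hom_eqI[OF _ _ _ that])
        fix i assume i: "i < r"
        consider "i = 0" | "i = 1" | "2 \<le> i" by linarith
        then show "k * expo 0 (gen i) = expo 0 (x (gen i)) - n * expo 1 (x (gen i))"
        proof cases
          case 1
          \<comment> \<open>Commuting with \<open>u\<close> at \<open>gen 1\<close> adds
            \<open>expo 0 (x (gen 0))\<close> on one side and \<open>k\<close> on the other.\<close>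
          have "expo 0 (x (u (gen 1))) = expo 0 (u (x (gen 1)))" by (simp add: xu)
          also have "\<dots> = expo 0 (x (gen 1)) + k"
            using expo0_u[of "x (gen 1)"] by (simp add: k_def)
          finally have "expo 0 (x (gen 0)) = k" using u(2) by simp
          then show ?thesis using 1 e1[of "gen 0"] i by (simp add: expo)
        next
          case 2
          have "n * k = expo 0 (x (gen 1)) * (k * k)" by (simp add: n_def)
          moreover have "expo 0 (gen 1) = 0" using rank by (simp add: expo)
          ultimately show ?thesis unfolding 2 k_def[symmetric] kk by simp
        next
          case 3
          \<comment> \<open>\<open>d\<close> inverts \<open>gen i\<close> but preserves
            \<open>expo 0\<close>, so this exponent equals its negative.\<close>
          have "expo 0 (x (d (gen i))) = expo 0 (x (gen i))"
            using xd[of "gen i"] expo_d[of "x (gen i)" 0] i by simp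
          then have "expo 0 (x (gen i)) = 0"
            using d(3)[OF i 3] i by (simp add: expo.hom_inv)
          then show ?thesis using 3 i e1[of "gen i"] by (simp add: expo)
        qed
      qed (auto simp: algebra_simps)
      \<comment> \<open>Hence \<open>x\<close> conjugates \<open>l\<close> to
        \<open>transvect 1 (- n)\<close>, so its commutator with \<open>l\<close> is
        \<open>transvect 0 (- n)\<close>, the n-th power of \<open>v\<close>.\<close>
      have "x (?l y) = transvect 1 (- n) (x y)" if y: "y \<in> carrier N" for y
      proof -
        have "x (?l y) = x y \<otimes> (c [^] k) [^] expo 0 y"
          using y by (simp add: transvect_apply x.hom_int_pow xc)
        also have "(c [^] k) [^] expo 0 y = c [^] (expo 0 (x y) - n * expo 1 (x y))"
          unfolding e0[OF y, symmetric] by (simp add: int_pow_pow mult.commute)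
        finally show ?thesis using y by (simp add: transvect_apply)
      qed
      moreover have lx: "?l \<otimes>\<^bsub>AutoGroup N\<^esub> x \<in> auto N"
        using G.m_closed xa l unfolding carrier_AutoGroup by blast
      ultimately have "x \<otimes>\<^bsub>AutoGroup N\<^esub> ?l = transvect 0 (- n) \<otimes>\<^bsub>AutoGroup N\<^esub> (?l \<otimes>\<^bsub>AutoGroup N\<^esub> x)"
        by (intro mult_AutoGroup_eqI[OF xa l transvect_auto lx])
          (simp add: mult_AutoGroup[OF l xa] transvect_transvect)
      then have "G.comm x ?l = ?v [^]\<^bsub>AutoGroup N\<^esub> n"
        unfolding transvect_int_pow using G.comm_eq_iff xa l transvect_auto
        unfolding carrier_AutoGroup by blast
      then show ?thesis by blast
    qed
  qed
  then show ?thesis by blast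
qed

end

lemma fg_free_nilpotent_groupE:
  assumes "fg_free_nilpotent_group N s" "2 \<le> s"
  obtains r :: nat and \<pi> where "free_nilpotent N r s \<pi>"
proof -
  obtain r :: nat where N: "group N" and r: "2 \<le> r"
    and iso: "N \<cong> free_group {..<r} Mod lower_central (free_group {..<r}) (s + 1)"
    using assms(1) unfolding fg_free_nilpotent_group_def by blast
  let ?F = "free_group {..<r}"
  let ?K = "lower_central ?F (Suc s)"
  interpret F: group ?F by (rule group_free_group)
  interpret N: group N by fact
  interpret K: normal ?K ?F by (rule F.lower_central_normal)
  have Q: "group (?F Mod ?K)" by (rule K.factorgroup_is_group)
  obtain h where "h \<in> iso N (?F Mod ?K)" using iso unfolding is_iso_def by auto
  then obtain g where g: "g \<in> iso (?F Mod ?K) N" using N.iso_set_sym by blast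
  then have g_hom: "g \<in> hom (?F Mod ?K) N" and g_bij: "bij_betw g (carrier (?F Mod ?K)) (carrier N)"
    by (simp_all add: iso_def)
  \<comment> \<open>The quotient map followed by an isomorphism of the quotient with
    \<open>N\<close>; its kernel consists of the \<open>w\<close> whose coset is
    \<open>?K\<close>.\<close>
  define \<pi> where "\<pi> = g \<circ> (\<lambda>a. ?K #>\<^bsub>?F\<^esub> a)"
  have \<pi>_eq_one: "\<pi> w = \<one>\<^bsub>N\<^esub> \<longleftrightarrow> ?K #>\<^bsub>?F\<^esub> w = ?K" if "w \<in> carrier ?F" for w
  proof -
    have K: "?K #>\<^bsub>?F\<^esub> w \<in> carrier (?F Mod ?K)" "?K \<in> carrier (?F Mod ?K)"
      using that monoid.one_closed[OF group.is_monoid[OF Q]] by (simp_all add: carrier_FactGroup)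
    have "g ?K = \<one>\<^bsub>N\<^esub>" using hom_one[OF g_hom Q N] by simp
    then have "\<pi> w = \<one>\<^bsub>N\<^esub> \<longleftrightarrow> g (?K #>\<^bsub>?F\<^esub> w) = g ?K" by (simp add: \<pi>_def)
    also have "\<dots> \<longleftrightarrow> ?K #>\<^bsub>?F\<^esub> w = ?K"
      using bij_betw_imp_inj_on[OF g_bij] K by (rule inj_on_eq_iff)
    finally show ?thesis .
  qed
  have "free_nilpotent N r s \<pi>"
  proof (intro free_nilpotent.intro free_nilpotent_axioms.intro)
    show "\<pi> \<in> hom ?F N"
      unfolding \<pi>_def by (rule hom_compose[OF K.r_coset_hom_Mod g_hom])
    show "\<pi> ` carrier ?F = carrier N"
      unfolding \<pi>_def image_comp[symmetric] carrier_FactGroup[symmetric]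
      using g_bij by (rule bij_betw_imp_surj_on)
    fix w
    show "w \<in> ?K" if "w \<in> carrier ?F" "\<pi> w = \<one>\<^bsub>N\<^esub>"
      by (rule F.coset_join1[OF _ that(1) K.subgroup_axioms]) (use that \<pi>_eq_one in simp)
    show "\<pi> w = \<one>\<^bsub>N\<^esub>" if "w \<in> ?K"
    proof -
      have "w \<in> carrier ?F" using that K.subset by blast
      then show ?thesis using \<pi>_eq_one F.coset_join2[OF _ K.subgroup_axioms that] by simp
    qed
  qed (use N r assms(2) in simp_all)
  then show thesis by (rule that)
qed

theorem theorem3p6:
  fixes N :: "('a, 'b) monoid_scheme" and s :: nat
  assumes "fg_free_nilpotent_group N s" and "s \<ge> 2"
  shows "unstable (fo_theory (AutoGroup N)) \<and> \<not> decidable (fo_theory (AutoGroup N))"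
proof -
  obtain r \<pi> where "free_nilpotent N r s \<pi>"
    using assms by (rule fg_free_nilpotent_groupE)
  then obtain u l d where "malcev (AutoGroup N) u l d"
    using free_nilpotent.malcev_AutoGroup by blast
  then show ?thesis by (simp add: malcev.unstable malcev.not_decidable)
qed

end
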